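(* Let \[\begin{array}{ccc} L&\xrightarrow{\ f\ }&H\\ {\scriptstyle\chi}\downarrow&&\downarrow{\scriptstyle\eta}\\ M&\xrightarrow{\ f'\ }&I\end{array}\] be a commutative diagram of morphisms of differential graded Lie algebras over $\mathbb{C}$. If the induced morphism of suspended mapping cones $C_\chi\to C_\eta$, $(l,m)\mapsto(f(l),f'(m))$, is a quasi-isomorphism, then the induced natural transformation of functors $\mathrm{Def}_\chi\to\mathrm{Def}_\eta$ is an isomorphism.
   Context: DGLA means differential $\mathbb{Z}$-graded Lie algebra over $\mathbb{C}$. $\mathbf{Art}$ is the category of local Artinian $\mathbb{C}$-algebras $(A,\mathfrak{m})$ with residue field $\mathbb{C}$. For a DGLA $K$, $K\otimes\mathfrak{m}$ has $d(v\otimes a)=d(v)\otimes a$, $[v\otimes a,w\otimes b]=[v,w]\otimes ab$; $\exp(K^0\otimes\mathfrak{m})=\{e^a\}$ is the exponential group of the nilpotent Lie algebra $K^0\otimes\mathfrak{m}$ (product given by Baker–Campbell–Hausdorff), and \[ e^a\ast w=w+\sum_{n\ge0}\frac{[a,-]^n}{(n+1)!}([a,w]-da),\qquad a\in K^0\otimes\mathfrak{m},\ w\in K^1\otimes\mathfrak{m}.\] For a DGLA morphism $\chi\colon L\to M$, the suspended mapping cone is the complex $C_\chi^i=L^i\oplus M^{i-1}$ with $\delta(l,m)=(dl,\chi(l)-dm)$. The functor $\mathrm{Def}_\chi\colon\mathbf{Art}\to\mathbf{Set}$ is defined by \[\mathrm{MC}_\chi(A)=\{(x,e^a)\in(L^1\otimes\mathfrak{m})\times\exp(M^0\otimes\mathfrak{m})\mid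 dx+\tfrac12[x,x]=0,\ e^a\ast\chi(x)=0\},\] \[\mathrm{Def}_\chi(A)=\mathrm{MC}_\chi(A)/\big(\exp(L^0\otimes\mathfrak{m})\times\exp(dM^{-1}\otimes\mathfrak{m})\big),\] the action being $(e^l,e^{dm})\ast(x,e^a)=(e^l\ast x,e^{dm}e^ae^{-\chi(l)})$. The natural transformation $\mathrm{Def}_\chi\to\mathrm{Def}_\eta$ is induced by $(x,e^a)\mapsto(f(x),e^{f'(a)})$. *)

theory Defs
  imports Complex_Main "HOL-Library.Poly_Mapping" "HOL-Library.Product_Plus"
begin

section \<open>Complex vector spaces\<close>

class complex_vector = ab_group_add +
  fixes scaleC :: "complex \<Rightarrow> 'a \<Rightarrow> 'a" (infixr \<open>*\<^sub>C\<close> 75)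
  assumes scaleC_add_right: "a *\<^sub>C (x + y) = a *\<^sub>C x + a *\<^sub>C y"
    and scaleC_add_left: "(a + b) *\<^sub>C x = a *\<^sub>C x + b *\<^sub>C x"
    and scaleC_scaleC: "a *\<^sub>C b *\<^sub>C x = (a * b) *\<^sub>C x"
    and scaleC_one: "1 *\<^sub>C x = x"

interpretation cvec: vector_space "scaleC :: complex \<Rightarrow> 'a \<Rightarrow> 'a::complex_vector"
  by unfold_locales (rule scaleC_add_right scaleC_add_left scaleC_scaleC scaleC_one)+

abbreviation csubspace :: "'a::complex_vector set \<Rightarrow> bool"
  where "csubspace \<equiv> module.subspace scaleC"

abbreviation cspan :: "'a::complex_vector set \<Rightarrow> 'a set"
  where "cspan \<equiv> module.span scaleC"

abbreviation clinear :: "('a::complex_vector \<Rightarrow> 'b::complex_vector) \<Rightarrow> bool"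
  where "clinear \<equiv> Vector_Spaces.linear scaleC scaleC"

definition cbilinear ::
    "('a::complex_vector \<Rightarrow> 'b::complex_vector \<Rightarrow> 'c::complex_vector) \<Rightarrow> bool"
  where "cbilinear f \<longleftrightarrow> (\<forall>v. clinear (f v)) \<and> (\<forall>w. clinear (\<lambda>v. f v w))"

lemma clinear_iff:
  "clinear f \<longleftrightarrow> (\<forall>x y. f (x + y) = f x + f y) \<and> (\<forall>c x. f (c *\<^sub>C x) = c *\<^sub>C f x)"
proof
  assume "clinear f"
  then interpret Vector_Spaces.linear scaleC scaleC f .
  show "(\<forall>x y. f (x + y) = f x + f y) \<and> (\<forall>c x. f (c *\<^sub>C x) = c *\<^sub>C f x)"
    using add scale by blast
next
  assume "(\<forall>x y. f (x + y) = f x + f y) \<and> (\<forall>c x. f (c *\<^sub>C x) = c *\<^sub>C f x)"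
  then show "clinear f"
    by (intro Vector_Spaces.linear.intro module_hom.intro module_hom_axioms.intro
        cvec.vector_space_axioms cvec.module_axioms) auto
qed

instantiation complex :: complex_vector
begin
definition scaleC_complex :: "complex \<Rightarrow> complex \<Rightarrow> complex"
  where "scaleC_complex = (*)"
instance by standard (auto simp: scaleC_complex_def algebra_simps)
end

instantiation poly_mapping :: (type, complex_vector) complex_vector
begin
lift_definition scaleC_poly_mapping :: "complex \<Rightarrow> ('a \<Rightarrow>\<^sub>0 'b) \<Rightarrow> ('a \<Rightarrow>\<^sub>0 'b)"
  is "\<lambda>c p k. c *\<^sub>C p k"
  by (rule finite_subset) auto
instance
  by standard (transfer; auto simp: fun_eq_iff scaleC_add_right scaleC_add_left scaleC_scaleC scaleC_one)+
end

section \<open>Tensor products over the complex numbers\<close>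

text \<open>\<open>V \<otimes> W\<close> is the free vector space on \<open>V \<times> W\<close> modulo the bilinearity relations.\<close>

inductive_set tensor_relators ::
    "(('a::complex_vector \<times> 'b::complex_vector) \<Rightarrow>\<^sub>0 complex) set"
  where
    "Poly_Mapping.single (v + v', w) 1 - Poly_Mapping.single (v, w) 1
       - Poly_Mapping.single (v', w) 1 \<in> tensor_relators"
  | "Poly_Mapping.single (v, w + w') 1 - Poly_Mapping.single (v, w) 1
       - Poly_Mapping.single (v, w') 1 \<in> tensor_relators"
  | "Poly_Mapping.single (c *\<^sub>C v, w) 1 - c *\<^sub>C Poly_Mapping.single (v, w) 1 \<in> tensor_relators"
  | "Poly_Mapping.single (v, c *\<^sub>C w) 1 - c *\<^sub>C Poly_Mapping.single (v, w) 1 \<in> tensor_relators"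

definition tensor_rel ::
    "(('a::complex_vector \<times> 'b::complex_vector) \<Rightarrow>\<^sub>0 complex) \<Rightarrow> ('a \<times> 'b \<Rightarrow>\<^sub>0 complex) \<Rightarrow> bool"
  where "tensor_rel p q \<longleftrightarrow> p - q \<in> cspan tensor_relators"

lemma equivp_tensor_rel: "equivp tensor_rel"
proof (rule equivpI)
  show "reflp tensor_rel"
    by (rule reflpI) (simp add: tensor_rel_def cvec.span_zero)
  show "symp tensor_rel"
    by (rule sympI) (metis tensor_rel_def cvec.span_neg minus_diff_eq)
  show "transp tensor_rel"
    by (rule transpI) (metis (no_types, lifting) tensor_rel_def cvec.span_add diff_add_cancel add_diff_eq)
qed

quotient_type (overloaded) ('a, 'b) tensor =
    "('a::complex_vector \<times> 'b::complex_vector) \<Rightarrow>\<^sub>0 complex" / tensor_rel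
  by (rule equivp_tensor_rel)

type_notation tensor (infixr \<open>\<otimes>\<close> 75)

instantiation tensor :: (complex_vector, complex_vector) complex_vector
begin

lift_definition zero_tensor :: "'a \<otimes> 'b" is 0 .

lift_definition plus_tensor :: "'a \<otimes> 'b \<Rightarrow> 'a \<otimes> 'b \<Rightarrow> 'a \<otimes> 'b" is "(+)"
  unfolding tensor_rel_def by (metis add_diff_add cvec.span_add)

lift_definition uminus_tensor :: "'a \<otimes> 'b \<Rightarrow> 'a \<otimes> 'b" is uminus
  unfolding tensor_rel_def by (metis cvec.span_neg minus_diff_minus)

lift_definition minus_tensor :: "'a \<otimes> 'b \<Rightarrow> 'a \<otimes> 'b \<Rightarrow> 'a \<otimes> 'b" is "(-)"
  unfolding tensor_rel_def
  by (metis (no_types, lifting) cvec.span_diff add_diff_add diff_conv_add_uminus minus_diff_minus)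

lift_definition scaleC_tensor :: "complex \<Rightarrow> 'a \<otimes> 'b \<Rightarrow> 'a \<otimes> 'b" is scaleC
  unfolding tensor_rel_def by (metis cvec.span_scale cvec.scale_right_diff_distrib)

instance
proof
  fix a b c :: "'a \<otimes> 'b" and r s :: complex
  show "a + b + c = a + (b + c)"
    by transfer (simp add: tensor_rel_def add.assoc cvec.span_zero)
  show "a + b = b + a"
    by transfer (simp add: tensor_rel_def add.commute cvec.span_zero)
  show "0 + a = a"
    by transfer (simp add: tensor_rel_def cvec.span_zero)
  show "- a + a = 0"
    by transfer (simp add: tensor_rel_def cvec.span_zero)
  show "a - b = a + - b"
    by transfer (simp add: tensor_rel_def cvec.span_zero)
  show "r *\<^sub>C (a + b) = r *\<^sub>C a + r *\<^sub>C b"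
    by transfer (simp add: tensor_rel_def scaleC_add_right cvec.span_zero)
  show "(r + s) *\<^sub>C a = r *\<^sub>C a + s *\<^sub>C a"
    by transfer (simp add: tensor_rel_def scaleC_add_left cvec.span_zero)
  show "r *\<^sub>C s *\<^sub>C a = (r * s) *\<^sub>C a"
    by transfer (simp add: tensor_rel_def scaleC_scaleC cvec.span_zero)
  show "1 *\<^sub>C a = a"
    by transfer (simp add: tensor_rel_def scaleC_one cvec.span_zero)
qed

end

lift_definition pure_tensor :: "'a::complex_vector \<Rightarrow> 'b::complex_vector \<Rightarrow> 'a \<otimes> 'b"
    (infixr \<open>\<otimes>\<close> 75)
  is "\<lambda>v w. Poly_Mapping.single (v, w) 1" .

lemma cbilinear_pure_tensor: "cbilinear (\<otimes>)"
  unfolding cbilinear_def clinear_iff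
proof (intro conjI allI)
  fix v v' :: 'a and w w' :: 'b and c :: complex
  show "v \<otimes> (w + w') = v \<otimes> w + v \<otimes> w'"
    by transfer
      (metis tensor_rel_def cvec.span_base tensor_relators.intros(2) diff_diff_add)
  show "v \<otimes> (c *\<^sub>C w) = c *\<^sub>C (v \<otimes> w)"
    by transfer (simp add: tensor_rel_def cvec.span_base tensor_relators.intros)
  show "(v + v') \<otimes> w = v \<otimes> w + v' \<otimes> w"
    by transfer
      (metis tensor_rel_def cvec.span_base tensor_relators.intros(1) diff_diff_add)
  show "(c *\<^sub>C v) \<otimes> w = c *\<^sub>C (v \<otimes> w)"
    by transfer (simp add: tensor_rel_def cvec.span_base tensor_relators.intros)
qed

lemma pure_tensor_linear:
  shows pure_tensor_add_left: "(v + v') \<otimes> w = v \<otimes> w + v' \<otimes> w"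
    and pure_tensor_add_right: "v \<otimes> (w + w') = v \<otimes> w + v \<otimes> w'"
    and pure_tensor_scale_left: "(c *\<^sub>C v) \<otimes> w = c *\<^sub>C (v \<otimes> w)"
    and pure_tensor_scale_right: "v \<otimes> (c *\<^sub>C w) = c *\<^sub>C (v \<otimes> w)"
  using cbilinear_pure_tensor unfolding cbilinear_def clinear_iff by metis+

text \<open>The linear map out of \<open>V \<otimes> W\<close> determined by a bilinear map (meaningful for bilinear
  \<open>f\<close> only).\<close>

definition tensor_lift ::
    "('a::complex_vector \<Rightarrow> 'b::complex_vector \<Rightarrow> 'c::complex_vector) \<Rightarrow> 'a \<otimes> 'b \<Rightarrow> 'c"
  where "tensor_lift f = (THE g. clinear g \<and> (\<forall>v w. g (v \<otimes> w) = f v w))"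


lemma clinear_eq_on_pure_tensors:
  assumes g: "clinear g" and h: "clinear h" and eq: "\<And>v w. g (v \<otimes> w) = h (v \<otimes> w)"
  shows "g = h"
proof
  fix t :: "'a \<otimes> 'b"
  interpret g: Vector_Spaces.linear scaleC scaleC g by (rule g)
  interpret h: Vector_Spaces.linear scaleC scaleC h by (rule h)
  obtain p where t: "t = abs_tensor p"
    by (metis Quotient_abs_rep Quotient_tensor)
  have abs_add: "abs_tensor (q + q') = abs_tensor q + (abs_tensor q' :: 'a \<otimes> 'b)" for q q'
    by (simp add: plus_tensor.abs_eq)
  have abs_sum: "abs_tensor (\<Sum>k\<in>S. q k) = (\<Sum>k\<in>S. abs_tensor (q k) :: 'a \<otimes> 'b)"
    if "finite S" for S :: "('a \<times> 'b) set" and q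
    using that by (induction S) (auto simp: abs_add zero_tensor.abs_eq)
  have single: "abs_tensor (Poly_Mapping.single (v, w) c) = c *\<^sub>C (v \<otimes> w)" for v w c
  proof -
    have "Poly_Mapping.single (v, w) c = c *\<^sub>C Poly_Mapping.single (v, w) (1 :: complex)"
      by (rule poly_mapping_eqI)
        (simp add: scaleC_poly_mapping.rep_eq scaleC_complex_def lookup_single when_def)
    then show ?thesis
      by (simp add: scaleC_tensor.abs_eq pure_tensor.abs_eq)
  qed
  have "t = (\<Sum>k\<in>Poly_Mapping.keys p. abs_tensor (Poly_Mapping.single k (Poly_Mapping.lookup p k)))"
  proof -
    have "(\<Sum>k\<in>Poly_Mapping.keys p. Poly_Mapping.single k (Poly_Mapping.lookup p k)) = p"
      by (rule poly_mapping_eqI)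
        (auto simp: lookup_sum lookup_single when_def sum.delta in_keys_iff)
    then show ?thesis
      unfolding t by (metis abs_sum finite_keys)
  qed
  also have "\<dots> = (\<Sum>k\<in>Poly_Mapping.keys p. Poly_Mapping.lookup p k *\<^sub>C (fst k \<otimes> snd k))"
    by (intro sum.cong refl) (metis single prod.collapse)
  finally have t': "t = (\<Sum>k\<in>Poly_Mapping.keys p. Poly_Mapping.lookup p k *\<^sub>C (fst k \<otimes> snd k))" .
  show "g t = h t"
    unfolding t' by (simp add: g.sum h.sum g.scale h.scale eq)
qed

lemma tensor_lift_exists:
  assumes "cbilinear f"
  shows "\<exists>g. clinear g \<and> (\<forall>v w. g (v \<otimes> w) = f v w)"
proof -
  have f: "f (v + v') w = f v w + f v' w" "f v (w + w') = f v w + f v w'"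
      "f (c *\<^sub>C v) w = c *\<^sub>C f v w" "f v (c *\<^sub>C w) = c *\<^sub>C f v w" for v v' w w' c
    using assms unfolding cbilinear_def clinear_iff by auto
  define ev where "ev p = (\<Sum>k\<in>Poly_Mapping.keys p. Poly_Mapping.lookup p k *\<^sub>C f (fst k) (snd k))"
    for p :: "'a \<times> 'b \<Rightarrow>\<^sub>0 complex"
  have ev: "ev p = (\<Sum>k\<in>S. Poly_Mapping.lookup p k *\<^sub>C f (fst k) (snd k))"
    if "finite S" "Poly_Mapping.keys p \<subseteq> S" for p S
    unfolding ev_def using that
    by (intro sum.mono_neutral_left) (auto simp: in_keys_iff)
  have add: "ev (p + q) = ev p + ev q" for p q
  proof -
    let ?S = "Poly_Mapping.keys p \<union> Poly_Mapping.keys q"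
    have "ev (p + q) = (\<Sum>k\<in>?S. Poly_Mapping.lookup (p + q) k *\<^sub>C f (fst k) (snd k))"
      by (intro ev) (simp_all add: keys_add)
    moreover have "ev p = (\<Sum>k\<in>?S. Poly_Mapping.lookup p k *\<^sub>C f (fst k) (snd k))"
      "ev q = (\<Sum>k\<in>?S. Poly_Mapping.lookup q k *\<^sub>C f (fst k) (snd k))"
      by (intro ev; auto)+
    ultimately show ?thesis
      by (simp add: lookup_add scaleC_add_left sum.distrib)
  qed
  have scale: "ev (c *\<^sub>C p) = c *\<^sub>C ev p" for c p
  proof -
    have "ev (c *\<^sub>C p) = (\<Sum>k\<in>Poly_Mapping.keys p. Poly_Mapping.lookup (c *\<^sub>C p) k *\<^sub>C f (fst k) (snd k))"
      by (intro ev)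
        (auto simp: in_keys_iff scaleC_poly_mapping.rep_eq scaleC_complex_def)
    then show ?thesis
      by (simp add: ev_def scaleC_poly_mapping.rep_eq scaleC_complex_def scaleC_scaleC
          cvec.scale_sum_right)
  qed
  have lin: "clinear ev"
    unfolding clinear_iff using add scale by blast
  interpret ev: Vector_Spaces.linear scaleC scaleC ev by (rule lin)
  have single: "ev (Poly_Mapping.single (v, w) 1) = f v w" for v w
    by (simp add: ev_def scaleC_one)
  have zero: "ev r = 0" if "r \<in> tensor_relators" for r
    using that by cases (simp_all add: ev.diff ev.scale single f)
  have span_zero: "ev r = 0" if "r \<in> cspan tensor_relators" for r
    using ev.eq_0_on_span[OF _ that] zero by blast
  define g where "g t = ev (rep_tensor t)" for t
  have g_abs: "g (abs_tensor p) = ev p" for p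
  proof -
    have "tensor_rel (rep_tensor (abs_tensor p)) p"
      by (metis Quotient_tensor Quotient_rep_abs equivp_reflp equivp_tensor_rel)
    then have "ev (rep_tensor (abs_tensor p) - p) = 0"
      by (intro span_zero) (simp add: tensor_rel_def)
    then show ?thesis by (simp add: g_def ev.diff)
  qed
  have abs_ex: "\<exists>p. t = abs_tensor p" for t :: "'a \<otimes> 'b"
    by (metis Quotient_abs_rep Quotient_tensor)
  have "clinear g"
    unfolding clinear_iff
  proof (intro conjI allI)
    fix s t :: "'a \<otimes> 'b" and c
    obtain p q where "s = abs_tensor p" "t = abs_tensor q"
      using abs_ex by metis
    then show "g (s + t) = g s + g t" "g (c *\<^sub>C s) = c *\<^sub>C g s"
      by (simp_all add: plus_tensor.abs_eq scaleC_tensor.abs_eq g_abs add scale)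
  qed
  moreover have "g (v \<otimes> w) = f v w" for v w
    by (simp add: pure_tensor.abs_eq g_abs single)
  ultimately show ?thesis by blast
qed

lemma
  assumes "cbilinear f"
  shows clinear_tensor_lift: "clinear (tensor_lift f)"
    and tensor_lift_pure: "tensor_lift f (v \<otimes> w) = f v w"
proof -
  have "\<exists>!g. clinear g \<and> (\<forall>v w. g (v \<otimes> w) = f v w)"
    using tensor_lift_exists[OF assms] by (metis clinear_eq_on_pure_tensors)
  then have "clinear (tensor_lift f) \<and> (\<forall>v w. tensor_lift f (v \<otimes> w) = f v w)"
    unfolding tensor_lift_def by (rule theI')
  then show "clinear (tensor_lift f)" "tensor_lift f (v \<otimes> w) = f v w"
    by auto
qed

lemma tensor_lift_add:
  assumes "cbilinear f" "cbilinear g"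
  shows "tensor_lift (\<lambda>v w. f v w + g v w) t = tensor_lift f t + tensor_lift g t"
proof -
  have bil: "cbilinear (\<lambda>v w. f v w + g v w)"
    using assms by (simp add: cbilinear_def clinear_iff scaleC_add_right algebra_simps)
  have "tensor_lift (\<lambda>v w. f v w + g v w) = (\<lambda>t. tensor_lift f t + tensor_lift g t)"
  proof (rule clinear_eq_on_pure_tensors)
    show "clinear (tensor_lift (\<lambda>v w. f v w + g v w))"
      by (rule clinear_tensor_lift[OF bil])
    show "clinear (\<lambda>t. tensor_lift f t + tensor_lift g t)"
      using assms[THEN clinear_tensor_lift]
      by (simp add: clinear_iff scaleC_add_right algebra_simps)
  qed (simp add: tensor_lift_pure assms bil)
  then show ?thesis by metis
qed

lemma tensor_lift_scale:
  assumes "cbilinear f"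
  shows "tensor_lift (\<lambda>v w. c *\<^sub>C f v w) t = c *\<^sub>C tensor_lift f t"
proof -
  have bil: "cbilinear (\<lambda>v w. c *\<^sub>C f v w)"
    using assms
    by (simp add: cbilinear_def clinear_iff scaleC_add_right scaleC_scaleC mult.commute)
  have "tensor_lift (\<lambda>v w. c *\<^sub>C f v w) = (\<lambda>t. c *\<^sub>C tensor_lift f t)"
  proof (rule clinear_eq_on_pure_tensors)
    show "clinear (tensor_lift (\<lambda>v w. c *\<^sub>C f v w))"
      by (rule clinear_tensor_lift[OF bil])
    show "clinear (\<lambda>t. c *\<^sub>C tensor_lift f t)"
      using assms[THEN clinear_tensor_lift]
      by (simp add: clinear_iff scaleC_add_right scaleC_scaleC mult.commute)
  qed (simp add: tensor_lift_pure assms bil)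
  then show ?thesis by metis
qed

definition tensor_map ::
    "('a::complex_vector \<Rightarrow> 'c::complex_vector) \<Rightarrow> ('b::complex_vector \<Rightarrow> 'd::complex_vector)
      \<Rightarrow> 'a \<otimes> 'b \<Rightarrow> 'c \<otimes> 'd"
  where "tensor_map f g = tensor_lift (\<lambda>v w. f v \<otimes> g w)"

lemma
  assumes "clinear f" "clinear g"
  shows clinear_tensor_map: "clinear (tensor_map f g)"
    and tensor_map_pure: "tensor_map f g (v \<otimes> w) = f v \<otimes> g w"
proof -
  have "cbilinear (\<lambda>v w. f v \<otimes> g w)"
    using assms by (simp add: cbilinear_def clinear_iff pure_tensor_linear)
  then show "clinear (tensor_map f g)" "tensor_map f g (v \<otimes> w) = f v \<otimes> g w"
    unfolding tensor_map_def by (rule clinear_tensor_lift, rule tensor_lift_pure)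
qed

text \<open>For subspaces \<open>V\<close> and \<open>W\<close> this is \<open>V \<otimes> W\<close>, which embeds into the tensor
  product of the ambient spaces because the ground ring is a field.\<close>

definition tensor_subspace ::
    "'a::complex_vector set \<Rightarrow> 'b::complex_vector set \<Rightarrow> ('a \<otimes> 'b) set"
  where "tensor_subspace V W = cspan {v \<otimes> w | v w. v \<in> V \<and> w \<in> W}"

section \<open>Local Artinian algebras with residue field the complex numbers\<close>

class complex_comm_algebra = complex_vector + comm_ring_1 +
  assumes scaleC_mult_left: "(c *\<^sub>C x) * y = c *\<^sub>C (x * y)"

context comm_ring_1
begin

definition ring_ideal :: "'a set \<Rightarrow> bool"
  where "ring_ideal J \<longleftrightarrow>
    0 \<in> J \<and> (\<forall>x\<in>J. \<forall>y\<in>J. x + y \<in> J) \<and> (\<forall>r. \<forall>x\<in>J. r * x \<in> J)"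

definition maximal_ideal :: "'a set \<Rightarrow> bool"
  where "maximal_ideal N \<longleftrightarrow>
    ring_ideal N \<and> N \<noteq> UNIV \<and> (\<forall>J. ring_ideal J \<and> N \<subseteq> J \<longrightarrow> J = N \<or> J = UNIV)"

end

text \<open>The last axiom says that the structure map from the complex numbers to the residue field
  is bijective.\<close>

class local_artinian = complex_comm_algebra +
  assumes local: "\<exists>!N::'a set. maximal_ideal N"
    and artinian: "\<And>J :: nat \<Rightarrow> 'a set. (\<And>n. ring_ideal (J n)) \<Longrightarrow> (\<And>n. J (Suc n) \<subseteq> J n)
      \<Longrightarrow> \<exists>k. \<forall>n\<ge>k. J n = J k"
    and residue_field: "\<And>(N::'a set) x. maximal_ideal N \<Longrightarrow> \<exists>!c. x - c *\<^sub>C 1 \<in> N"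

definition max_ideal :: "'a::local_artinian set"
  where "max_ideal = (THE N. maximal_ideal N)"

lemma maximal_ideal_max_ideal: "maximal_ideal max_ideal"
  unfolding max_ideal_def using local by (rule theI')

definition algebra_hom :: "('a::complex_comm_algebra \<Rightarrow> 'b::complex_comm_algebra) \<Rightarrow> bool"
  where "algebra_hom \<phi> \<longleftrightarrow> clinear \<phi> \<and> \<phi> 1 = 1 \<and> (\<forall>x y. \<phi> (x * y) = \<phi> x * \<phi> y)"

section \<open>Differential graded Lie algebras\<close>

record 'v dgla_data =
  deg :: "int \<Rightarrow> 'v set"
  brk :: "'v \<Rightarrow> 'v \<Rightarrow> 'v"
  dif :: "'v \<Rightarrow> 'v"

text \<open>The underlying type is the total space, i.e. the internal direct sum of the
  homogeneous components \<open>deg K i\<close>.\<close>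

locale dgla =
  fixes K :: "'v::complex_vector dgla_data"
  assumes deg_subspace: "csubspace (deg K i)"
    and deg_direct_sum:
      "\<exists>!c :: int \<Rightarrow> 'v. (\<forall>i. c i \<in> deg K i) \<and> finite {i. c i \<noteq> 0} \<and> v = Sum_any c"
    and brk_bilinear: "cbilinear (brk K)"
    and brk_deg: "x \<in> deg K i \<Longrightarrow> y \<in> deg K j \<Longrightarrow> brk K x y \<in> deg K (i + j)"
    and brk_skew: "x \<in> deg K i \<Longrightarrow> y \<in> deg K j \<Longrightarrow>
      brk K x y = - ((-1) powi (i * j) *\<^sub>C brk K y x)"
    and brk_jacobi: "x \<in> deg K i \<Longrightarrow> y \<in> deg K j \<Longrightarrow> z \<in> deg K k \<Longrightarrow>
      brk K x (brk K y z) = brk K (brk K x y) z + (-1) powi (i * j) *\<^sub>C brk K y (brk K x z)"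
    and dif_linear: "clinear (dif K)"
    and dif_deg: "x \<in> deg K i \<Longrightarrow> dif K x \<in> deg K (i + 1)"
    and dif_dif: "dif K (dif K x) = 0"
    and dif_brk: "x \<in> deg K i \<Longrightarrow>
      dif K (brk K x y) = brk K (dif K x) y + (-1) powi i *\<^sub>C brk K x (dif K y)"

definition dgla_hom ::
    "'v::complex_vector dgla_data \<Rightarrow> 'w::complex_vector dgla_data \<Rightarrow> ('v \<Rightarrow> 'w) \<Rightarrow> bool"
  where "dgla_hom K K' f \<longleftrightarrow> clinear f
    \<and> (\<forall>i. f ` deg K i \<subseteq> deg K' i)
    \<and> (\<forall>x y. f (brk K x y) = brk K' (f x) (f y))
    \<and> (\<forall>x. f (dif K x) = dif K' (f x))"

section \<open>Cohomology and suspended mapping cones\<close>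

text \<open>The map induced by \<open>g\<close> on quotients; \<open>r\<close> is the equivalence relation on the target.
  If \<open>g\<close> respects the relations, the class of \<open>x\<close> goes to the class of \<open>g x\<close>.\<close>

definition quotient_map :: "('y \<times> 'y) set \<Rightarrow> ('x \<Rightarrow> 'y) \<Rightarrow> 'x set \<Rightarrow> 'y set"
  where "quotient_map r g X = r `` (g ` X)"

definition cocycles :: "(int \<Rightarrow> 'c::ab_group_add set) \<Rightarrow> ('c \<Rightarrow> 'c) \<Rightarrow> int \<Rightarrow> 'c set"
  where "cocycles C \<delta> i = {z \<in> C i. \<delta> z = 0}"

definition cohomologous :: "(int \<Rightarrow> 'c::ab_group_add set) \<Rightarrow> ('c \<Rightarrow> 'c) \<Rightarrow> int \<Rightarrow> ('c \<times> 'c) set"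
  where "cohomologous C \<delta> i =
    {(z, z'). z \<in> cocycles C \<delta> i \<and> z' \<in> cocycles C \<delta> i \<and> z - z' \<in> \<delta> ` C (i - 1)}"

definition cohomology :: "(int \<Rightarrow> 'c::ab_group_add set) \<Rightarrow> ('c \<Rightarrow> 'c) \<Rightarrow> int \<Rightarrow> 'c set set"
  where "cohomology C \<delta> i = cocycles C \<delta> i // cohomologous C \<delta> i"

definition quasi_isomorphism ::
    "(int \<Rightarrow> 'c::ab_group_add set) \<Rightarrow> ('c \<Rightarrow> 'c) \<Rightarrow> (int \<Rightarrow> 'e::ab_group_add set) \<Rightarrow> ('e \<Rightarrow> 'e)
      \<Rightarrow> ('c \<Rightarrow> 'e) \<Rightarrow> bool"
  where "quasi_isomorphism C \<delta> D \<epsilon> g \<longleftrightarrow>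
    (\<forall>i. bij_betw (quotient_map (cohomologous D \<epsilon> i) g) (cohomology C \<delta> i) (cohomology D \<epsilon> i))"

definition cone :: "'l::complex_vector dgla_data \<Rightarrow> 'm::complex_vector dgla_data \<Rightarrow> int \<Rightarrow> ('l \<times> 'm) set"
  where "cone L M i = deg L i \<times> deg M (i - 1)"

definition cone_dif ::
    "'l::complex_vector dgla_data \<Rightarrow> 'm::complex_vector dgla_data \<Rightarrow> ('l \<Rightarrow> 'm) \<Rightarrow> 'l \<times> 'm \<Rightarrow> 'l \<times> 'm"
  where "cone_dif L M \<chi> = (\<lambda>(l, m). (dif L l, \<chi> l - dif M m))"

section \<open>Gauge action and exponential group\<close>

text \<open>The operations of \<open>K \<otimes> A\<close>, with graded pieces \<open>K\<^sup>i \<otimes> \<mm>\<close>; so the pieces span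
  \<open>K \<otimes> \<mm>\<close>, not the whole type.\<close>

definition dgla_tensor ::
    "'k::complex_vector dgla_data \<Rightarrow> ('k \<otimes> 'a::local_artinian) dgla_data"
  where "dgla_tensor K =
    \<lparr>deg = \<lambda>i. tensor_subspace (deg K i) max_ideal,
     brk = \<lambda>s t. tensor_lift (\<lambda>v a. tensor_lift (\<lambda>w b. brk K v w \<otimes> (a * b)) t) s,
     dif = tensor_map (dif K) id\<rparr>"

lemma
  fixes K :: "'k::complex_vector dgla_data"
    and a b :: "'a::local_artinian" and s t :: "'k \<otimes> 'a"
  assumes "cbilinear (brk K)"
  shows cbilinear_brk_tensor:
      "cbilinear (brk (dgla_tensor K) :: 'k \<otimes> 'a \<Rightarrow> 'k \<otimes> 'a \<Rightarrow> 'k \<otimes> 'a)"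
    and brk_tensor_pure: "brk (dgla_tensor K) (v \<otimes> a) (w \<otimes> b) = brk K v w \<otimes> (a * b)"
proof -
  let ?F = "\<lambda>v a w b. brk K v w \<otimes> (a * b :: 'a)"
  let ?G = "\<lambda>t v a. tensor_lift (?F v a) t"
  have K: "brk K (x + y) z = brk K x z + brk K y z" "brk K x (y + z) = brk K x y + brk K x z"
    "brk K (c *\<^sub>C x) y = c *\<^sub>C brk K x y" "brk K x (c *\<^sub>C y) = c *\<^sub>C brk K x y" for x y z c
    using assms by (simp_all add: cbilinear_def clinear_iff)
  have mult: "x * (c *\<^sub>C y) = c *\<^sub>C (x * y)" for c and x y :: 'a
    by (metis mult.commute scaleC_mult_left)
  have F: "cbilinear (?F v a)" for v a
    by (simp add: cbilinear_def clinear_iff K pure_tensor_linear mult algebra_simps)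
  have G: "cbilinear (?G t)" for t
    unfolding cbilinear_def clinear_iff
    by (simp add: K pure_tensor_linear scaleC_mult_left distrib_right tensor_lift_add[OF F F]
        tensor_lift_scale[OF F])
  have brk: "brk (dgla_tensor K) s t = tensor_lift (?G t) s" for s t
    by (simp add: dgla_tensor_def)
  show "brk (dgla_tensor K) (v \<otimes> a) (w \<otimes> b) = brk K v w \<otimes> (a * b)"
    unfolding brk by (subst tensor_lift_pure[OF G]) (rule tensor_lift_pure[OF F])
  have "clinear (\<lambda>t. tensor_lift (?G t) s)" for s
  proof -
    have 1: "?G (t + t') = (\<lambda>v a. ?G t v a + ?G t' v a)"
      "?G (c *\<^sub>C t) = (\<lambda>v a. c *\<^sub>C ?G t v a)" for t t' c
      using clinear_tensor_lift[OF F] by (simp_all add: clinear_iff)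
    show ?thesis
      unfolding clinear_iff 1 by (simp add: tensor_lift_add[OF G G] tensor_lift_scale[OF G])
  qed
  moreover have "clinear (\<lambda>s. tensor_lift (?G t) s)" for t
    using clinear_tensor_lift[OF G] .
  ultimately show "cbilinear (brk (dgla_tensor K) :: 'k \<otimes> 'a \<Rightarrow> 'k \<otimes> 'a \<Rightarrow> 'k \<otimes> 'a)"
    unfolding cbilinear_def brk by blast
qed

text \<open>In \<open>gauge\<close> and \<open>bch\<close> below, \<open>Sum_any\<close> sums over the finitely many indices with
  nonzero summand; for arguments in \<open>K \<otimes> \<mm>\<close> there are only finitely many because
  \<open>\<mm>\<close> is nilpotent.\<close>

definition gauge :: "'v::complex_vector dgla_data \<Rightarrow> 'v \<Rightarrow> 'v \<Rightarrow> 'v"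
  where "gauge K a w =
    w + Sum_any (\<lambda>n. (1 / fact (n + 1)) *\<^sub>C (brk K a ^^ n) (brk K a w - dif K a))"

fun nested_brk :: "('v::zero \<Rightarrow> 'v \<Rightarrow> 'v) \<Rightarrow> 'v list \<Rightarrow> 'v" where
  "nested_brk br [] = 0"
| "nested_brk br [x] = x"
| "nested_brk br (x # y # zs) = br x (nested_brk br (y # zs))"

text \<open>The Baker--Campbell--Hausdorff series in Dynkin's form: the sum over
  \<open>n \<ge> 1\<close> and pairs \<open>(r\<^sub>1, s\<^sub>1), \<dots>, (r\<^sub>n, s\<^sub>n)\<close> with \<open>r\<^sub>i + s\<^sub>i > 0\<close> of
  \<open>(-1)\<^bsup>n-1\<^esup> / (n (\<Sum>(r\<^sub>i + s\<^sub>i)) (\<Prod> r\<^sub>i! s\<^sub>i!))\<close> times the right-nested bracket of the word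
  \<open>a\<^bsup>r\<^sub>1\<^esup> b\<^bsup>s\<^sub>1\<^esup> \<dots> a\<^bsup>r\<^sub>n\<^esup> b\<^bsup>s\<^sub>n\<^esup>\<close>.\<close>

definition bch :: "'v::complex_vector dgla_data \<Rightarrow> 'v \<Rightarrow> 'v \<Rightarrow> 'v"
  where "bch K a b = Sum_any (\<lambda>ps :: (nat \<times> nat) list.
    if ps \<noteq> [] \<and> (\<forall>(r, s) \<in> set ps. r + s > 0) then
      ((-1) ^ (length ps - 1) /
        (of_nat (length ps) * of_nat (\<Sum>(r, s)\<leftarrow>ps. r + s) * (\<Prod>(r, s)\<leftarrow>ps. fact r * fact s)))
      *\<^sub>C nested_brk (brk K) (concat (map (\<lambda>(r, s). replicate r a @ replicate s b) ps))
    else 0)"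

section \<open>The deformation functor of a morphism of DGLAs\<close>

text \<open>The group element \<open>e\<^bsup>a\<^esup>\<close> is represented by its exponent \<open>a\<close>, the group product being
  \<open>bch\<close>.\<close>

definition MC_cone ::
    "'l::complex_vector dgla_data \<Rightarrow> 'm::complex_vector dgla_data \<Rightarrow> ('l \<Rightarrow> 'm)
      \<Rightarrow> (('l \<otimes> 'a::local_artinian) \<times> ('m \<otimes> 'a)) set"
  where "MC_cone L M \<chi> = {(x, a).
    x \<in> deg (dgla_tensor L) 1 \<and> a \<in> deg (dgla_tensor M) 0
    \<and> dif (dgla_tensor L) x + (1/2) *\<^sub>C brk (dgla_tensor L) x x = 0
    \<and> gauge (dgla_tensor M) a (tensor_map \<chi> id x) = 0}"

definition cone_action ::
    "'l::complex_vector dgla_data \<Rightarrow> 'm::complex_vector dgla_data \<Rightarrow> ('l \<Rightarrow> 'm)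
      \<Rightarrow> ('l \<otimes> 'a::local_artinian) \<times> ('m \<otimes> 'a) \<Rightarrow> ('l \<otimes> 'a) \<times> ('m \<otimes> 'a)
      \<Rightarrow> ('l \<otimes> 'a) \<times> ('m \<otimes> 'a)"
  where "cone_action L M \<chi> = (\<lambda>(l, c) (x, a).
    (gauge (dgla_tensor L) l x,
     bch (dgla_tensor M) (bch (dgla_tensor M) c a) (- tensor_map \<chi> id l)))"

definition gauge_equivalent ::
    "'l::complex_vector dgla_data \<Rightarrow> 'm::complex_vector dgla_data \<Rightarrow> ('l \<Rightarrow> 'm)
      \<Rightarrow> ((('l \<otimes> 'a::local_artinian) \<times> ('m \<otimes> 'a)) \<times> (('l \<otimes> 'a) \<times> ('m \<otimes> 'a))) set"
  where "gauge_equivalent L M \<chi> = {(p, cone_action L M \<chi> g p) | p g.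
    p \<in> MC_cone L M \<chi>
    \<and> g \<in> tensor_subspace (deg L 0) max_ideal
          \<times> tensor_subspace (dif M ` deg M (-1)) max_ideal}"

definition Def ::
    "'l::complex_vector dgla_data \<Rightarrow> 'm::complex_vector dgla_data \<Rightarrow> ('l \<Rightarrow> 'm)
      \<Rightarrow> (('l \<otimes> 'a::local_artinian) \<times> ('m \<otimes> 'a)) set set"
  where "Def L M \<chi> = MC_cone L M \<chi> // gauge_equivalent L M \<chi>"

text \<open>The action of the functor on a morphism \<open>\<phi>\<close> of local Artinian algebras.\<close>

definition Def_mor ::
    "'l::complex_vector dgla_data \<Rightarrow> 'm::complex_vector dgla_data \<Rightarrow> ('l \<Rightarrow> 'm)
      \<Rightarrow> ('a::local_artinian \<Rightarrow> 'b::local_artinian)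
      \<Rightarrow> (('l \<otimes> 'a) \<times> ('m \<otimes> 'a)) set \<Rightarrow> (('l \<otimes> 'b) \<times> ('m \<otimes> 'b)) set"
  where "Def_mor L M \<chi> \<phi> =
    quotient_map (gauge_equivalent L M \<chi>) (map_prod (tensor_map id \<phi>) (tensor_map id \<phi>))"

text \<open>The natural transformation induced by \<open>(f, f')\<close>; its source is \<open>Def L M \<chi>\<close> for any
  \<open>\<chi>\<close> making the square commute, its target \<open>Def H I \<eta>\<close>.\<close>

definition Def_trans ::
    "'h::complex_vector dgla_data \<Rightarrow> 'i::complex_vector dgla_data \<Rightarrow> ('h \<Rightarrow> 'i)
      \<Rightarrow> ('l::complex_vector \<Rightarrow> 'h) \<Rightarrow> ('m::complex_vector \<Rightarrow> 'i)
      \<Rightarrow> (('l \<otimes> 'a::local_artinian) \<times> ('m \<otimes> 'a)) set \<Rightarrow> (('h \<otimes> 'a) \<times> ('i \<otimes> 'a)) set"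
  where "Def_trans H I \<eta> f f' =
    quotient_map (gauge_equivalent H I \<eta>) (map_prod (tensor_map f id) (tensor_map f' id))"

end

theory Submission
  imports Defs "HOL-Computational_Algebra.Formal_Power_Series" "HOL-Library.Function_Algebras"
begin

text \<open>The proof is an approximation argument along the powers of the maximal ideal \<open>\<mm>\<close>, which
  are eventually zero (\<open>max_power_nilpotent\<close>). Perturb a Maurer--Cartan element or a gauge
  transformation by something in \<open>\<mm>\<^sup>k\<close>. Then, modulo \<open>\<mm>\<^bsup>k+1\<^esup>\<close>, the gauge action, the group
  product and the curvature \<open>dx + [x, x]/2\<close> change in a linear way that involves only the
  differential and the morphisms (\<open>gauge_approx\<close>, \<open>bch_approx\<close>, \<open>curv_approx\<close>, \<open>Ad_approx\<close>).
  So each step from \<open>k\<close> to \<open>k + 1\<close> is a problem about the complex that combines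
  \<open>C\<^sub>\<chi>\<close> and \<open>C\<^sub>\<eta>\<close>, the mapping cone of \<open>C\<^sub>\<chi> \<rightarrow> C\<^sub>\<eta>\<close>, with coefficients
  in \<open>\<mm>\<^sup>k/\<mm>\<^bsup>k+1\<^esup>\<close>. By hypothesis this cone is acyclic. Over a field it then has a linear
  contraction, and a contraction survives tensoring (\<open>contraction\<close>, \<open>acyclic_tensor\<close>).

  Surjectivity (\<open>surjective_step\<close>). Let \<open>(y, b)\<close> be a Maurer--Cartan pair for \<open>\<eta>\<close> and \<open>(x, a)\<close>
  an approximate one for \<open>\<chi>\<close> whose image agrees with \<open>(y, b)\<close> modulo \<open>\<mm>\<^sup>k\<close>. Its defects
  \<open>dx + [x, x]/2\<close> and \<open>e\<^sup>a * \<chi>(x)\<close>, together with the difference from \<open>(y, b)\<close>, form a cocycle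
  modulo \<open>\<mm>\<^bsup>k+1\<^esup>\<close>: this is the Bianchi identity together with the fact that the curvature of
  \<open>e\<^sup>a * w\<close> is the curvature of \<open>w\<close> transformed by \<open>Ad e\<^sup>a\<close> (\<open>bianchi\<close>, \<open>curv_gauge\<close>). A
  cochain that bounds it improves \<open>(x, a)\<close> and moves \<open>(y, b)\<close> inside its gauge orbit so that both
  agree modulo \<open>\<mm>\<^bsup>k+1\<^esup>\<close>.

  Injectivity (\<open>injective_step\<close>). Suppose that \<open>g\<close> takes the image of \<open>p\<close> to the image of \<open>q\<close>,
  and that \<open>p - q\<close> and \<open>log g\<close> lie in \<open>\<mm>\<^sup>k\<close>. Then \<open>(q - p, log g)\<close> is a cocycle modulo
  \<open>\<mm>\<^bsup>k+1\<^esup>\<close>. A cochain that bounds it contains a gauge transformation that brings \<open>p\<close> closer to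
  \<open>q\<close>, but its image agrees with \<open>g\<close> only up to a boundary \<open>du\<close>. Here the group helps: if \<open>w\<close> is a
  Maurer--Cartan element, \<open>du + [w, u]\<close> generates gauge transformations that fix \<open>w\<close>
  (\<open>inner_stabilizer\<close>), so \<open>g\<close> can be corrected by an element of the stabilizer that agrees with
  \<open>du\<close> to leading order. After that all the data are in \<open>\<mm>\<^bsup>k+1\<^esup>\<close>.

  All of this uses the group \<open>exp(K\<^sup>0 \<otimes> \<mm>)\<close>, whose product is given by Dynkin's explicit
  series. The central fact is \<open>nexp_dynkin\<close>: for operators that generate a nilpotent algebra, the
  series is \<open>log(e\<^sup>X e\<^sup>Y)\<close>. In the presence of a grading operator \<open>D\<close> with \<open>[D, X] = X\<close> and
  \<open>[D, Y] = Y\<close> it is Dynkin's classical argument, which determines \<open>[D, log(e\<^sup>X e\<^sup>Y)]\<close>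
  (\<open>dynkin_graded\<close>); the general case follows by introducing a formal variable. The gauge action
  is the exponential of the adjoint action on \<open>K \<oplus> \<complex>d\<close>, where the differential is
  adjoined as an element; hence it is an action, and conjugating the operator \<open>[w + d, -]\<close> gives
  the transformation of curvature. Associativity of the product is read off
  from a faithful representation, which exists after replacing \<open>K\<^sup>0 \<otimes> \<mm>\<close> by its Rees algebra
  (\<open>dynkin_assoc\<close>, \<open>dynkin_conjugate\<close>).

  The arguments take place in an abstract filtered differential graded Lie algebra; the algebra
  \<open>K \<otimes> A\<close> with the filtration \<open>K\<^sup>i \<otimes> \<mm>\<^sup>k\<close> is the example of interest. A homomorphism of local Artinian
  algebras preserves this filtration, so it is a morphism of such filtered algebras just as
  \<open>f\<close> is, and naturality comes from applying the maps to representatives.\<close>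

section \<open>Linear maps and algebras over the complex numbers\<close>

text \<open>The class admits \<open>0 = 1\<close>, because the endomorphisms of the zero space must be
  an instance.\<close>

class complex_algebra = complex_vector + ring + monoid_mult +
  assumes mult_scaleC_left: "(c *\<^sub>C x) * y = c *\<^sub>C (x * y)"
    and mult_scaleC_right: "x * (c *\<^sub>C y) = c *\<^sub>C (x * y)"

lemmas scaleC_simps = scaleC_add_right scaleC_add_left scaleC_scaleC scaleC_one
  cvec.scale_zero_left cvec.scale_zero_right cvec.scale_minus_left cvec.scale_minus_right
  cvec.scale_right_diff_distrib cvec.scale_left_diff_distrib

lemma clinearI:
  "(\<And>x y. f (x + y) = f x + f y) \<Longrightarrow> (\<And>c x. f (c *\<^sub>C x) = c *\<^sub>C f x) \<Longrightarrow> clinear f"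
  by (simp add: clinear_iff)

lemma
  assumes "clinear f"
  shows clinear_add: "f (x + y) = f x + f y" and clinear_scale: "f (c *\<^sub>C x) = c *\<^sub>C f x"
    and clinear_zero: "f 0 = 0" and clinear_minus: "f (- x) = - f x"
    and clinear_diff: "f (x - y) = f x - f y" and clinear_sum: "f (sum g S) = (\<Sum>i\<in>S. f (g i))"
proof -
  interpret Vector_Spaces.linear scaleC scaleC f by (rule assms)
  show "f (x + y) = f x + f y" "f (c *\<^sub>C x) = c *\<^sub>C f x" "f 0 = 0" "f (- x) = - f x"
    "f (x - y) = f x - f y" "f (sum g S) = (\<Sum>i\<in>S. f (g i))"
    by (simp_all add: add scale zero neg diff sum)
qed

lemma
  assumes "csubspace S"
  shows csubspace_0: "0 \<in> S" and csubspace_add: "x \<in> S \<Longrightarrow> y \<in> S \<Longrightarrow> x + y \<in> S"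
    and csubspace_scale: "x \<in> S \<Longrightarrow> c *\<^sub>C x \<in> S" and csubspace_minus: "x \<in> S \<Longrightarrow> - x \<in> S"
    and csubspace_diff: "x \<in> S \<Longrightarrow> y \<in> S \<Longrightarrow> x - y \<in> S"
    and csubspace_sum: "(\<And>i. i \<in> I \<Longrightarrow> g i \<in> S) \<Longrightarrow> sum g I \<in> S"
  using assms by (auto intro: cvec.subspace_0 cvec.subspace_add cvec.subspace_scale cvec.subspace_neg
      cvec.subspace_diff cvec.subspace_sum)

lemma csubspaceI:
  "0 \<in> S \<Longrightarrow> (\<And>x y. x \<in> S \<Longrightarrow> y \<in> S \<Longrightarrow> x + y \<in> S) \<Longrightarrow> (\<And>c x. x \<in> S \<Longrightarrow> c *\<^sub>C x \<in> S) \<Longrightarrow> csubspace S"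
  unfolding cvec.subspace_def by blast

lemma clinear_cspan_subset:
  assumes "clinear f" "\<And>x. x \<in> B \<Longrightarrow> f x \<in> S" "csubspace S" "x \<in> cspan B"
  shows "f x \<in> S"
  using assms(4)
proof (induction rule: cvec.span_induct_alt)
  case base
  then show ?case using assms(1,3) by (simp add: clinear_zero csubspace_0)
next
  case (step c x y)
  then show ?case using assms
    by (simp add: clinear_add clinear_scale csubspace_add csubspace_scale)
qed

lemma clinear_eq_on_cspan:
  assumes "clinear f" "clinear g" "\<And>x. x \<in> B \<Longrightarrow> f x = g x" "x \<in> cspan B"
  shows "f x = g x"
  using assms(4)
  by (induction rule: cvec.span_induct_alt)
    (use assms in \<open>simp_all add: clinear_zero clinear_add clinear_scale\<close>)

section \<open>Functional calculus for nilpotent elements\<close>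

lemma sum_product_convolution:
  fixes a b :: "nat \<Rightarrow> 'a::ring"
  assumes "\<And>k. k \<ge> P \<Longrightarrow> a k = 0" "\<And>k. k \<ge> Q \<Longrightarrow> b k = 0"
  shows "(\<Sum>k<P. a k) * (\<Sum>j<Q. b j) = (\<Sum>n<P + Q. \<Sum>k\<le>n. a k * b (n - k))"
proof -
  have "(\<Sum>k<P. a k) * (\<Sum>j<Q. b j) = (\<Sum>(k, j)\<in>{..<P} \<times> {..<Q}. a k * b j)"
    by (simp add: sum_product sum.cartesian_product)
  also have "\<dots> = (\<Sum>(n, k)\<in>(SIGMA n:{..<P + Q}. {..n}). a k * b (n - k))"
  proof (rule sum.reindex_bij_witness_not_neutral
      [where S' = "{}" and T' = "{(n, k) \<in> (SIGMA n:{..<P + Q}. {..n}). \<not> (k < P \<and> n - k < Q)}"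
        and j = "\<lambda>(k, j). (k + j, k)" and i = "\<lambda>(n, k). (k, n - k)"])
    have "{(n, k) \<in> (SIGMA n:{..<P + Q}. {..n}). \<not> (k < P \<and> n - k < Q)}
        \<subseteq> (SIGMA n:{..<P + Q}. {..n})" by auto
    then show "finite {(n, k) \<in> (SIGMA n:{..<P + Q}. {..n}). \<not> (k < P \<and> n - k < Q)}"
      by (rule finite_subset) auto
  next
    fix x assume "x \<in> {(n, k) \<in> (SIGMA n:{..<P + Q}. {..n}). \<not> (k < P \<and> n - k < Q)}"
    then obtain n k where "x = (n, k)" "\<not> (k < P \<and> n - k < Q)" by auto
    then show "(case x of (n, k) \<Rightarrow> a k * b (n - k)) = 0"
      using assms(1)[of k] assms(2)[of "n - k"] by (cases "k < P") auto
  qed auto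
  also have "\<dots> = (\<Sum>n<P + Q. \<Sum>k\<le>n. a k * b (n - k))"
    by (simp add: sum.Sigma)
  finally show ?thesis .
qed

lemma scaleC_sum_left: "(\<Sum>i\<in>S. f i) *\<^sub>C x = (\<Sum>i\<in>S. f i *\<^sub>C (x::'a::complex_vector))"
  by (rule cvec.scale_sum_left)

lemma power_zero_ge: "(u::'a::complex_algebra) ^ N = 0 \<Longrightarrow> N \<le> n \<Longrightarrow> u ^ n = 0"
  by (metis le_add_diff_inverse mult_zero_left power_add)

text \<open>The value of a power series at a nilpotent element. For fixed nilpotent \<open>u\<close> this is a ring
  homomorphism compatible with substitution, so identities between \<open>exp\<close> and \<open>log\<close> as formal
  power series hold for nilpotent elements.\<close>

definition nil_eval :: "complex fps \<Rightarrow> 'a::complex_algebra \<Rightarrow> 'a"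
  where "nil_eval p u = Sum_any (\<lambda>n. fps_nth p n *\<^sub>C u ^ n)"

lemma nil_eval_eq:
  assumes "u ^ N = 0"
  shows "nil_eval p u = (\<Sum>n<N. fps_nth p n *\<^sub>C u ^ n)"
  unfolding nil_eval_def
  by (rule Sum_any.expand_superset)
    (use power_zero_ge[OF assms] in \<open>auto simp: not_less[symmetric]\<close>)

lemma nil_eval_mult:
  assumes "u ^ N = 0"
  shows "nil_eval (p * q) u = nil_eval p u * nil_eval q u"
proof -
  have 0: "u ^ (N + N) = 0" using power_zero_ge[OF assms, of "N + N"] by simp
  have "nil_eval p u * nil_eval q u
      = (\<Sum>n<N + N. \<Sum>k\<le>n. (fps_nth p k *\<^sub>C u ^ k) * (fps_nth q (n - k) *\<^sub>C u ^ (n - k)))"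
    unfolding nil_eval_eq[OF assms]
    by (rule sum_product_convolution) (simp_all add: power_zero_ge[OF assms])
  also have "\<dots> = (\<Sum>n<N + N. \<Sum>k\<le>n. (fps_nth p k * fps_nth q (n - k)) *\<^sub>C u ^ n)"
    by (intro sum.cong refl)
      (simp add: mult_scaleC_left mult_scaleC_right scaleC_scaleC mult.commute flip: power_add)
  also have "\<dots> = nil_eval (p * q) u"
    unfolding nil_eval_eq[OF 0] by (simp add: fps_mult_nth atMost_atLeast0 scaleC_sum_left)
  finally show ?thesis ..
qed

lemma nil_eval_1: "nil_eval 1 u = 1"
proof -
  have "nil_eval 1 u = (\<Sum>n\<in>{0}. fps_nth 1 n *\<^sub>C u ^ n)"
    unfolding nil_eval_def by (rule Sum_any.expand_superset) (auto split: if_splits)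
  then show ?thesis by (simp add: scaleC_one)
qed

lemma nil_eval_X: "nil_eval fps_X u = u"
proof -
  have "nil_eval fps_X u = (\<Sum>n\<in>{1}. fps_nth fps_X n *\<^sub>C u ^ n)"
    unfolding nil_eval_def by (rule Sum_any.expand_superset) (auto split: if_splits)
  then show ?thesis by (simp add: scaleC_one)
qed

lemma nil_eval_diff:
  assumes "u ^ N = 0"
  shows "nil_eval (p - q) u = nil_eval p u - nil_eval q u"
  by (simp add: nil_eval_eq[OF assms] cvec.scale_left_diff_distrib sum_subtractf)

lemma nil_eval_power:
  assumes "u ^ N = 0"
  shows "nil_eval (q ^ i) u = nil_eval q u ^ i"
  by (induction i) (simp_all add: nil_eval_1 nil_eval_mult[OF assms])

lemma nil_eval_nilpotent:
  assumes "u ^ N = 0" "fps_nth q 0 = 0"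
  shows "nil_eval q u ^ N = 0"
proof -
  have "nil_eval (q ^ N) u = 0"
    unfolding nil_eval_eq[OF assms(1)]
    using assms(2) by (intro sum.neutral) (auto simp: startsby_zero_power_prefix)
  then show ?thesis by (simp add: nil_eval_power[OF assms(1)])
qed

lemma nil_eval_compose:
  assumes "u ^ N = 0" "fps_nth q 0 = 0"
  shows "nil_eval (fps_compose p q) u = nil_eval p (nil_eval q u)"
proof -
  have "nil_eval p (nil_eval q u) = (\<Sum>i<N. fps_nth p i *\<^sub>C (\<Sum>n<N. fps_nth (q ^ i) n *\<^sub>C u ^ n))"
    unfolding nil_eval_eq[OF nil_eval_nilpotent[OF assms]] nil_eval_power[OF assms(1), symmetric]
    unfolding nil_eval_eq[OF assms(1)] ..
  also have "\<dots> = (\<Sum>n<N. \<Sum>i<N. (fps_nth p i * fps_nth (q ^ i) n) *\<^sub>C u ^ n)"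
    unfolding cvec.scale_sum_right by (subst sum.swap) (simp add: scaleC_scaleC)
  also have "\<dots> = (\<Sum>n<N. fps_nth (fps_compose p q) n *\<^sub>C u ^ n)"
  proof (intro sum.cong refl)
    fix n assume n: "n \<in> {..<N}"
    have "(\<Sum>i<N. fps_nth p i * fps_nth (q ^ i) n) = (\<Sum>i = 0..n. fps_nth p i * fps_nth (q ^ i) n)"
      using n assms(2) by (intro sum.mono_neutral_right) (auto simp: startsby_zero_power_prefix)
    then show "(\<Sum>i<N. (fps_nth p i * fps_nth (q ^ i) n) *\<^sub>C u ^ n)
        = fps_nth (fps_compose p q) n *\<^sub>C u ^ n"
      by (simp add: fps_compose_nth flip: scaleC_sum_left)
  qed
  finally show ?thesis by (simp add: nil_eval_eq[OF assms(1)])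
qed

abbreviation nexp :: "'a::complex_algebra \<Rightarrow> 'a" where "nexp \<equiv> nil_eval (fps_exp 1)"
abbreviation nlog :: "'a::complex_algebra \<Rightarrow> 'a" where "nlog x \<equiv> nil_eval (fps_ln 1) (x - 1)"

lemma nexp_minus_1: "u ^ N = 0 \<Longrightarrow> nexp u - 1 = nil_eval (fps_exp 1 - 1) u"
  by (simp add: nil_eval_diff nil_eval_1)

lemma fps_exp_ln_compose:
  "fps_compose (fps_ln 1) (fps_exp 1 - 1) = (fps_X :: complex fps)"
  "fps_compose (fps_exp 1 - 1) (fps_ln 1) = (fps_X :: complex fps)"
proof -
  have *: "fps_nth (fps_exp 1 - 1 :: complex fps) 0 = 0" "fps_nth (fps_exp 1 - 1 :: complex fps) 1 \<noteq> 0"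
    by simp_all
  show "fps_compose (fps_ln 1) (fps_exp 1 - 1) = (fps_X :: complex fps)"
    by (simp add: fps_ln_fps_exp_inv fps_inv[OF *])
  show "fps_compose (fps_exp 1 - 1) (fps_ln 1) = (fps_X :: complex fps)"
    by (simp add: fps_ln_fps_exp_inv fps_inv_right[OF *])
qed

lemma nlog_nexp: "u ^ N = 0 \<Longrightarrow> nlog (nexp u) = u"
  using nil_eval_compose[of u N "fps_exp 1 - 1" "fps_ln 1"]
  by (simp add: nexp_minus_1 fps_exp_ln_compose nil_eval_X)

lemma nexp_nlog:
  assumes "(x - 1) ^ N = 0"
  shows "nexp (nlog x) = x"
proof -
  have "nlog x ^ N = 0" by (rule nil_eval_nilpotent[OF assms]) simp
  then have "nexp (nlog x) - 1 = nil_eval (fps_exp 1 - 1) (nlog x)" by (rule nexp_minus_1)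
  also have "\<dots> = x - 1"
    using nil_eval_compose[OF assms, of "fps_ln 1" "fps_exp 1 - 1"]
    by (simp add: fps_exp_ln_compose nil_eval_X)
  finally show ?thesis by simp
qed

lemma nexp_inject: "u ^ N = 0 \<Longrightarrow> v ^ N' = 0 \<Longrightarrow> nexp u = nexp v \<longleftrightarrow> u = v"
  by (metis nlog_nexp)

lemma power_scaleC: "(c *\<^sub>C u) ^ n = c ^ n *\<^sub>C (u::'a::complex_algebra) ^ n"
  by (induction n) (simp_all add: scaleC_one mult_scaleC_left mult_scaleC_right scaleC_scaleC mult.commute)

lemma nexp_uminus: "nexp (- u) = nil_eval (fps_exp (-1)) u"
proof -
  have "(- u) ^ n = (-1) ^ n *\<^sub>C u ^ n" for n
    using power_scaleC[of "-1" u n] by (simp add: scaleC_one)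
  then show ?thesis
    by (simp add: nil_eval_def scaleC_scaleC)
qed

lemma nexp_inverse:
  assumes "u ^ N = 0"
  shows "nexp u * nexp (- u) = 1" "nexp (- u) * nexp u = 1"
proof -
  have "fps_exp 1 * fps_exp (-1) = (1 :: complex fps)"
    by (metis add.right_inverse fps_exp_0 fps_exp_add_mult)
  then show "nexp u * nexp (- u) = 1" "nexp (- u) * nexp u = 1"
    unfolding nexp_uminus nil_eval_mult[OF assms, symmetric]
    by (simp_all add: nil_eval_1 mult.commute)
qed

lemma nexp_conjugate:
  assumes "u * v = 1" "v * u = 1" "B ^ N = 0"
  shows "u * nexp B * v = nexp (u * B * v)"
proof -
  have pow: "(u * B * v) ^ n = u * B ^ n * v" for n
  proof (induction n)
    case (Suc n)
    have "(u * B * v) ^ Suc n = u * B * v * (u * B ^ n * v)" by (simp add: Suc)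
    also have "\<dots> = u * B * (v * u) * B ^ n * v" by (simp only: mult.assoc)
    finally show ?case by (simp add: assms mult.assoc)
  qed (simp add: assms)
  have "(u * B * v) ^ N = 0" by (simp add: pow assms)
  then show ?thesis
    by (simp add: nil_eval_eq[OF assms(3)] nil_eval_eq pow sum_distrib_left sum_distrib_right
        mult_scaleC_left mult_scaleC_right)
qed

section \<open>Linear endomorphisms and the adjoint representation\<close>

typedef (overloaded) 'v cend = "{f :: 'v::complex_vector \<Rightarrow> 'v. clinear f}"
  morphisms app Cend
  by (rule exI[of _ id]) (simp add: clinear_iff)

setup_lifting type_definition_cend

lemma clinear_app: "clinear (app f)"
  using app by blast

lemma app_Cend: "clinear f \<Longrightarrow> app (Cend f) = f"
  by (simp add: Cend_inverse)

lemma cend_eqI: "(\<And>v. app f v = app g v) \<Longrightarrow> f = g"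
  by (metis app_inject ext)

instantiation cend :: (complex_vector) complex_algebra
begin
lift_definition zero_cend :: "'a cend" is "\<lambda>_. 0" by (simp add: clinear_iff)
lift_definition one_cend :: "'a cend" is "\<lambda>v. v" by (simp add: clinear_iff)
lift_definition plus_cend :: "'a cend \<Rightarrow> 'a cend \<Rightarrow> 'a cend" is "\<lambda>f g v. f v + g v"
  by (auto simp: clinear_iff scaleC_add_right algebra_simps)
lift_definition minus_cend :: "'a cend \<Rightarrow> 'a cend \<Rightarrow> 'a cend" is "\<lambda>f g v. f v - g v"
  by (auto simp: clinear_iff cvec.scale_right_diff_distrib algebra_simps)
lift_definition uminus_cend :: "'a cend \<Rightarrow> 'a cend" is "\<lambda>f v. - f v"
  by (auto simp: clinear_iff)
lift_definition times_cend :: "'a cend \<Rightarrow> 'a cend \<Rightarrow> 'a cend" is "\<lambda>f g v. f (g v)"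
  by (auto simp: clinear_iff)
lift_definition scaleC_cend :: "complex \<Rightarrow> 'a cend \<Rightarrow> 'a cend" is "\<lambda>c f v. c *\<^sub>C f v"
  by (auto simp: clinear_iff scaleC_add_right scaleC_scaleC mult.commute)
instance
  by standard (transfer; auto simp: clinear_add clinear_scale scaleC_simps fun_eq_iff algebra_simps)+
end

lemma app_simps [simp]:
  "app 0 v = 0" "app 1 v = v" "app (f + g) v = app f v + app g v" "app (f - g) v = app f v - app g v"
  "app (- f) v = - app f v" "app (f * g) v = app f (app g v)" "app (c *\<^sub>C f) v = c *\<^sub>C app f v"
  by (transfer; simp)+

lemma app_linear [simp]:
  "app f 0 = 0" "app f (v + w) = app f v + app f w" "app f (v - w) = app f v - app f w"
  "app f (- v) = - app f v" "app f (c *\<^sub>C v) = c *\<^sub>C app f v"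
  using clinear_app[of f] by (simp_all add: clinear_zero clinear_add clinear_diff clinear_minus clinear_scale)

lemma app_sum_left: "app (\<Sum>i\<in>S. f i) v = (\<Sum>i\<in>S. app (f i) v)"
  by (induction S rule: infinite_finite_induct) simp_all

lemma app_sum_right: "app f (\<Sum>i\<in>S. v i) = (\<Sum>i\<in>S. app f (v i))"
  by (rule clinear_sum[OF clinear_app])

lemma app_power: "app (f ^ n) v = (app f ^^ n) v"
  by (induction n) simp_all

lemma app_nil_eval:
  assumes "f ^ N = 0"
  shows "app (nil_eval p f) v = (\<Sum>n<N. fps_nth p n *\<^sub>C (app f ^^ n) v)"
  by (simp add: nil_eval_eq[OF assms] app_sum_left app_power)

definition commutator :: "'a::ring \<Rightarrow> 'a \<Rightarrow> 'a"
  where "commutator x y = x * y - y * x"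

lemma clinear_commutator: "clinear (commutator (x::'a::complex_algebra))"
  by (rule clinearI) (simp_all add: commutator_def algebra_simps mult_scaleC_left mult_scaleC_right scaleC_simps)

definition ad :: "'a::complex_algebra \<Rightarrow> 'a cend"
  where "ad x = Cend (commutator x)"

lemma app_ad: "app (ad x) y = commutator x y"
  by (simp add: ad_def app_Cend clinear_commutator)

text \<open>Expanding \<open>(ad a)\<^sup>n T\<close> gives terms \<open>a\<^sup>i T a\<^sup>j\<close> with \<open>i + j = n\<close>; if \<open>n = 2N\<close>, one of the
  two exponents is at least \<open>N\<close>.\<close>

lemma ad_nilpotent:
  fixes a :: "'a::complex_algebra"
  assumes "a ^ N = 0"
  shows "ad a ^ (2 * N) = 0"
proof (rule cend_eqI)
  fix T :: 'a
  let ?S = "\<lambda>n. {a ^ i * T * a ^ j | i j. i + j = n}"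
  have step: "app (ad a) x \<in> cspan (?S (Suc n))" if "x \<in> cspan (?S n)" for x n
  proof (rule clinear_cspan_subset[OF clinear_app _ _ that])
    fix x assume "x \<in> ?S n"
    then obtain i j where x: "x = a ^ i * T * a ^ j" "i + j = n" by blast
    have "app (ad a) x = a ^ Suc i * T * a ^ j - a ^ i * T * a ^ Suc j"
      by (simp add: app_ad commutator_def x mult.assoc power_commutes)
    moreover have "a ^ Suc i * T * a ^ j \<in> cspan (?S (Suc n))"
      by (rule cvec.span_base) (use x in \<open>force simp del: power_Suc\<close>)
    moreover have "a ^ i * T * a ^ Suc j \<in> cspan (?S (Suc n))"
      by (rule cvec.span_base) (use x in \<open>force simp del: power_Suc\<close>)
    ultimately show "app (ad a) x \<in> cspan (?S (Suc n))"
      by (simp add: cvec.span_diff)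
  qed (rule cvec.subspace_span)
  have "app (ad a ^ n) T \<in> cspan (?S n)" for n
  proof (induction n)
    case 0
    show ?case by (rule cvec.span_base) force
  next
    case (Suc n)
    then show ?case using step by simp
  qed
  moreover have "?S (2 * N) \<subseteq> {0}"
  proof
    fix x assume "x \<in> ?S (2 * N)"
    then obtain i j where x: "x = a ^ i * T * a ^ j" "i + j = 2 * N" by blast
    then have "i \<ge> N \<or> j \<ge> N" by linarith
    then show "x \<in> {0}" using power_zero_ge[OF assms] x by auto
  qed
  ultimately have "app (ad a ^ (2 * N)) T \<in> cspan {0}"
    using cvec.span_mono by blast
  then show "app (ad a ^ (2 * N)) T = app 0 T" by simp
qed

text \<open>Left multiplication by \<open>a\<close> is the sum of \<open>ad a\<close> and right multiplication by \<open>a\<close>, which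
  commute. So this is the binomial theorem, and its exponential form below is
  \<open>e\<^sup>a T e\<^sup>-\<^sup>a = e\<^bsup>ad a\<^esup> T\<close>.\<close>

lemma power_mult_ad:
  fixes a T :: "'a::complex_algebra"
  shows "a ^ n * T = (\<Sum>k\<le>n. of_nat (n choose k) *\<^sub>C (app (ad a ^ k) T * a ^ (n - k)))"
proof (induction n)
  case 0
  show ?case by (simp add: scaleC_one)
next
  case (Suc n)
  let ?t = "\<lambda>k. app (ad a ^ k) T"
  have step: "a * ?t k = ?t (Suc k) + ?t k * a" for k
    by (simp add: app_ad commutator_def)
  have "a ^ Suc n * T = (\<Sum>k\<le>n. of_nat (n choose k) *\<^sub>C (a * ?t k * a ^ (n - k)))"
    by (simp add: mult.assoc Suc sum_distrib_left mult_scaleC_right)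
  also have "\<dots> = (\<Sum>k\<le>n. of_nat (n choose k) *\<^sub>C (?t (Suc k) * a ^ (Suc n - Suc k)))
      + (\<Sum>k\<le>n. of_nat (n choose k) *\<^sub>C (?t k * a ^ (Suc n - k)))"
    by (simp add: step distrib_right scaleC_add_right sum.distrib mult.assoc Suc_diff_le)
  also have "(\<Sum>k\<le>n. of_nat (n choose k) *\<^sub>C (?t (Suc k) * a ^ (Suc n - Suc k)))
      = (\<Sum>k\<in>{1..Suc n}. of_nat (n choose (k - 1)) *\<^sub>C (?t k * a ^ (Suc n - k)))"
    by (rule sum.reindex_bij_witness[where i = "\<lambda>k. k - 1" and j = Suc]) auto
  also have "\<dots> = (\<Sum>k\<le>Suc n. (if k = 0 then 0 else of_nat (n choose (k - 1))) *\<^sub>C (?t k * a ^ (Suc n - k)))"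
    by (rule sum.mono_neutral_cong_left) auto
  also have "(\<Sum>k\<le>n. of_nat (n choose k) *\<^sub>C (?t k * a ^ (Suc n - k)))
      = (\<Sum>k\<le>Suc n. of_nat (n choose k) *\<^sub>C (?t k * a ^ (Suc n - k)))"
    by simp
  also have "(\<Sum>k\<le>Suc n. (if k = 0 then 0 else of_nat (n choose (k - 1))) *\<^sub>C (?t k * a ^ (Suc n - k)))
     + (\<Sum>k\<le>Suc n. of_nat (n choose k) *\<^sub>C (?t k * a ^ (Suc n - k)))
     = (\<Sum>k\<le>Suc n. of_nat (Suc n choose k) *\<^sub>C (?t k * a ^ (Suc n - k)))"
    unfolding sum.distrib[symmetric] scaleC_add_left[symmetric]
    by (intro sum.cong refl arg_cong2[of _ _ _ _ scaleC])
      (auto simp: gr0_conv_Suc binomial_Suc_Suc)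
  finally show ?case .
qed

lemma nexp_mult_ad:
  fixes a T :: "'a::complex_algebra"
  assumes "a ^ N = 0"
  shows "nexp a * T = app (nexp (ad a)) T * nexp a"
proof -
  let ?t = "\<lambda>k. (1 / fact k) *\<^sub>C app (ad a ^ k) T" and ?a = "\<lambda>k. (1 / fact k) *\<^sub>C a ^ k"
  have ad0: "app (ad a ^ k) T = 0" if "k \<ge> 2 * N" for k
    using power_zero_ge[OF ad_nilpotent[OF assms] that] by simp
  have a0: "a ^ (2 * N + N) = 0" using power_zero_ge[OF assms, of "2 * N + N"] by simp
  have "app (nexp (ad a)) T * nexp a = (\<Sum>k<2 * N. ?t k) * (\<Sum>k<N. ?a k)"
    by (simp add: nil_eval_eq[OF ad_nilpotent[OF assms]] nil_eval_eq[OF assms] app_sum_left)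
  also have "\<dots> = (\<Sum>n<2 * N + N. \<Sum>k\<le>n. ?t k * ?a (n - k))"
    by (rule sum_product_convolution) (simp_all add: ad0 power_zero_ge[OF assms])
  also have "\<dots> = (\<Sum>n<2 * N + N. (1 / fact n) *\<^sub>C (a ^ n * T))"
  proof (intro sum.cong refl)
    fix n
    have "?t k * ?a (n - k) = (1 / fact n) *\<^sub>C (of_nat (n choose k) *\<^sub>C (app (ad a ^ k) T * a ^ (n - k)))"
      if "k \<le> n" for k
      using that
      by (simp add: mult_scaleC_left mult_scaleC_right scaleC_scaleC binomial_fact mult.commute)
    then show "(\<Sum>k\<le>n. ?t k * ?a (n - k)) = (1 / fact n) *\<^sub>C (a ^ n * T)"
      unfolding power_mult_ad cvec.scale_sum_right by (intro sum.cong) auto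
  qed
  also have "\<dots> = nexp a * T"
    by (simp add: nil_eval_eq[OF a0] sum_distrib_right mult_scaleC_left)
  finally show ?thesis ..
qed

lemma app_nexp_ad:
  assumes "a ^ N = 0"
  shows "app (nexp (ad a)) T = nexp a * T * nexp (- a)"
  by (subst nexp_mult_ad[OF assms]) (simp only: mult.assoc nexp_inverse(1)[OF assms] mult_1_right)

section \<open>The Baker--Campbell--Hausdorff series in Dynkin's form\<close>

definition dynkin_word :: "'v \<Rightarrow> 'v \<Rightarrow> (nat \<times> nat) list \<Rightarrow> 'v list"
  where "dynkin_word a b ps = concat (map (\<lambda>(r, s). replicate r a @ replicate s b) ps)"

definition dynkin_coeff :: "(nat \<times> nat) list \<Rightarrow> complex"
  where "dynkin_coeff ps = (-1) ^ (length ps - 1) /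
    (of_nat (length ps) * of_nat (\<Sum>(r, s)\<leftarrow>ps. r + s) * (\<Prod>(r, s)\<leftarrow>ps. fact r * fact s))"

definition dynkin_index :: "(nat \<times> nat) list \<Rightarrow> bool"
  where "dynkin_index ps \<longleftrightarrow> ps \<noteq> [] \<and> (\<forall>(r, s) \<in> set ps. r + s > 0)"

text \<open>The series depends on the bracket alone. The same symbol serves for the bracket of a
  differential graded Lie algebra, for commutators of operators, and for Rees algebras.\<close>

definition dynkin :: "('v::complex_vector \<Rightarrow> 'v \<Rightarrow> 'v) \<Rightarrow> 'v \<Rightarrow> 'v \<Rightarrow> 'v"
  where "dynkin br a b = Sum_any (\<lambda>ps. if dynkin_index ps
    then dynkin_coeff ps *\<^sub>C nested_brk br (dynkin_word a b ps) else 0)"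

lemma bch_eq_dynkin: "bch K a b = dynkin (brk K) a b"
  unfolding bch_def dynkin_def dynkin_index_def dynkin_coeff_def dynkin_word_def ..

text \<open>The condition that makes the series a finite sum. It concerns the letters \<open>a\<close> and \<open>b\<close>
  only; so it applies to elements of algebras that are not themselves nilpotent.\<close>

definition nilpotent_pair :: "('v::zero \<Rightarrow> 'v \<Rightarrow> 'v) \<Rightarrow> nat \<Rightarrow> 'v \<Rightarrow> 'v \<Rightarrow> bool"
  where "nilpotent_pair br N a b \<longleftrightarrow>
    (\<forall>ws. set ws \<subseteq> {a, b} \<longrightarrow> N \<le> length ws \<longrightarrow> nested_brk br ws = 0)"

lemma length_dynkin_word: "length (dynkin_word a b ps) = (\<Sum>(r, s)\<leftarrow>ps. r + s)"
  by (induction ps) (auto simp: dynkin_word_def)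

lemma set_dynkin_word: "set (dynkin_word a b ps) \<subseteq> {a, b}"
  by (auto simp: dynkin_word_def)

lemma dynkin_index_bounds:
  assumes "\<forall>(r, s) \<in> set ps. r + s > 0"
  shows "length ps \<le> (\<Sum>(r, s)\<leftarrow>ps. r + s)"
    and "p \<in> set ps \<Longrightarrow> fst p + snd p \<le> (\<Sum>(r, s)\<leftarrow>ps. r + s)"
  using assms by (induction ps) fastforce+

text \<open>A finite set which, for a nilpotent pair and large \<open>M\<close>, contains all lists of \<open>n\<close> pairs that
  contribute to the series. Bounding each entry rather than the total degree makes the set a product, so sums over
  it factor.\<close>

definition dynkin_indices :: "nat \<Rightarrow> nat \<Rightarrow> (nat \<times> nat) list set"
  where "dynkin_indices M n = {ps. length ps = n \<and> set ps \<subseteq> {(r, s). r < M \<and> s < M \<and> 0 < r + s}}"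

lemma finite_dynkin_entries: "finite {(r, s). r < M \<and> s < M \<and> 0 < r + (s::nat)}"
  by (rule finite_subset[of _ "{..<M} \<times> {..<M}"]) auto

lemma finite_dynkin_indices: "finite (dynkin_indices M n)"
  using finite_lists_length_eq[OF finite_dynkin_entries[of M], of n]
  by (simp add: dynkin_indices_def conj_commute)

lemma dynkin_eq:
  assumes nil: "nilpotent_pair br N a b" and "N \<le> M"
  shows "dynkin br a b = (\<Sum>n<M. \<Sum>ps\<in>dynkin_indices M (Suc n).
    dynkin_coeff ps *\<^sub>C nested_brk br (dynkin_word a b ps))"
proof -
  let ?g = "\<lambda>ps. if dynkin_index ps
    then dynkin_coeff ps *\<^sub>C nested_brk br (dynkin_word a b ps) else 0"
  let ?A = "\<Union>n<M. dynkin_indices M (Suc n)"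
  have sub: "{ps. ?g ps \<noteq> 0} \<subseteq> ?A"
  proof
    fix ps assume "ps \<in> {ps. ?g ps \<noteq> 0}"
    then have ps: "dynkin_index ps" and nz: "nested_brk br (dynkin_word a b ps) \<noteq> 0"
      by (auto split: if_splits)
    from nz nil set_dynkin_word[of a b ps] have "length (dynkin_word a b ps) < N"
      unfolding nilpotent_pair_def by (metis not_le)
    then have lt: "(\<Sum>(r, s)\<leftarrow>ps. r + s) < N" by (simp add: length_dynkin_word)
    have pos: "\<forall>(r, s) \<in> set ps. r + s > 0" using ps by (simp add: dynkin_index_def)
    have "ps \<in> dynkin_indices M (length ps)"
      unfolding dynkin_indices_def
      using pos dynkin_index_bounds(2)[OF pos] lt \<open>N \<le> M\<close> by fastforce
    moreover obtain n where "length ps = Suc n"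
      using ps by (cases ps) (auto simp: dynkin_index_def)
    moreover have "length ps < N" using dynkin_index_bounds(1)[OF pos] lt by simp
    ultimately show "ps \<in> ?A" using \<open>N \<le> M\<close> by force
  qed
  have "dynkin br a b = (\<Sum>ps\<in>?A. ?g ps)"
    unfolding dynkin_def
    by (rule Sum_any.expand_superset[OF _ sub]) (simp add: finite_dynkin_indices)
  also have "\<dots> = (\<Sum>n<M. \<Sum>ps\<in>dynkin_indices M (Suc n). ?g ps)"
    by (rule sum.UNION_disjoint) (auto simp: finite_dynkin_indices, auto simp: dynkin_indices_def)
  also have "\<dots> = (\<Sum>n<M. \<Sum>ps\<in>dynkin_indices M (Suc n).
    dynkin_coeff ps *\<^sub>C nested_brk br (dynkin_word a b ps))"
    by (intro sum.cong refl if_P) (auto simp: dynkin_indices_def dynkin_index_def)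
  finally show ?thesis .
qed

lemma nested_brk_replicate:
  "ws \<noteq> [] \<Longrightarrow> nested_brk br (replicate r a @ ws) = (br a ^^ r) (nested_brk br ws)"
proof (induction r)
  case (Suc r)
  then obtain y zs where "replicate r a @ ws = y # zs"
    by (cases "replicate r a @ ws") auto
  then show ?case using Suc by simp
qed simp

text \<open>The innermost bracket of a longer word of equal letters is \<open>[b, b] = 0\<close>. Together with the
  preceding lemma this removes all blocks \<open>a\<^sup>r b\<^sup>s\<close> with \<open>s > 1\<close> at the end of a word.\<close>

lemma nested_brk_replicate_self:
  assumes "br b b = 0" "\<And>x. br x 0 = 0"
  shows "nested_brk br (replicate s b) = (if s = 1 then b else 0)"
proof (cases "s \<le> 1")
  case True
  then have "s = 0 \<or> s = 1" by auto
  then show ?thesis by auto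
next
  case False
  then obtain n where s: "s = Suc (Suc n)" by (metis One_nat_def Suc_le_eq less_imp_Suc_add not_le plus_1_eq_Suc add_Suc)
  have "nested_brk br (replicate n b @ [b, b]) = 0"
    by (subst nested_brk_replicate) (induction n; simp add: assms)+
  moreover have "replicate n b @ [b, b] = replicate s b"
    by (simp add: s replicate_app_Cons_same)
  ultimately show ?thesis using s by simp
qed

lemma nested_brk_hom:
  assumes "\<And>x y. x \<in> G \<Longrightarrow> y \<in> G \<Longrightarrow> \<phi> (br x y) = br' (\<phi> x) (\<phi> y)"
    and "\<And>x y. x \<in> G \<Longrightarrow> y \<in> G \<Longrightarrow> br x y \<in> G" and "0 \<in> G" "\<phi> 0 = 0" and "set ws \<subseteq> G"
  shows "\<phi> (nested_brk br ws) = nested_brk br' (map \<phi> ws) \<and> nested_brk br ws \<in> G"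
  using assms(5)
proof (induction ws rule: induct_list012)
  case 1
  show ?case using assms(3,4) by simp
next
  case (2 x)
  then show ?case by simp
next
  case (3 x y zs)
  then show ?case using assms(1,2) by simp
qed

lemma map_dynkin_word: "map \<phi> (dynkin_word a b ps) = dynkin_word (\<phi> a) (\<phi> b) ps"
  by (induction ps) (auto simp: dynkin_word_def)

lemma dynkin_in_subspace:
  assumes "nilpotent_pair br N a b" "csubspace S"
    and "\<And>ws. set ws \<subseteq> {a, b} \<Longrightarrow> ws \<noteq> [] \<Longrightarrow> nested_brk br ws \<in> S"
  shows "dynkin br a b \<in> S"
proof -
  have "nested_brk br (dynkin_word a b ps) \<in> S" for ps
    using assms(3)[OF set_dynkin_word] csubspace_0[OF assms(2)]
    by (cases "dynkin_word a b ps = []") auto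
  then show ?thesis unfolding dynkin_eq[OF assms(1) order_refl]
    by (intro csubspace_sum csubspace_scale assms(2))
qed

text \<open>The set \<open>G\<close> allows maps that respect brackets only on a subalgebra, such as the
  representations below.\<close>

lemma dynkin_hom:
  assumes "nilpotent_pair br N a b" "nilpotent_pair br' N' (\<phi> a) (\<phi> b)" "clinear \<phi>"
    and "\<And>x y. x \<in> G \<Longrightarrow> y \<in> G \<Longrightarrow> \<phi> (br x y) = br' (\<phi> x) (\<phi> y)"
    and "\<And>x y. x \<in> G \<Longrightarrow> y \<in> G \<Longrightarrow> br x y \<in> G" "0 \<in> G" "a \<in> G" "b \<in> G"
  shows "\<phi> (dynkin br a b) = dynkin br' (\<phi> a) (\<phi> b)"
proof -
  have "\<phi> (nested_brk br (dynkin_word a b ps)) = nested_brk br' (dynkin_word (\<phi> a) (\<phi> b) ps)" for ps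
  proof -
    have "set (dynkin_word a b ps) \<subseteq> G" using set_dynkin_word[of a b ps] assms(7,8) by auto
    from nested_brk_hom[of G \<phi> br br', OF assms(4-6) clinear_zero[OF assms(3)] this]
    show ?thesis by (simp add: map_dynkin_word)
  qed
  then show ?thesis
    unfolding dynkin_eq[OF assms(1) max.cobounded1[of N N']] dynkin_eq[OF assms(2) max.cobounded2[of N' N]]
    by (simp add: clinear_sum[OF assms(3)] clinear_scale[OF assms(3)])
qed

section \<open>Words in two elements of an algebra\<close>

text \<open>In the subalgebra generated by \<open>X\<close> and \<open>Y\<close>, this is the \<open>k\<close>-th power of the ideal generated by \<open>X\<close> and
  \<open>Y\<close>.\<close>

definition word_span :: "'a::complex_algebra \<Rightarrow> 'a \<Rightarrow> nat \<Rightarrow> 'a set"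
  where "word_span X Y k = cspan {prod_list ws | ws. set ws \<subseteq> {X, Y} \<and> k \<le> length ws}"

lemma csubspace_word_span: "csubspace (word_span X Y k)"
  unfolding word_span_def by (rule cvec.subspace_span)

lemma prod_list_in_word_span: "set ws \<subseteq> {X, Y} \<Longrightarrow> k \<le> length ws \<Longrightarrow> prod_list ws \<in> word_span X Y k"
  unfolding word_span_def by (rule cvec.span_base) auto

lemma word_span_antimono: "k \<le> l \<Longrightarrow> word_span X Y l \<subseteq> word_span X Y k"
  unfolding word_span_def by (rule cvec.span_mono) auto

lemma mult_in_word_span:
  assumes "x \<in> word_span X Y i" "y \<in> word_span X Y j"
  shows "x * y \<in> word_span X Y (i + j)"
proof (rule clinear_cspan_subset[where f = "\<lambda>x. x * y"])
  show "x \<in> cspan {prod_list ws | ws. set ws \<subseteq> {X, Y} \<and> i \<le> length ws}"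
    using assms(1) by (simp add: word_span_def)
  show "clinear (\<lambda>x. x * y)" by (simp add: clinear_iff distrib_right mult_scaleC_left)
  fix x assume "x \<in> {prod_list ws | ws. set ws \<subseteq> {X, Y} \<and> i \<le> length ws}"
  then obtain us where us: "x = prod_list us" "set us \<subseteq> {X, Y}" "i \<le> length us" by blast
  show "x * y \<in> word_span X Y (i + j)"
  proof (rule clinear_cspan_subset[where f = "\<lambda>y. x * y"])
    show "y \<in> cspan {prod_list ws | ws. set ws \<subseteq> {X, Y} \<and> j \<le> length ws}"
      using assms(2) by (simp add: word_span_def)
    show "clinear (\<lambda>y. x * y)" by (simp add: clinear_iff distrib_left mult_scaleC_right)
    fix y assume "y \<in> {prod_list ws | ws. set ws \<subseteq> {X, Y} \<and> j \<le> length ws}"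
    then obtain vs where vs: "y = prod_list vs" "set vs \<subseteq> {X, Y}" "j \<le> length vs" by blast
    have "x * y = prod_list (us @ vs)" by (simp add: us vs)
    also have "\<dots> \<in> word_span X Y (i + j)"
      by (rule prod_list_in_word_span) (use us vs in auto)
    finally show "x * y \<in> word_span X Y (i + j)" .
  qed (rule csubspace_word_span)
qed (rule csubspace_word_span)

lemma power_in_word_span: "x \<in> word_span X Y 1 \<Longrightarrow> x ^ n \<in> word_span X Y n"
proof (induction n)
  case 0
  show ?case using prod_list_in_word_span[of "[]"] by simp
next
  case (Suc n)
  then show ?case using mult_in_word_span[of x X Y 1 "x ^ n" n] by simp
qed

lemma commutator_in_word_span:
  assumes "x \<in> word_span X Y i" "y \<in> word_span X Y j"
  shows "commutator x y \<in> word_span X Y (i + j)"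
  unfolding commutator_def
  using mult_in_word_span[OF assms] mult_in_word_span[OF assms(2,1)]
  by (simp add: csubspace_diff[OF csubspace_word_span] add.commute)

lemma nested_in_word_span:
  "set ws \<subseteq> {X, Y} \<Longrightarrow> nested_brk commutator ws \<in> word_span X Y (length ws)"
proof (induction ws rule: induct_list012)
  case 1
  show ?case by (simp add: csubspace_0[OF csubspace_word_span])
next
  case (2 x)
  then show ?case using prod_list_in_word_span[of "[x]"] by simp
next
  case (3 x y zs)
  then show ?case
    using commutator_in_word_span[OF prod_list_in_word_span[of "[x]" X Y 1]] by simp
qed

lemma nil_eval_in_word_span:
  assumes "u \<in> word_span X Y 1" "u ^ N = 0" "fps_nth p 0 = 0"
  shows "nil_eval p u \<in> word_span X Y 1"
  unfolding nil_eval_eq[OF assms(2)]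
proof (rule csubspace_sum[OF csubspace_word_span])
  fix n
  show "fps_nth p n *\<^sub>C u ^ n \<in> word_span X Y 1"
  proof (cases "n = 0")
    case True
    then show ?thesis using assms(3) by (simp add: csubspace_0[OF csubspace_word_span])
  next
    case False
    then have "u ^ n \<in> word_span X Y 1"
      using power_in_word_span[OF assms(1), of n] word_span_antimono[of 1 n X Y] by auto
    then show ?thesis by (rule csubspace_scale[OF csubspace_word_span])
  qed
qed

locale nilpotent_words =
  fixes X Y :: "'a::complex_algebra" and N :: nat
  assumes words_zero: "set ws \<subseteq> {X, Y} \<Longrightarrow> N \<le> length ws \<Longrightarrow> prod_list ws = 0"
begin

lemma word_span_zero: "N \<le> k \<Longrightarrow> word_span X Y k = {0}"
proof -
  assume "N \<le> k"
  then have "{prod_list ws | ws. set ws \<subseteq> {X, Y} \<and> k \<le> length ws} \<subseteq> {0}"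
    using words_zero by auto
  then have "word_span X Y k \<subseteq> cspan {0}" unfolding word_span_def by (rule cvec.span_mono)
  then show ?thesis using csubspace_0[OF csubspace_word_span] by fastforce
qed

lemma word_span_nilpotent: "x \<in> word_span X Y 1 \<Longrightarrow> x ^ N = 0"
  using power_in_word_span[of x X Y N] word_span_zero[of N] by simp

lemma XY_in: "X \<in> word_span X Y 1" "Y \<in> word_span X Y 1"
  using prod_list_in_word_span[of "[X]" X Y 1] prod_list_in_word_span[of "[Y]" X Y 1] by simp_all

lemmas XN = word_span_nilpotent[OF XY_in(1)] and YN = word_span_nilpotent[OF XY_in(2)]

lemma nilpotent_pair: "nilpotent_pair commutator N X Y"
  unfolding nilpotent_pair_def using nested_in_word_span word_span_zero by blast

lemma dynkin_in: "dynkin commutator X Y \<in> word_span X Y 1"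
proof (rule dynkin_in_subspace[OF nilpotent_pair csubspace_word_span])
  fix ws assume "set ws \<subseteq> {X, Y}" "ws \<noteq> []"
  then show "nested_brk commutator ws \<in> word_span X Y 1"
    using nested_in_word_span[of ws X Y] word_span_antimono[of 1 "length ws" X Y]
    by (cases ws) auto
qed

definition W :: 'a where "W = nlog (nexp X * nexp Y)"

lemma exp_product_in: "nexp X * nexp Y - 1 \<in> word_span X Y 1"
proof -
  have 1: "nexp X - 1 \<in> word_span X Y 1" "nexp Y - 1 \<in> word_span X Y 1"
    using nil_eval_in_word_span[OF XY_in(1) XN] nil_eval_in_word_span[OF XY_in(2) YN]
    by (simp_all add: nexp_minus_1[OF XN] nexp_minus_1[OF YN])
  have "nexp X * nexp Y - 1 = (nexp X - 1) * (nexp Y - 1) + (nexp X - 1) + (nexp Y - 1)"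
    by (simp add: algebra_simps)
  moreover have "(nexp X - 1) * (nexp Y - 1) \<in> word_span X Y 1"
    using mult_in_word_span[OF 1] word_span_antimono[of 1 "1 + 1" X Y] by auto
  ultimately show ?thesis using 1 csubspace_add[OF csubspace_word_span] by metis
qed

lemma W_in: "W \<in> word_span X Y 1"
  unfolding W_def
  by (rule nil_eval_in_word_span[OF exp_product_in word_span_nilpotent[OF exp_product_in]]) simp

lemmas WN = word_span_nilpotent[OF W_in]

lemma nexp_W: "nexp W = nexp X * nexp Y"
  unfolding W_def by (rule nexp_nlog[OF word_span_nilpotent[OF exp_product_in]])

lemma nexp_minus_W: "nexp (- W) = nexp (- Y) * nexp (- X)"
proof -
  have "nexp (- W) = nexp (- W) * (nexp X * nexp Y) * (nexp (- Y) * nexp (- X))"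
    by (simp add: mult.assoc) (simp add: mult.assoc[symmetric, of "nexp Y"] nexp_inverse[OF YN] nexp_inverse[OF XN])
  then show ?thesis by (simp add: nexp_W[symmetric] nexp_inverse[OF WN])
qed

lemma nexp_ad_W: "nexp (ad W) = nexp (ad X) * nexp (ad Y)"
  by (rule cend_eqI)
    (simp add: app_nexp_ad[OF WN] app_nexp_ad[OF XN] app_nexp_ad[OF YN] nexp_W nexp_minus_W mult.assoc)

end

section \<open>Dynkin's formula in a graded algebra\<close>

text \<open>The operator is \<open>\<Prod>\<^sub>j (ad D - j)\<close>. It annihilates the eigenvectors with eigenvalue
  \<open>1, \<dots>, m\<close> and acts on the kernel of \<open>ad D\<close> by a nonzero scalar; so it separates the
  two.\<close>

lemma app_ad_power_product:
  "\<exists>f. \<forall>v c. commutator D v = c *\<^sub>C v \<longrightarrow>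
    app f v = (\<Prod>j=1..m. c - of_nat j) *\<^sub>C (v::'a::complex_algebra)"
proof (induction m)
  case 0
  show ?case by (rule exI[of _ 1]) (simp add: scaleC_one)
next
  case (Suc m)
  then obtain f where f: "\<And>v c. commutator D v = c *\<^sub>C v \<Longrightarrow>
    app f v = (\<Prod>j=1..m. c - of_nat j) *\<^sub>C (v::'a)" by blast
  have "app ((ad D - of_nat (Suc m) *\<^sub>C 1) * f) v = (\<Prod>j=1..Suc m. c - of_nat j) *\<^sub>C v"
    if v: "commutator D v = c *\<^sub>C v" for v c
  proof -
    have "app ((ad D - of_nat (Suc m) *\<^sub>C 1) * f) v
        = (\<Prod>j=1..m. c - of_nat j) *\<^sub>C c *\<^sub>C v - of_nat (Suc m) *\<^sub>C (\<Prod>j=1..m. c - of_nat j) *\<^sub>C v"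
      by (simp only: app_simps f[OF v] app_ad clinear_scale[OF clinear_commutator] v)
    also have "\<dots> = (\<Prod>j=1..Suc m. c - of_nat j) *\<^sub>C v"
      unfolding scaleC_scaleC cvec.scale_left_diff_distrib[symmetric]
      by (intro arg_cong2[of _ _ _ _ scaleC] refl) (simp add: algebra_simps)
    finally show ?thesis .
  qed
  then show ?case by blast
qed

text \<open>An element \<open>D\<close> whose adjoint action multiplies each word by its length. Dynkin's series
  carries the factor 1 / length, which \<open>ad D\<close> removes; this is why it is easier to compute
  \<open>[D, log(e\<^sup>X e\<^sup>Y)]\<close> than the logarithm itself.\<close>

locale graded_words = nilpotent_words +
  fixes D :: 'a
  assumes DX: "commutator D X = X" and DY: "commutator D Y = Y"
begin

lemma commutator_D_derivation:
  "commutator D (x * y) = commutator D x * y + x * commutator D y"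
  by (simp add: commutator_def algebra_simps)

lemma commutator_D_word:
  "set ws \<subseteq> {X, Y} \<Longrightarrow> commutator D (prod_list ws) = of_nat (length ws) *\<^sub>C prod_list ws"
proof (induction ws)
  case Nil
  show ?case by (simp add: commutator_def)
next
  case (Cons x ws)
  then have "commutator D x = x" using DX DY by auto
  with Cons show ?case
    by (simp add: commutator_D_derivation mult_scaleC_right scaleC_add_left scaleC_one)
qed

lemma commutator_D_nested:
  "set ws \<subseteq> {X, Y} \<Longrightarrow>
    commutator D (nested_brk commutator ws) = of_nat (length ws) *\<^sub>C nested_brk commutator ws"
proof (induction ws rule: induct_list012)
  case 1
  show ?case by (simp add: commutator_def)
next
  case (2 x)
  then show ?case using DX DY by (auto simp: scaleC_one)
next
  case (3 x y zs)
  let ?w = "nested_brk commutator (y # zs)"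
  from 3 have x: "commutator D x = x" using DX DY by auto
  have "commutator D (commutator x ?w) = commutator (commutator D x) ?w + commutator x (commutator D ?w)"
    by (simp add: commutator_def algebra_simps)
  also have "\<dots> = commutator x ?w + commutator x (of_nat (length (y # zs)) *\<^sub>C ?w)"
    using 3 x by simp
  also have "\<dots> = of_nat (length (x # y # zs)) *\<^sub>C commutator x ?w"
    by (simp only: length_Cons[of x] of_nat_Suc clinear_scale[OF clinear_commutator]
        scaleC_add_left scaleC_one)
  finally show ?case by simp
qed

lemma ad_D_injective:
  assumes v: "v \<in> word_span X Y 1" and 0: "commutator D v = 0"
  shows "v = 0"
proof -
  obtain f where f: "\<And>v c. commutator D v = c *\<^sub>C v \<Longrightarrow> app f v = (\<Prod>j=1..N. c - of_nat j) *\<^sub>C (v::'a)"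
    using app_ad_power_product[of D N] by blast
  have "app f v \<in> {0}"
  proof (rule clinear_cspan_subset[OF clinear_app])
    show "v \<in> cspan {prod_list ws | ws. set ws \<subseteq> {X, Y} \<and> 1 \<le> length ws}"
      using v by (simp add: word_span_def)
    fix x assume "x \<in> {prod_list ws | ws. set ws \<subseteq> {X, Y} \<and> 1 \<le> length ws}"
    then obtain ws where ws: "x = prod_list ws" "set ws \<subseteq> {X, Y}" "1 \<le> length ws" by blast
    show "app f x \<in> {0}"
    proof (cases "N \<le> length ws")
      case True
      then show ?thesis using words_zero ws by simp
    next
      case False
      then have "(\<Prod>j=1..N. of_nat (length ws) - of_nat j :: complex) = 0"
        using ws by (intro prod_zero) (auto intro!: bexI[of _ "length ws"])
      then show ?thesis using f[of x "of_nat (length ws)"] commutator_D_word[OF ws(2)] ws(1) by simp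
    qed
  qed (simp add: cvec.subspace_0 csubspaceI)
  moreover have "app f v = (\<Prod>j=1..N. - of_nat j) *\<^sub>C v"
    using f[of v 0] 0 by simp
  moreover have "(\<Prod>j=1..N. - of_nat j :: complex) \<noteq> 0" by auto
  ultimately show ?thesis by simp
qed

text \<open>The power series \<open>(e\<^sup>T - 1)/T\<close> and \<open>log(1 + T)/T\<close>. Substituting \<open>e\<^sup>T - 1\<close> into the second
  gives \<open>T/(e\<^sup>T - 1)\<close>, the inverse of the first.\<close>

definition psi :: "complex fps" where "psi = Abs_fps (\<lambda>n. 1 / fact (Suc n))"
definition lam :: "complex fps" where "lam = Abs_fps (\<lambda>n. (-1) ^ n / of_nat (Suc n))"

lemma fps_exp_psi: "fps_exp 1 - 1 = psi * fps_X"
  by (rule fps_ext) (auto simp: psi_def fps_X_mult_right_nth simp del: fact_Suc of_nat_Suc)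

lemma lam_psi: "fps_compose lam (fps_exp 1 - 1) * psi = 1"
proof -
  have ln: "fps_ln 1 = lam * fps_X"
    by (rule fps_ext) (auto simp: lam_def fps_X_mult_right_nth fps_ln_nth of_nat_diff)
  have "fps_X * (fps_compose lam (fps_exp 1 - 1) * psi)
      = fps_compose lam (fps_exp 1 - 1) * (fps_exp 1 - 1)"
    by (simp add: fps_exp_psi mult_ac)
  also have "\<dots> = fps_compose (lam * fps_X) (fps_exp 1 - 1)"
    by (subst fps_compose_mult_distrib) simp_all
  also have "\<dots> = fps_X * 1"
    by (simp add: ln[symmetric] fps_exp_ln_compose)
  finally show ?thesis
    by (subst (asm) mult_cancel_left) simp
qed

text \<open>Since \<open>(ad u) D = -[D, u]\<close>, all terms of \<open>e\<^bsup>ad u\<^esup> D\<close> except the first are powers of \<open>ad u\<close>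
  applied to \<open>[D, u]\<close>.\<close>

lemma nexp_ad_D:
  assumes "u ^ K = 0"
  shows "app (nexp (ad u)) D = D - app (nil_eval psi (ad u)) (commutator D u)"
proof -
  note k = ad_nilpotent[OF assms]
  have "nexp (ad u) - 1 = nil_eval psi (ad u) * ad u"
    unfolding nexp_minus_1[OF k] fps_exp_psi nil_eval_mult[OF k] nil_eval_X ..
  then have "nexp (ad u) = 1 + nil_eval psi (ad u) * ad u" by (simp add: algebra_simps)
  moreover have "commutator u D = - commutator D u" by (simp add: commutator_def)
  ultimately show ?thesis by (simp add: app_ad)
qed

text \<open>Compute \<open>e\<^sup>W D e\<^sup>-\<^sup>W = e\<^sup>X e\<^sup>Y D e\<^sup>-\<^sup>Y e\<^sup>-\<^sup>X\<close> in two ways. The left side is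
  \<open>D - \<psi>(ad W)[D, W]\<close>; the right side is \<open>e\<^bsup>ad X\<^esup>(D - Y) = D - X - e\<^bsup>ad X\<^esup> Y\<close>. Then invert
  \<open>\<psi>(ad W)\<close> and use \<open>e\<^bsup>ad W\<^esup> = e\<^bsup>ad X\<^esup> e\<^bsup>ad Y\<^esup>\<close>, which expresses the inverse
  through \<open>X\<close> and \<open>Y\<close>.\<close>

lemma commutator_D_W:
  "commutator D W = app (nil_eval lam (nexp (ad X) * nexp (ad Y) - 1)) (X + app (nexp (ad X)) Y)"
proof -
  note kW = ad_nilpotent[OF WN] and kY = ad_nilpotent[OF YN]
  \<comment> \<open>\<open>ad u\<close> kills \<open>u\<close>, so only the constant term of \<open>\<psi>\<close> acts; the exponent is raised by one
    so that the truncated sum contains that term\<close>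
  have self: "app (nil_eval psi (ad u)) u = u" if "u ^ K = 0" for u :: 'a and K
  proof -
    have k: "ad u ^ (Suc (2 * K)) = 0" using ad_nilpotent[OF that] by simp
    have "(app (ad u) ^^ n) u = (if n = 0 then u else 0)" for n
      by (induction n) (auto simp: app_ad commutator_def)
    then show ?thesis unfolding app_nil_eval[OF k]
      by (simp add: if_distrib[of "scaleC _"] sum.delta psi_def scaleC_one cong: if_cong)
  qed
  have "app (nexp (ad Y)) D = D - Y"
    by (simp add: nexp_ad_D[OF YN] DY self[OF YN])
  then have "app (nexp (ad W)) D = app (nexp (ad X)) D - app (nexp (ad X)) Y"
    by (simp add: nexp_ad_W)
  also have "\<dots> = D - X - app (nexp (ad X)) Y"
    by (simp add: nexp_ad_D[OF XN] DX self[OF XN])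
  finally have eq: "app (nil_eval psi (ad W)) (commutator D W) = X + app (nexp (ad X)) Y"
    by (simp add: nexp_ad_D[OF WN] algebra_simps)
  have "nil_eval lam (nexp (ad W) - 1) = nil_eval (fps_compose lam (fps_exp 1 - 1)) (ad W)"
    by (simp add: nexp_minus_1[OF kW] nil_eval_compose[OF kW])
  then have "nil_eval lam (nexp (ad W) - 1) * nil_eval psi (ad W) = 1"
    by (simp add: lam_psi nil_eval_1 flip: nil_eval_mult[OF kW])
  then have "commutator D W = app (nil_eval lam (nexp (ad W) - 1)) (app (nil_eval psi (ad W)) (commutator D W))"
    by (metis app_simps(2,6))
  then show ?thesis by (simp add: eq nexp_ad_W)
qed

abbreviation pair_coeff :: "nat \<times> nat \<Rightarrow> complex"
  where "pair_coeff \<equiv> \<lambda>(r, s). fact r * fact s"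

text \<open>The contribution of the lists of \<open>n\<close> pairs to \<open>[D, -]\<close> of Dynkin's series, without the
  common factor \<open>(-1)\<^bsup>n-1\<^esup> / n\<close>.\<close>

definition layer :: "nat \<Rightarrow> nat \<Rightarrow> 'a" where
  "layer M n = (\<Sum>ps\<in>dynkin_indices M n.
     (1 / prod_list (map pair_coeff ps)) *\<^sub>C nested_brk commutator (dynkin_word X Y ps))"

lemma expand_exp_ad:
  assumes "2 * N < M"
  shows "app (nexp (ad X) * nexp (ad Y) - 1) v = (\<Sum>p | fst p < M \<and> snd p < M \<and> 0 < fst p + snd p.
    (1 / pair_coeff p) *\<^sub>C (app (ad X) ^^ fst p) ((app (ad Y) ^^ snd p) v))"
proof -
  have k: "ad X ^ M = 0" "ad Y ^ M = 0"
    using power_zero_ge[OF ad_nilpotent[OF XN], of M] power_zero_ge[OF ad_nilpotent[OF YN], of M] assms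
    by simp_all
  let ?t = "\<lambda>p. (1 / pair_coeff p) *\<^sub>C (app (ad X) ^^ fst p) ((app (ad Y) ^^ snd p) v)"
  let ?S = "{p. fst p < M \<and> snd p < M \<and> 0 < fst p + snd p}"
  have "app (nexp (ad X) * nexp (ad Y)) v
      = (\<Sum>r<M. \<Sum>s<M. (1 / (fact r * fact s)) *\<^sub>C (app (ad X) ^^ r) ((app (ad Y) ^^ s) v))"
    by (simp add: nil_eval_eq[OF k(1)] nil_eval_eq[OF k(2)] app_sum_left app_sum_right scaleC_scaleC
        cvec.scale_sum_right app_power[symmetric]) (subst sum.swap, simp add: mult.commute)
  also have "\<dots> = (\<Sum>p\<in>{..<M} \<times> {..<M}. ?t p)"
    by (simp add: sum.cartesian_product case_prod_unfold)
  also have "{..<M} \<times> {..<M} = insert (0, 0) ?S"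
    using assms by auto
  also have "sum ?t (insert (0, 0) ?S) = v + sum ?t ?S"
  proof (subst sum.insert)
    show "finite ?S" using finite_dynkin_entries[of M] by (simp add: case_prod_unfold)
  qed (simp_all add: scaleC_one)
  finally show ?thesis by (simp add: algebra_simps)
qed

text \<open>For one block \<open>X\<^sup>r Y\<^sup>s\<close> the nested bracket vanishes unless \<open>s = 1\<close>, or \<open>s = 0\<close> and
  \<open>r = 1\<close>. The terms with \<open>s = 1\<close> add up to \<open>e\<^bsup>ad X\<^esup> Y\<close>.\<close>

lemma layer_1:
  assumes "2 * N < M" "2 \<le> M"
  shows "layer M 1 = X + app (nexp (ad X)) Y"
proof -
  have k: "ad X ^ M = 0"
    using power_zero_ge[OF ad_nilpotent[OF XN], of M] assms by simp
  let ?w = "\<lambda>r s. nested_brk commutator (replicate r X @ replicate s Y)"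
  let ?t = "\<lambda>r s. (1 / (fact r * fact s)) *\<^sub>C ?w r s"
  have cc: "commutator x x = 0" "commutator x 0 = 0" for x :: 'a
    by (simp_all add: commutator_def)
  have br: "commutator x = app (ad x)" for x :: 'a by (simp add: fun_eq_iff app_ad)
  have w0: "?w r 0 = (if r = 1 then X else 0)" for r
    using nested_brk_replicate_self[of commutator X r, OF cc] by simp
  have w1: "?w r (Suc s) = (if s = 0 then app (ad X ^ r) Y else 0)" for r s
    using nested_brk_replicate_self[of commutator Y "Suc s", OF cc]
      nested_brk_replicate[of "replicate (Suc s) Y" commutator r X]
    by (simp add: br flip: app_power)
  have inj: "inj_on (\<lambda>p. [p]) A" for A :: "(nat \<times> nat) set" by (simp add: inj_on_def)
  have set1: "dynkin_indices M 1 = (\<lambda>p. [p]) ` {p. fst p < M \<and> snd p < M \<and> 0 < fst p + snd p}"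
    by (auto simp: dynkin_indices_def length_Suc_conv image_iff)
  have "layer M 1 = (\<Sum>p | fst p < M \<and> snd p < M \<and> 0 < fst p + snd p. ?t (fst p) (snd p))"
    unfolding layer_def set1 sum.reindex[OF inj]
    by (simp add: dynkin_word_def case_prod_unfold)
  also have "\<dots> = (\<Sum>p\<in>{..<M} \<times> {..<M}. ?t (fst p) (snd p))"
    by (rule sum.mono_neutral_left) (auto intro!: gr0I)
  also have "\<dots> = (\<Sum>r<M. \<Sum>s<M. ?t r s)"
    by (simp add: sum.cartesian_product case_prod_unfold)
  also have "\<dots> = (\<Sum>r<M. ?t r 0 + ?t r 1)"
  proof (intro sum.cong refl)
    fix r
    have "(\<Sum>s<M. ?t r s) = (\<Sum>s\<in>{0, 1}. ?t r s)"
    proof (rule sum.mono_neutral_right)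
      show "\<forall>s\<in>{..<M} - {0, 1}. ?t r s = 0"
      proof
        fix s assume "s \<in> {..<M} - {0, 1}"
        then obtain n where "s = Suc n" "n \<noteq> 0" by (cases s) auto
        then show "?t r s = 0" by (simp only: w1) simp
      qed
    qed (use assms in auto)
    then show "(\<Sum>s<M. ?t r s) = ?t r 0 + ?t r 1" by simp
  qed
  also have "\<dots> = X + app (nexp (ad X)) Y"
  proof -
    have "(\<Sum>r<M. ?t r 0) = (\<Sum>r<M. if r = 1 then X else 0)"
      by (intro sum.cong refl) (simp only: w0, simp add: scaleC_one)
    also have "\<dots> = X" using assms by simp
    finally have 1: "(\<Sum>r<M. ?t r 0) = X" .
    have 2: "(\<Sum>r<M. ?t r 1) = app (nexp (ad X)) Y"
      unfolding nil_eval_eq[OF k] app_sum_left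
      by (intro sum.cong refl) (simp only: One_nat_def w1, simp)
    show ?thesis by (simp only: sum.distrib 1 2)
  qed
  finally show ?thesis .
qed

text \<open>A further block \<open>X\<^sup>r Y\<^sup>s\<close> in front applies \<open>(ad X)\<^sup>r (ad Y)\<^sup>s / (r! s!)\<close>. The sum over all
  \<open>(r, s)\<close> except \<open>(0, 0)\<close> is \<open>e\<^bsup>ad X\<^esup> e\<^bsup>ad Y\<^esup> - 1\<close>.\<close>

lemma layer_Suc:
  assumes "2 * N < M"
  shows "layer M (Suc (Suc n)) = app (nexp (ad X) * nexp (ad Y) - 1) (layer M (Suc n))"
proof -
  let ?S = "{p. fst p < M \<and> snd p < M \<and> 0 < fst p + snd p}"
  have br: "commutator x = app (ad x)" for x :: 'a by (simp add: fun_eq_iff app_ad)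
  have inj: "inj_on (\<lambda>(p, ps). p # ps) A" for A :: "((nat \<times> nat) \<times> (nat \<times> nat) list) set"
    by (auto simp: inj_on_def)
  have idx: "dynkin_indices M (Suc (Suc n)) = (\<lambda>(p, ps). p # ps) ` (?S \<times> dynkin_indices M (Suc n))"
    by (auto simp: dynkin_indices_def length_Suc_conv image_iff)
  have word: "nested_brk commutator (dynkin_word X Y (p # ps))
      = (app (ad X) ^^ fst p) ((app (ad Y) ^^ snd p) (nested_brk commutator (dynkin_word X Y ps)))"
    if "ps \<in> dynkin_indices M (Suc n)" for p ps
  proof -
    have "dynkin_word X Y ps \<noteq> []"
      using that by (cases ps) (auto simp: dynkin_indices_def dynkin_word_def)
    then show ?thesis
      by (simp add: dynkin_word_def case_prod_unfold nested_brk_replicate br)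
  qed
  have "layer M (Suc (Suc n)) = (\<Sum>p\<in>?S. \<Sum>ps\<in>dynkin_indices M (Suc n).
      (1 / prod_list (map pair_coeff (p # ps))) *\<^sub>C nested_brk commutator (dynkin_word X Y (p # ps)))"
    unfolding layer_def idx sum.reindex[OF inj] sum.cartesian_product
    by (simp add: case_prod_unfold)
  also have "\<dots> = (\<Sum>p\<in>?S. (1 / pair_coeff p) *\<^sub>C (app (ad X) ^^ fst p) ((app (ad Y) ^^ snd p) (layer M (Suc n))))"
    by (intro sum.cong refl)
      (simp add: layer_def word app_power[symmetric] app_sum_right cvec.scale_sum_right scaleC_scaleC mult.commute)
  also have "\<dots> = app (nexp (ad X) * nexp (ad Y) - 1) (layer M (Suc n))"
    by (simp only: expand_exp_ad[OF assms])
  finally show ?thesis .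
qed

text \<open>By the recursion for the layers, \<open>[D, -]\<close> of Dynkin's series is the value of the power series
  \<open>log(1 + T)/T\<close> at \<open>e\<^bsup>ad X\<^esup> e\<^bsup>ad Y\<^esup> - 1\<close>, applied to \<open>X + e\<^bsup>ad X\<^esup> Y\<close>. That is also
  \<open>[D, W]\<close>, and \<open>ad D\<close> is injective on the span of nonempty words.\<close>

theorem dynkin_graded: "nexp X * nexp Y = nexp (dynkin commutator X Y)"
proof -
  \<comment> \<open>\<open>ad X\<close> and \<open>ad Y\<close> are nilpotent of index \<open>2 * N\<close>; the bound \<open>2 \<le> M\<close> makes
    the pairs \<open>(1, 0)\<close> and \<open>(0, 1)\<close> available\<close>
  define M where "M = 2 * N + 2"
  let ?E = "nexp (ad X) * nexp (ad Y) - 1"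
  have M: "2 * N < M" "2 \<le> M" "N \<le> M" by (simp_all add: M_def)
  have layers: "layer M (Suc n) = app (?E ^ n) (X + app (nexp (ad X)) Y)" for n
  proof (induction n)
    case 0
    show ?case using layer_1[OF M(1,2)] by simp
  next
    case (Suc n)
    show ?case unfolding layer_Suc[OF M(1)] Suc by simp
  qed
  have "?E ^ (2 * N) = 0"
    unfolding nexp_ad_W[symmetric] nexp_minus_1[OF ad_nilpotent[OF WN]]
    by (rule nil_eval_nilpotent[OF ad_nilpotent[OF WN]]) simp
  then have E: "?E ^ M = 0" by (rule power_zero_ge) (use M in simp)
  have "commutator D W = (\<Sum>n<M. ((-1) ^ n / of_nat (Suc n)) *\<^sub>C layer M (Suc n))"
    unfolding commutator_D_W nil_eval_eq[OF E] app_sum_left by (simp only: layers) (simp add: lam_def scaleC_add_right del: of_nat_Suc)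
  also have "\<dots> = commutator D (dynkin commutator X Y)"
  proof -
    have summand: "commutator D (dynkin_coeff ps *\<^sub>C nested_brk commutator (dynkin_word X Y ps))
        = ((-1) ^ n / of_nat (Suc n)) *\<^sub>C (1 / prod_list (map pair_coeff ps)) *\<^sub>C
            nested_brk commutator (dynkin_word X Y ps)"
      if "ps \<in> dynkin_indices M (Suc n)" for ps n
    proof -
      have len: "length ps = Suc n" and "\<forall>(r, s) \<in> set ps. r + s > 0"
        using that by (auto simp: dynkin_indices_def)
      define l where "l = (\<Sum>(r, s)\<leftarrow>ps. r + s)"
      have "l \<noteq> 0"
        using dynkin_index_bounds(1)[of ps] len \<open>\<forall>(r, s) \<in> set ps. r + s > 0\<close> unfolding l_def by linarith
      then show ?thesis
        unfolding clinear_scale[OF clinear_commutator] commutator_D_nested[OF set_dynkin_word]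
          length_dynkin_word dynkin_coeff_def len scaleC_scaleC l_def[symmetric]
        by (intro arg_cong2[of _ _ _ _ scaleC] refl) (simp add: case_prod_unfold del: of_nat_Suc)
    qed
    show ?thesis
      unfolding dynkin_eq[OF nilpotent_pair M(3)] clinear_sum[OF clinear_commutator] layer_def
        cvec.scale_sum_right
      by (intro sum.cong refl) (simp only: summand)
  qed
  finally have "commutator D (W - dynkin commutator X Y) = 0"
    by (simp add: clinear_diff[OF clinear_commutator])
  then have "W = dynkin commutator X Y"
    using ad_D_injective[OF csubspace_diff[OF csubspace_word_span W_in dynkin_in]] by simp
  then show ?thesis using nexp_W by simp
qed

end

section \<open>Dynkin's formula for nilpotent operators\<close>

text \<open>On \<open>V[t]\<close>, the type \<^typ>\<open>nat \<Rightarrow>\<^sub>0 'v\<close>, the operators \<open>tX\<close> and \<open>tY\<close> are graded by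
  \<open>t d/dt\<close>; evaluation at \<open>t = 1\<close> intertwines \<open>tX\<close> with \<open>X\<close>. So the graded case implies
  the general one.\<close>

lift_definition shift_op :: "'v::complex_vector cend \<Rightarrow> (nat \<Rightarrow>\<^sub>0 'v) \<Rightarrow> (nat \<Rightarrow>\<^sub>0 'v)"
  is "\<lambda>T p n. case n of 0 \<Rightarrow> 0 | Suc m \<Rightarrow> app T (p m)"
proof -
  fix T :: "'v cend" and p :: "nat \<Rightarrow> 'v"
  assume "finite {n. p n \<noteq> 0}"
  moreover have "{n. (case n of 0 \<Rightarrow> 0 | Suc m \<Rightarrow> app T (p m)) \<noteq> 0} \<subseteq> Suc ` {n. p n \<noteq> 0}"
  proof
    fix n assume "n \<in> {n. (case n of 0 \<Rightarrow> 0 | Suc m \<Rightarrow> app T (p m)) \<noteq> 0}"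
    then show "n \<in> Suc ` {n. p n \<noteq> 0}" by (cases n) auto
  qed
  ultimately show "finite {n. (case n of 0 \<Rightarrow> 0 | Suc m \<Rightarrow> app T (p m)) \<noteq> 0}"
    by (meson finite_imageI finite_subset)
qed

lift_definition degree_op :: "(nat \<Rightarrow>\<^sub>0 'v::complex_vector) \<Rightarrow> (nat \<Rightarrow>\<^sub>0 'v)"
  is "\<lambda>p n. of_nat n *\<^sub>C p n"
  by (rule finite_subset) auto

definition coeff_sum :: "(nat \<Rightarrow>\<^sub>0 'v::complex_vector) \<Rightarrow> 'v"
  where "coeff_sum p = Sum_any (Poly_Mapping.lookup p)"

lemma clinear_shift_op: "clinear (shift_op T)"
  by (rule clinearI; transfer) (auto simp: fun_eq_iff split: nat.splits)

lemma clinear_degree_op: "clinear degree_op"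
  by (rule clinearI; transfer) (auto simp: fun_eq_iff scaleC_simps mult.commute)

lemma clinear_coeff_sum: "clinear (coeff_sum :: (nat \<Rightarrow>\<^sub>0 'v::complex_vector) \<Rightarrow> 'v)"
proof (rule clinearI)
  fix p q :: "nat \<Rightarrow>\<^sub>0 'v" and c
  have fin: "finite {n. Poly_Mapping.lookup p n \<noteq> 0}" for p :: "nat \<Rightarrow>\<^sub>0 'v"
    using finite_keys[of p] by (simp add: Poly_Mapping.keys.rep_eq)
  show "coeff_sum (p + q) = coeff_sum p + coeff_sum q"
    unfolding coeff_sum_def lookup_add by (rule Sum_any.distrib[OF fin fin])
  have "Sum_any (Poly_Mapping.lookup (c *\<^sub>C p)) = (\<Sum>n | Poly_Mapping.lookup p n \<noteq> 0. c *\<^sub>C Poly_Mapping.lookup p n)"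
    by (subst Sum_any.expand_superset[OF fin[of p]]) (auto simp: scaleC_poly_mapping.rep_eq)
  then show "coeff_sum (c *\<^sub>C p) = c *\<^sub>C coeff_sum p"
    by (simp add: coeff_sum_def Sum_any.expand_set cvec.scale_sum_right)
qed

lemma coeff_sum_shift_op: "coeff_sum (shift_op T p) = app T (coeff_sum p)"
proof -
  have fin: "finite {n. Poly_Mapping.lookup p n \<noteq> 0}"
    using finite_keys[of p] by (simp add: Poly_Mapping.keys.rep_eq)
  have "coeff_sum (shift_op T p) = (\<Sum>n\<in>Suc ` {n. Poly_Mapping.lookup p n \<noteq> 0}. Poly_Mapping.lookup (shift_op T p) n)"
    unfolding coeff_sum_def
  proof (rule Sum_any.expand_superset)
    show "{n. Poly_Mapping.lookup (shift_op T p) n \<noteq> 0} \<subseteq> Suc ` {n. Poly_Mapping.lookup p n \<noteq> 0}"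
    proof
      fix n assume "n \<in> {n. Poly_Mapping.lookup (shift_op T p) n \<noteq> 0}"
      then show "n \<in> Suc ` {n. Poly_Mapping.lookup p n \<noteq> 0}"
        by (cases n) (auto simp: shift_op.rep_eq)
    qed
  qed (simp add: fin)
  also have "\<dots> = (\<Sum>n | Poly_Mapping.lookup p n \<noteq> 0. app T (Poly_Mapping.lookup p n))"
    by (subst sum.reindex) (auto simp: shift_op.rep_eq)
  finally show ?thesis by (simp add: coeff_sum_def Sum_any.expand_set app_sum_right)
qed

lemma coeff_sum_single: "coeff_sum (Poly_Mapping.single 0 v) = v"
  unfolding coeff_sum_def
  by (subst Sum_any.expand_superset[of "{0}"]) (auto simp: lookup_single when_def)

definition shift :: "'v::complex_vector cend \<Rightarrow> (nat \<Rightarrow>\<^sub>0 'v) cend"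
  where "shift T = Cend (shift_op T)"

lemma app_shift: "app (shift T) = shift_op T"
  by (simp add: shift_def app_Cend clinear_shift_op)

lemma lookup_prod_shift:
  "Poly_Mapping.lookup (app (prod_list (map shift Ts)) p) n
    = (if length Ts \<le> n then app (prod_list Ts) (Poly_Mapping.lookup p (n - length Ts)) else 0)"
  by (induction Ts arbitrary: n) (auto simp: app_shift shift_op.rep_eq split: nat.splits)

text \<open>Every operator formed from \<open>tX\<close> and \<open>tY\<close> is intertwined, by evaluation at \<open>t = 1\<close>, with the same
  expression in \<open>X\<close> and \<open>Y\<close>. Evaluating on constant polynomials recovers the identity
  on all of \<open>V\<close>.\<close>

theorem nexp_dynkin:
  fixes X Y :: "'v::complex_vector cend"
  assumes "\<And>ws. set ws \<subseteq> {X, Y} \<Longrightarrow> N \<le> length ws \<Longrightarrow> prod_list ws = 0"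
  shows "nexp (dynkin commutator X Y) = nexp X * nexp Y"
    and "dynkin commutator X Y ^ N = 0"
proof -
  interpret nilpotent_words X Y N by standard (rule assms)
  let ?D = "Cend degree_op :: (nat \<Rightarrow>\<^sub>0 'v) cend"
  have D: "app ?D = degree_op" by (simp add: app_Cend clinear_degree_op)
  have grade: "commutator ?D (shift T) = shift T" for T :: "'v cend"
  proof (rule cend_eqI, rule poly_mapping_eqI)
    fix p n
    show "Poly_Mapping.lookup (app (commutator ?D (shift T)) p) n = Poly_Mapping.lookup (app (shift T) p) n"
      by (auto simp: commutator_def D app_shift shift_op.rep_eq degree_op.rep_eq lookup_minus
          scaleC_simps split: nat.splits)
  qed
  interpret G: graded_words "shift X" "shift Y" N ?D
  proof
    fix us assume us: "set us \<subseteq> {shift X, shift Y}" "N \<le> length us"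
    have "\<exists>ws. us = map shift ws \<and> set ws \<subseteq> {X, Y}"
      using us(1)
    proof (induction us)
      case (Cons u us)
      then obtain ws where ws: "us = map shift ws" "set ws \<subseteq> {X, Y}" by auto
      from Cons obtain w where w: "w \<in> {X, Y}" "u = shift w" by auto
      show ?case by (rule exI[of _ "w # ws"]) (use ws w in auto)
    qed simp
    then obtain ws where ws: "us = map shift ws" "set ws \<subseteq> {X, Y}" by blast
    then have "prod_list ws = 0" using words_zero us(2) by simp
    then show "prod_list us = 0"
      by (intro cend_eqI poly_mapping_eqI) (simp add: ws(1) lookup_prod_shift)
  qed (rule grade)+
  let ?rel = "\<lambda>A B. \<forall>p. coeff_sum (app A p) = app B (coeff_sum p)"
  have rel_mult: "?rel A B \<Longrightarrow> ?rel A' B' \<Longrightarrow> ?rel (A * A') (B * B')" for A A' and B B' :: "'v cend"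
    by simp
  have rel_power: "?rel A B \<Longrightarrow> ?rel (A ^ n) (B ^ n)" for A and B :: "'v cend" and n
    by (induction n) simp_all
  have rel_sum: "(\<And>i. i \<in> S \<Longrightarrow> ?rel (A i) (B i)) \<Longrightarrow> ?rel (sum A S) (sum B S)"
    for S :: "'i set" and A and B :: "'i \<Rightarrow> 'v cend"
    by (simp add: app_sum_left clinear_sum[OF clinear_coeff_sum])
  have rel_scale: "?rel A B \<Longrightarrow> ?rel (c *\<^sub>C A) (c *\<^sub>C B)" for A c and B :: "'v cend"
    by (simp add: clinear_scale[OF clinear_coeff_sum])
  have rel_nexp: "?rel A B \<Longrightarrow> A ^ N = 0 \<Longrightarrow> B ^ N = 0 \<Longrightarrow> ?rel (nexp A) (nexp B)"
    for A and B :: "'v cend"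
    unfolding nil_eval_eq[of A N] nil_eval_eq[of B N]
    by (intro rel_sum rel_scale rel_power)
  have rel_shift: "?rel (shift T) T" for T :: "'v cend"
    by (simp add: app_shift coeff_sum_shift_op)
  have rel_nested: "?rel (nested_brk commutator (map shift ws)) (nested_brk commutator ws)"
    for ws :: "'v cend list"
  proof (induction ws rule: induct_list012)
    case 1
    show ?case by (simp add: clinear_zero[OF clinear_coeff_sum])
  next
    case (2 x)
    show ?case using rel_shift by simp
  next
    case (3 x y zs)
    then show ?case
      using rel_shift by (simp add: commutator_def clinear_diff[OF clinear_coeff_sum])
  qed
  have rel_dynkin: "?rel (dynkin commutator (shift X) (shift Y)) (dynkin commutator X Y)"
    unfolding dynkin_eq[OF G.nilpotent_pair order_refl] dynkin_eq[OF nilpotent_pair order_refl]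
      map_dynkin_word[symmetric]
    by (intro rel_sum rel_scale rel_nested)
  show nil: "dynkin commutator X Y ^ N = 0"
    by (rule word_span_nilpotent[OF dynkin_in])
  have 1: "?rel (nexp (dynkin commutator (shift X) (shift Y))) (nexp (dynkin commutator X Y))"
    by (rule rel_nexp[OF rel_dynkin G.word_span_nilpotent[OF G.dynkin_in] nil])
  have 2: "?rel (nexp (shift X) * nexp (shift Y)) (nexp X * nexp Y)"
    by (intro rel_mult rel_nexp rel_shift XN YN G.XN G.YN)
  show "nexp (dynkin commutator X Y) = nexp X * nexp Y"
  proof (rule cend_eqI)
    fix v
    show "app (nexp (dynkin commutator X Y)) v = app (nexp X * nexp Y) v"
      using 1[rule_format, of "Poly_Mapping.single 0 v"] 2[rule_format, of "Poly_Mapping.single 0 v"]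
      unfolding G.dynkin_graded[symmetric] coeff_sum_single by simp
  qed
qed

section \<open>Bilinear maps and the leading terms of Dynkin's series\<close>

instantiation prod :: (complex_vector, complex_vector) complex_vector
begin
definition scaleC_prod :: "complex \<Rightarrow> 'a \<times> 'b \<Rightarrow> 'a \<times> 'b"
  where "scaleC_prod c p = (c *\<^sub>C fst p, c *\<^sub>C snd p)"
instance
  by standard (simp_all add: scaleC_prod_def scaleC_simps prod_eq_iff)
end

lemma scaleC_Pair [simp]: "c *\<^sub>C (x, y) = (c *\<^sub>C x, c *\<^sub>C y)"
  by (simp add: scaleC_prod_def)

instantiation "fun" :: (type, complex_vector) complex_vector
begin
definition scaleC_fun :: "complex \<Rightarrow> ('a \<Rightarrow> 'b) \<Rightarrow> 'a \<Rightarrow> 'b"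
  where "scaleC_fun c f = (\<lambda>x. c *\<^sub>C f x)"
instance
  by standard (simp_all add: scaleC_fun_def scaleC_simps fun_eq_iff)
end

lemma
  assumes "cbilinear br"
  shows cbilinear_add_left: "br (x + x') y = br x y + br x' y"
    and cbilinear_add_right: "br x (y + y') = br x y + br x y'"
    and cbilinear_scale_left: "br (c *\<^sub>C x) y = c *\<^sub>C br x y"
    and cbilinear_scale_right: "br x (c *\<^sub>C y) = c *\<^sub>C br x y"
    and cbilinear_zero_left: "br 0 y = 0" and cbilinear_zero_right: "br x 0 = 0"
    and cbilinear_minus_left: "br (- x) y = - br x y" and cbilinear_minus_right: "br x (- y) = - br x y"
    and cbilinear_diff_left: "br (x - x') y = br x y - br x' y"
    and cbilinear_diff_right: "br x (y - y') = br x y - br x y'"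
    and cbilinear_sum_left: "br (sum g S) y = (\<Sum>i\<in>S. br (g i) y)"
    and cbilinear_sum_right: "br x (sum h T) = (\<Sum>i\<in>T. br x (h i))"
proof -
  have r: "clinear (br x)" and l: "clinear (\<lambda>x. br x y)" for x y
    using assms by (auto simp: cbilinear_def)
  note * = clinear_add clinear_scale clinear_zero clinear_minus clinear_diff clinear_sum
  show "br (x + x') y = br x y + br x' y" "br (c *\<^sub>C x) y = c *\<^sub>C br x y" "br 0 y = 0"
    "br (- x) y = - br x y" "br (x - x') y = br x y - br x' y" "br (sum g S) y = (\<Sum>i\<in>S. br (g i) y)"
    using *[OF l[of y]] by simp_all
  show "br x (y + y') = br x y + br x y'" "br x (c *\<^sub>C y) = c *\<^sub>C br x y" "br x 0 = 0"
    "br x (- y) = - br x y" "br x (y - y') = br x y - br x y'" "br x (sum h T) = (\<Sum>i\<in>T. br x (h i))"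
    using *[OF r[of x]] by simp_all
qed

text \<open>Modulo a subspace that contains all brackets of \<open>a\<close> and \<open>b\<close>, only the words of length
  one survive.\<close>

lemma nested_brk_in_subspace:
  assumes "csubspace S" "br a b \<in> S" "br b a \<in> S" "br a a = 0" "br b b = 0"
    and "\<And>x. x \<in> S \<Longrightarrow> br a x \<in> S" "\<And>x. x \<in> S \<Longrightarrow> br b x \<in> S"
    and "set ws \<subseteq> {a, b}" "2 \<le> length ws"
  shows "nested_brk br ws \<in> S"
  using assms(8,9)
proof (induction ws rule: induct_list012)
  case (3 x y zs)
  show ?case
  proof (cases zs)
    case Nil
    then show ?thesis using 3 assms(2-5) csubspace_0[OF assms(1)] by auto
  next
    case (Cons z zs')
    then show ?thesis using 3 assms(6,7) by auto
  qed
qed auto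

lemma dynkin_mod_sum:
  assumes nil: "nilpotent_pair br N a b" and S: "csubspace S" "br a b \<in> S" "br b a \<in> S" "br a a = 0" "br b b = 0"
    "\<And>x. x \<in> S \<Longrightarrow> br a x \<in> S" "\<And>x. x \<in> S \<Longrightarrow> br b x \<in> S"
  shows "dynkin br a b - (a + b) \<in> S"
proof -
  let ?M = "max N 2"
  let ?t = "\<lambda>ps. dynkin_coeff ps *\<^sub>C nested_brk br (dynkin_word a b ps)"
  let ?e = "\<lambda>ps. (if ps = [(1, 0)] then a else 0) + (if ps = [(0, 1)] then b else 0)"
  have "(\<Sum>n<?M. \<Sum>ps\<in>dynkin_indices ?M (Suc n). ?e ps) = (\<Sum>n<?M. if n = 0 then a + b else 0)"
  proof (intro sum.cong refl)
    fix n
    have "(\<Sum>ps\<in>dynkin_indices ?M (Suc n). ?e ps)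
        = (if [(1, 0)] \<in> dynkin_indices ?M (Suc n) then a else 0)
          + (if [(0, 1)] \<in> dynkin_indices ?M (Suc n) then b else 0)"
      unfolding sum.distrib sum.delta[OF finite_dynkin_indices] ..
    then show "(\<Sum>ps\<in>dynkin_indices ?M (Suc n). ?e ps) = (if n = 0 then a + b else 0)"
      by (auto simp: dynkin_indices_def)
  qed
  also have "\<dots> = a + b" by (subst sum.delta) simp_all
  finally have e: "(\<Sum>n<?M. \<Sum>ps\<in>dynkin_indices ?M (Suc n). ?e ps) = a + b" .
  have mem: "?t ps - ?e ps \<in> S" if "ps \<in> dynkin_indices ?M (Suc n)" for ps n
  proof (cases "2 \<le> length (dynkin_word a b ps)")
    case True
    then have "?e ps = 0" by (auto simp: dynkin_word_def)
    moreover have "nested_brk br (dynkin_word a b ps) \<in> S"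
      by (rule nested_brk_in_subspace[OF S set_dynkin_word True])
    ultimately show ?thesis by (simp add: csubspace_scale[OF S(1)])
  next
    case False
    have pos: "\<forall>(r, s) \<in> set ps. r + s > 0" and len: "length ps = Suc n"
      using that by (auto simp: dynkin_indices_def)
    have sum: "(\<Sum>(r, s)\<leftarrow>ps. r + s) \<le> 1" using False by (simp add: length_dynkin_word)
    with dynkin_index_bounds(1)[OF pos] len have "length ps = 1" by simp
    then obtain r s where ps: "ps = [(r, s)]" by (cases ps) auto
    with pos sum have "(r = 1 \<and> s = 0) \<or> (r = 0 \<and> s = 1)" by auto
    then have "?t ps - ?e ps = 0" by (auto simp: ps dynkin_coeff_def dynkin_word_def scaleC_one)
    then show ?thesis using csubspace_0[OF S(1)] by (simp only:)
  qed
  have "dynkin br a b - (a + b) = (\<Sum>n<?M. \<Sum>ps\<in>dynkin_indices ?M (Suc n). ?t ps - ?e ps)"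
    unfolding dynkin_eq[OF nil max.cobounded1[of N 2]] e[symmetric] by (simp only: sum_subtractf)
  also have "\<dots> \<in> S" by (intro csubspace_sum[OF S(1)] mem)
  finally show ?thesis .
qed

section \<open>Nilpotent Lie algebras and derivations\<close>

text \<open>A Lie algebra \<open>G\<close> that acts on a space with a finite filtration \<open>V\<close> and raises the filtration
  degree. The bracket is defined on the whole space and \<open>v\<close> in the Jacobi identity is arbitrary, since \<open>G\<close> will be
  the degree 0 part of a graded Lie algebra whose other components it acts on.\<close>

locale nilpotent_lie =
  fixes br :: "'v::complex_vector \<Rightarrow> 'v \<Rightarrow> 'v" and G :: "'v set" and V :: "nat \<Rightarrow> 'v set" and N :: nat
  assumes bilinear: "cbilinear br" and N_pos: "0 < N"
    and csubspace_G: "csubspace G" and csubspace_V: "csubspace (V k)"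
    and V_0: "V 0 = UNIV" and V_Suc: "V (Suc k) \<subseteq> V k" and V_N: "V N = {0}"
    and G_V: "G \<subseteq> V 1"
    and br_G: "a \<in> G \<Longrightarrow> b \<in> G \<Longrightarrow> br a b \<in> G"
    and br_V: "a \<in> G \<Longrightarrow> v \<in> V k \<Longrightarrow> br a v \<in> V (Suc k)"
    and skew: "a \<in> G \<Longrightarrow> b \<in> G \<Longrightarrow> br a b = - br b a"
    and jacobi: "a \<in> G \<Longrightarrow> b \<in> G \<Longrightarrow> br a (br b v) = br (br a b) v + br b (br a v)"
begin

lemmas br_simps = cbilinear_add_left[OF bilinear] cbilinear_add_right[OF bilinear]
  cbilinear_scale_left[OF bilinear] cbilinear_scale_right[OF bilinear]
  cbilinear_zero_left[OF bilinear] cbilinear_zero_right[OF bilinear]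
  cbilinear_minus_left[OF bilinear] cbilinear_minus_right[OF bilinear]
  cbilinear_diff_left[OF bilinear] cbilinear_diff_right[OF bilinear]

lemma G_0: "0 \<in> G" and G_add: "a \<in> G \<Longrightarrow> b \<in> G \<Longrightarrow> a + b \<in> G"
  and G_minus: "a \<in> G \<Longrightarrow> - a \<in> G" and G_scale: "a \<in> G \<Longrightarrow> c *\<^sub>C a \<in> G"
  by (simp_all add: csubspace_0 csubspace_add csubspace_minus csubspace_scale csubspace_G)

lemma V_mono: "k \<le> l \<Longrightarrow> V l \<subseteq> V k"
  by (rule lift_Suc_antimono_le) (rule V_Suc)

lemma V_zero: "v \<in> V k \<Longrightarrow> N \<le> k \<Longrightarrow> v = 0"
  using V_mono V_N by blast

lemma br_self: "a \<in> G \<Longrightarrow> br a a = 0"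
proof -
  assume "a \<in> G"
  then have "br a a + br a a = 0" using skew[of a a] by (metis add.right_inverse)
  then have "(1/2) *\<^sub>C (br a a + br a a) = 0" by simp
  then show ?thesis
    by (simp add: scaleC_add_right scaleC_add_left[symmetric] scaleC_one)
qed

lemma br_funpow_V: "a \<in> G \<Longrightarrow> v \<in> V k \<Longrightarrow> (br a ^^ n) v \<in> V (n + k)"
  by (induction n) (simp_all add: br_V)

lemma br_funpow_zero: "a \<in> G \<Longrightarrow> N \<le> n \<Longrightarrow> (br a ^^ n) v = 0"
  using br_funpow_V[of a v 0 n] V_zero V_0 by auto

lemma nested_brk_G: "set ws \<subseteq> G \<Longrightarrow> nested_brk br ws \<in> G \<inter> V (length ws)"
proof (induction ws rule: induct_list012)
  case 1
  show ?case using csubspace_0[OF csubspace_V] G_0 by simp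
next
  case (2 x)
  then show ?case using G_V by auto
next
  case (3 x y zs)
  then show ?case using br_G br_V by simp
qed

lemma nilpotent_pair_G: "a \<in> G \<Longrightarrow> b \<in> G \<Longrightarrow> nilpotent_pair br N a b"
  unfolding nilpotent_pair_def using nested_brk_G V_zero by (metis IntD2 empty_subsetI insert_subset subset_trans)

lemma dynkin_G: "a \<in> G \<Longrightarrow> b \<in> G \<Longrightarrow> dynkin br a b \<in> G"
  by (rule dynkin_in_subspace[OF nilpotent_pair_G csubspace_G]) (use nested_brk_G in auto)

lemma dynkin_in_subalgebra:
  assumes "csubspace S" "S \<subseteq> G" "\<And>x y. x \<in> S \<Longrightarrow> y \<in> S \<Longrightarrow> br x y \<in> S" "a \<in> S" "b \<in> S"
  shows "dynkin br a b \<in> S"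
proof (rule dynkin_in_subspace[OF nilpotent_pair_G assms(1)])
  fix ws assume "set ws \<subseteq> {a, b}"
  then show "nested_brk br ws \<in> S"
    using assms csubspace_0[OF assms(1)] by (induction ws rule: induct_list012) auto
qed (use assms in auto)

lemma dynkin_mod:
  assumes "a \<in> G" "b \<in> G" "csubspace S" "br a b \<in> S"
    and "\<And>x. x \<in> S \<Longrightarrow> br a x \<in> S" "\<And>x. x \<in> S \<Longrightarrow> br b x \<in> S"
  shows "dynkin br a b - (a + b) \<in> S"
  by (rule dynkin_mod_sum[OF nilpotent_pair_G])
    (use assms br_self skew[of b a] csubspace_minus[OF assms(3)] in auto)

lemma dynkin_commuting:
  assumes "a \<in> G" "b \<in> G" "br a b = 0"
  shows "dynkin br a b = a + b"
  using dynkin_mod[OF assms(1,2), of "{0}"] assms(3)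
  by (simp add: cvec.subspace_0 csubspaceI br_simps)

lemma dynkin_0: "a \<in> G \<Longrightarrow> dynkin br a 0 = a" "a \<in> G \<Longrightarrow> dynkin br 0 a = a"
  using dynkin_commuting[of a 0] dynkin_commuting[of 0 a] by (simp_all add: G_0 br_simps)

lemma dynkin_inverse: "a \<in> G \<Longrightarrow> dynkin br a (- a) = 0" "a \<in> G \<Longrightarrow> dynkin br (- a) a = 0"
  using dynkin_commuting[of a "- a"] dynkin_commuting[of "- a" a] by (simp_all add: G_minus br_simps br_self)

text \<open>The operator \<open>e\<^bsup>ad a\<^esup>\<close>.\<close>

definition Ad :: "'v \<Rightarrow> 'v \<Rightarrow> 'v"
  where "Ad a v = (\<Sum>n<N. (1 / fact n) *\<^sub>C (br a ^^ n) v)"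

end

text \<open>A derivation \<open>der\<close> can be adjoined to the Lie algebra as an element \<open>d\<close> with \<open>[d, a] = der a\<close>.
  The operator \<open>ext a\<close> below is the adjoint action of \<open>a\<close> on \<open>V \<oplus> \<complex>d\<close>, where
  \<open>[a, d] = - der a\<close>. Its exponential applied to \<open>w + d\<close> is the formula for gauge
  transformations if \<open>der\<close> is the differential; if \<open>der\<close> is injective on \<open>G\<close>, then \<open>ext\<close> is
  faithful.\<close>

locale nilpotent_lie_derivation = nilpotent_lie +
  fixes der :: "'a \<Rightarrow> 'a"
  assumes clinear_der: "clinear der"
    and der_V: "a \<in> G \<Longrightarrow> der a \<in> V 1"
    and der_br: "a \<in> G \<Longrightarrow> b \<in> G \<Longrightarrow> der (br a b) = br a (der b) - br b (der a)"
begin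

definition ext :: "'a \<Rightarrow> ('a \<times> complex) cend"
  where "ext a = Cend (\<lambda>(v, c). (br a v - c *\<^sub>C der a, 0))"

lemma app_ext: "app (ext a) (v, c) = (br a v - c *\<^sub>C der a, 0)"
proof -
  have "clinear (\<lambda>(v, c). (br a v - c *\<^sub>C der a, 0 :: complex))"
    by (rule clinearI)
      (auto simp: br_simps scaleC_simps scaleC_complex_def algebra_simps split: prod.splits)
  then show ?thesis by (simp add: ext_def app_Cend)
qed

lemma clinear_ext: "clinear ext"
  by (intro clinearI cend_eqI)
    (auto simp: app_ext br_simps clinear_add[OF clinear_der] clinear_scale[OF clinear_der] scaleC_simps mult.commute)

lemma ext_br: "a \<in> G \<Longrightarrow> b \<in> G \<Longrightarrow> ext (br a b) = commutator (ext a) (ext b)"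
proof (rule cend_eqI, clarify)
  fix v c assume "a \<in> G" "b \<in> G"
  then show "app (ext (br a b)) (v, c) = app (commutator (ext a) (ext b)) (v, c)"
    using jacobi[of a b v]
    by (simp add: commutator_def app_ext der_br br_simps scaleC_simps algebra_simps)
qed

text \<open>The first operator that acts may send \<open>d\<close> to \<open>V 1\<close>; each of the others raises the
  filtration degree.\<close>

lemma ext_words:
  "set ws \<subseteq> ext ` G \<Longrightarrow> ws \<noteq> [] \<Longrightarrow> fst (app (prod_list ws) z) \<in> V (length ws) \<and> snd (app (prod_list ws) z) = 0"
proof (induction ws)
  case (Cons w ws)
  then obtain a where a: "a \<in> G" "w = ext a" by auto
  obtain v c where vc: "app (prod_list ws) z = (v, c)" by fastforce
  show ?case
  proof (cases "ws = []")
    case True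
    have "br a v - c *\<^sub>C der a \<in> V 1"
      using br_V[OF a(1), of v 0] V_0 der_V[OF a(1)]
      by (simp add: csubspace_diff[OF csubspace_V] csubspace_scale[OF csubspace_V])
    then show ?thesis using True by (simp add: a(2) vc[simplified True, simplified] app_ext)
  next
    case False
    then have "v \<in> V (length ws)" "c = 0" using Cons vc by auto
    then show ?thesis using br_V[OF a(1)] by (simp add: a(2) vc app_ext)
  qed
qed simp

lemma ext_words_zero: "set ws \<subseteq> ext ` G \<Longrightarrow> N \<le> length ws \<Longrightarrow> prod_list ws = 0"
  using ext_words[of ws] V_zero N_pos
  by (intro cend_eqI) (metis app_simps(1) le_zero_eq length_0_conv neq0_conv prod.collapse zero_prod_def)

lemma ext_nilpotent: "a \<in> G \<Longrightarrow> ext a ^ N = 0"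
  using ext_words_zero[of "replicate N (ext a)"] by (auto simp: set_replicate_conv_if)

theorem nexp_ext_dynkin:
  assumes "a \<in> G" "b \<in> G"
  shows "nexp (ext (dynkin br a b)) = nexp (ext a) * nexp (ext b)"
proof -
  have words: "prod_list ws = 0" if "set ws \<subseteq> {ext a, ext b}" "N \<le> length ws" for ws
    by (rule ext_words_zero) (use that assms in auto)
  interpret nilpotent_words "ext a" "ext b" N by standard (rule words)
  have "ext (dynkin br a b) = dynkin commutator (ext a) (ext b)"
    by (rule dynkin_hom[where G = G and N = N and N' = N])
      (simp_all add: nilpotent_pair_G nilpotent_pair clinear_ext ext_br br_G G_0 assms)
  then show ?thesis using nexp_dynkin(1)[OF words] by simp
qed

lemma ext_funpow: "(app (ext a) ^^ n) (v, 0) = ((br a ^^ n) v, 0)"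
  by (induction n) (simp_all add: app_ext)

lemma sum_Pair: "(\<Sum>i\<in>S. (g i, h i)) = (\<Sum>i\<in>S. g i, \<Sum>i\<in>S. h i)"
  by (induction S rule: infinite_finite_induct) (simp_all add: zero_prod_def)

lemma app_nexp_ext_0:
  assumes "a \<in> G"
  shows "app (nexp (ext a)) (v, 0) = (Ad a v, 0)"
  by (simp add: app_nil_eval[OF ext_nilpotent[OF assms]] ext_funpow Ad_def sum_Pair)

lemma app_nexp_ext_1:
  assumes "a \<in> G"
  shows "app (nexp (ext a)) (v, 1) = (v + (\<Sum>n<N. (1 / fact (n + 1)) *\<^sub>C (br a ^^ n) (br a v - der a)), 1)"
proof -
  have nil: "ext a ^ Suc N = 0" using ext_nilpotent[OF assms] by simp
  have "app (nexp (ext a)) (v, 1)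
      = (v, 1) + (\<Sum>n<N. (1 / fact (Suc n)) *\<^sub>C (app (ext a) ^^ n) (br a v - der a, 0))"
    unfolding app_nil_eval[OF nil] sum.lessThan_Suc_shift
    by (simp add: funpow_swap1 app_ext scaleC_one del: fact_Suc)
  then show ?thesis
    by (simp add: ext_funpow sum_Pair del: fact_Suc)
qed

lemma nexp_ad_ext:
  assumes "a \<in> G" "b \<in> G"
  shows "nexp (ext a) * ext b * nexp (- ext a) = ext (Ad a b)"
proof -
  have mem: "(br a ^^ n) b \<in> G" for n
    by (induction n) (simp_all add: assms br_G)
  have pow: "(app (ad (ext a)) ^^ n) (ext b) = ext ((br a ^^ n) b)" for n
    by (induction n) (simp_all add: app_ad ext_br assms mem)
  have "app (nexp (ad (ext a))) (ext b) = (\<Sum>n<2 * N. (1 / fact n) *\<^sub>C ext ((br a ^^ n) b))"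
    by (simp add: app_nil_eval[OF ad_nilpotent[OF ext_nilpotent[OF assms(1)]]] pow)
  also have "\<dots> = (\<Sum>n<N. (1 / fact n) *\<^sub>C ext ((br a ^^ n) b))"
    by (rule sum.mono_neutral_right)
      (auto simp: br_funpow_zero[OF assms(1)] clinear_zero[OF clinear_ext])
  also have "\<dots> = ext (Ad a b)"
    by (simp add: Ad_def clinear_sum[OF clinear_ext] clinear_scale[OF clinear_ext])
  finally show ?thesis by (simp add: app_nexp_ad[OF ext_nilpotent[OF assms(1)]])
qed

lemma nexp_ext_minus: "a \<in> G \<Longrightarrow> nexp (ext (- a)) = nexp (- ext a)"
  by (simp add: clinear_minus[OF clinear_ext])

end

\<comment> \<open>filtration degree \<open>1\<close> occurs in the parameters of the following locales and must
    not be rewritten to \<open>Suc 0\<close>\<close>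
declare One_nat_def [simp del]

section \<open>The exponential group of a nilpotent Lie algebra\<close>

text \<open>A multiplicative filtration \<open>GF\<close> gives rise to a Rees algebra; \<open>GF 1\<close> plays the part of
  \<open>G\<close>.\<close>

locale filtered_lie = nilpotent_lie br "GF 1" V N
  for br :: "'v::complex_vector \<Rightarrow> 'v \<Rightarrow> 'v" and GF :: "nat \<Rightarrow> 'v set" and V N +
  assumes csubspace_GF: "csubspace (GF k)" and GF_Suc: "GF (Suc k) \<subseteq> GF k" and GF_V: "GF k \<subseteq> V k"
    and br_GF: "a \<in> GF i \<Longrightarrow> b \<in> GF j \<Longrightarrow> br a b \<in> GF (i + j)"
begin

text \<open>The elements \<open>\<Sum> p\<^sub>n t\<^sup>n\<close> with \<open>p\<^sub>n \<in> GF n\<close> and \<open>p\<^sub>0 = 0\<close>, represented by their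
  coefficients. They have the derivation \<open>t d/dt\<close>, which is injective because of \<open>p\<^sub>0 = 0\<close>;
  \<open>GF 1\<close> itself may have no faithful nilpotent representation of the form \<open>ext\<close>. An element
  \<open>a\<close> of \<open>GF 1\<close> lifts to \<open>a t\<close> and is recovered at \<open>t = 1\<close>.\<close>

definition rees :: "(nat \<Rightarrow> 'v) set"
  where "rees = {p. p 0 = 0 \<and> (\<forall>n. p n \<in> GF n)}"

definition rees_br :: "(nat \<Rightarrow> 'v) \<Rightarrow> (nat \<Rightarrow> 'v) \<Rightarrow> nat \<Rightarrow> 'v"
  where "rees_br p q n = (\<Sum>i\<le>n. br (p i) (q (n - i)))"

definition rees_deg :: "(nat \<Rightarrow> 'v) \<Rightarrow> nat \<Rightarrow> 'v"
  where "rees_deg p n = of_nat n *\<^sub>C p n"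

definition at_one :: "(nat \<Rightarrow> 'v) \<Rightarrow> 'v"
  where "at_one p = (\<Sum>n<N. p n)"

definition rees_lift :: "'v \<Rightarrow> nat \<Rightarrow> 'v"
  where "rees_lift a n = (if n = 1 then a else 0)"

lemma rees_in_G: "p \<in> rees \<Longrightarrow> p n \<in> GF 1"
proof (cases n)
  case (Suc m)
  assume "p \<in> rees"
  then have "p n \<in> GF n" by (simp add: rees_def)
  moreover have "GF n \<subseteq> GF 1"
    by (rule lift_Suc_antimono_le[of GF 1 n]) (use GF_Suc Suc in auto)
  ultimately show ?thesis by blast
qed (simp add: rees_def csubspace_0[OF csubspace_GF])

lemma triangle_sums:
  fixes f :: "nat \<Rightarrow> nat \<Rightarrow> 'b::comm_monoid_add"
  shows "(\<Sum>i\<le>n. \<Sum>j\<le>n - i. f i j) = (\<Sum>k\<le>n. \<Sum>i\<le>k. f i (k - i))"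
    and "(\<Sum>j\<le>n. \<Sum>i\<le>n - j. f i j) = (\<Sum>k\<le>n. \<Sum>i\<le>k. f i (k - i))"
proof -
  have S: "{(i, j). i + j \<le> n} = (SIGMA i:{..n}. {..n - i})" by auto
  show 1: "(\<Sum>i\<le>n. \<Sum>j\<le>n - i. f i j) = (\<Sum>k\<le>n. \<Sum>i\<le>k. f i (k - i))" for f :: "nat \<Rightarrow> nat \<Rightarrow> 'b"
    unfolding sum.triangle_reindex_eq[symmetric] S by (simp add: sum.Sigma)
  show "(\<Sum>j\<le>n. \<Sum>i\<le>n - j. f i j) = (\<Sum>k\<le>n. \<Sum>i\<le>k. f i (k - i))"
    unfolding 1[of "\<lambda>j i. f i j"]
  proof (rule sum.cong[OF refl])
    fix k show "(\<Sum>j\<le>k. f (k - j) j) = (\<Sum>i\<le>k. f i (k - i))"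
      by (rule sum.reindex_bij_witness[where i = "\<lambda>i. k - i" and j = "\<lambda>i. k - i"]) auto
  qed
qed

lemma rees_br_skew: "p \<in> rees \<Longrightarrow> q \<in> rees \<Longrightarrow> rees_br p q = - rees_br q p"
proof
  fix n assume "p \<in> rees" "q \<in> rees"
  then have "(\<Sum>i\<le>n. br (p i) (q (n - i))) = (\<Sum>i\<le>n. - br (q (n - i)) (p i))"
    by (intro sum.cong refl skew rees_in_G)
  also have "\<dots> = - (\<Sum>i\<le>n. br (q i) (p (n - i)))"
    unfolding sum_negf
    by (intro arg_cong[of _ _ uminus] sum.reindex_bij_witness[where i = "\<lambda>i. n - i" and j = "\<lambda>i. n - i"]) auto
  finally show "rees_br p q n = (- rees_br q p) n" by (simp add: rees_br_def)
qed

lemma rees_br_jacobi: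
  assumes "p \<in> rees" "q \<in> rees"
  shows "rees_br p (rees_br q u) = rees_br (rees_br p q) u + rees_br q (rees_br p u)"
proof
  fix n
  let ?A = "\<lambda>i j. br (p i) (br (q j) (u (n - (i + j))))"
  let ?B = "\<lambda>i j. br (q j) (br (p i) (u (n - (i + j))))"
  let ?C = "\<lambda>i j. br (br (p i) (q j)) (u (n - (i + j)))"
  have "rees_br p (rees_br q u) n = (\<Sum>i\<le>n. \<Sum>j\<le>n - i. ?A i j)"
    unfolding rees_br_def by (simp add: cbilinear_sum_right[OF bilinear])
  then have A: "rees_br p (rees_br q u) n = (\<Sum>k\<le>n. \<Sum>i\<le>k. ?A i (k - i))"
    unfolding triangle_sums .
  have "rees_br q (rees_br p u) n = (\<Sum>j\<le>n. \<Sum>i\<le>n - j. ?B i j)"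
    unfolding rees_br_def by (simp add: cbilinear_sum_right[OF bilinear] add.commute)
  then have B: "rees_br q (rees_br p u) n = (\<Sum>k\<le>n. \<Sum>i\<le>k. ?B i (k - i))"
    by (simp only: triangle_sums(2)[of ?B])
  have C: "rees_br (rees_br p q) u n = (\<Sum>k\<le>n. \<Sum>i\<le>k. ?C i (k - i))"
    unfolding rees_br_def by (simp add: cbilinear_sum_left[OF bilinear])
  have "?A i j = ?C i j + ?B i j" for i j
    by (rule jacobi[OF rees_in_G[OF assms(1)] rees_in_G[OF assms(2)]])
  then show "rees_br p (rees_br q u) n = (rees_br (rees_br p q) u + rees_br q (rees_br p u)) n"
    unfolding A plus_fun_apply B C sum.distrib[symmetric] by (intro sum.cong refl) blast
qed

lemma rees_br_rees: "p \<in> rees \<Longrightarrow> q \<in> rees \<Longrightarrow> rees_br p q \<in> rees"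
  unfolding rees_def rees_br_def
  by (auto intro!: csubspace_sum[OF csubspace_GF] simp: br_simps)
    (metis br_GF le_add_diff_inverse)

lemma rees_deg_derivation:
  assumes "p \<in> rees" "q \<in> rees"
  shows "rees_deg (rees_br p q) = rees_br p (rees_deg q) - rees_br q (rees_deg p)"
proof
  fix n
  have "rees_br q (rees_deg p) n = (\<Sum>i\<le>n. br (q (n - i)) (rees_deg p i))"
    unfolding rees_br_def
    by (rule sum.reindex_bij_witness[where i = "\<lambda>i. n - i" and j = "\<lambda>i. n - i"]) auto
  also have "\<dots> = (\<Sum>i\<le>n. - (of_nat i *\<^sub>C br (p i) (q (n - i))))"
    by (intro sum.cong refl)
      (simp add: rees_deg_def br_simps skew[OF rees_in_G[OF assms(2)] rees_in_G[OF assms(1)]] scaleC_simps)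
  finally have 1: "rees_br q (rees_deg p) n = - (\<Sum>i\<le>n. of_nat i *\<^sub>C br (p i) (q (n - i)))"
    by (simp add: sum_negf)
  have "rees_deg (rees_br p q) n = (\<Sum>i\<le>n. of_nat (n - i) *\<^sub>C br (p i) (q (n - i)) + of_nat i *\<^sub>C br (p i) (q (n - i)))"
    unfolding rees_deg_def rees_br_def cvec.scale_sum_right scaleC_add_left[symmetric] of_nat_add[symmetric]
    by (intro sum.cong) auto
  also have "\<dots> = rees_br p (rees_deg q) n - rees_br q (rees_deg p) n"
  proof -
    have "rees_br p (rees_deg q) n = (\<Sum>i\<le>n. of_nat (n - i) *\<^sub>C br (p i) (q (n - i)))"
      by (simp only: rees_br_def rees_deg_def br_simps)
    then show ?thesis by (simp only: 1 sum.distrib diff_minus_eq_add)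
  qed
  finally show "rees_deg (rees_br p q) n = (rees_br p (rees_deg q) - rees_br q (rees_deg p)) n" by simp
qed

sublocale rees: nilpotent_lie_derivation rees_br rees "\<lambda>k. {u. \<forall>n. u n \<in> V k}" N rees_deg
proof (intro nilpotent_lie_derivation.intro nilpotent_lie_derivation_axioms.intro nilpotent_lie.intro)
  show "cbilinear rees_br"
    unfolding cbilinear_def
    by (auto intro!: clinearI simp: fun_eq_iff rees_br_def scaleC_fun_def br_simps sum.distrib cvec.scale_sum_right)
  show "csubspace rees"
    by (rule csubspaceI)
      (auto simp: rees_def scaleC_fun_def csubspace_0[OF csubspace_GF] csubspace_add[OF csubspace_GF] csubspace_scale[OF csubspace_GF])
  show "csubspace {u. \<forall>n. u n \<in> V k}" for k
    by (rule csubspaceI)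
      (auto simp: scaleC_fun_def csubspace_0[OF csubspace_V] csubspace_add[OF csubspace_V] csubspace_scale[OF csubspace_V])
  show "{u :: nat \<Rightarrow> 'v. \<forall>n. u n \<in> V 0} = UNIV" by (simp add: V_0)
  show "{u :: nat \<Rightarrow> 'v. \<forall>n. u n \<in> V (Suc k)} \<subseteq> {u. \<forall>n. u n \<in> V k}" for k using V_Suc by blast
  show "{u :: nat \<Rightarrow> 'v. \<forall>n. u n \<in> V N} = {0}" by (auto simp: V_N fun_eq_iff)
  show "rees \<subseteq> {u. \<forall>n. u n \<in> V 1}" using rees_in_G G_V by blast
  show "rees_br p u \<in> {u. \<forall>n. u n \<in> V (Suc k)}" if "p \<in> rees" "u \<in> {u. \<forall>n. u n \<in> V k}" for p u k
    using that by (auto simp: rees_br_def intro!: csubspace_sum[OF csubspace_V] br_V rees_in_G)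
  show "clinear rees_deg"
    by (rule clinearI) (auto simp: fun_eq_iff rees_deg_def scaleC_fun_def scaleC_simps mult.commute)
  show "rees_deg p \<in> {u. \<forall>n. u n \<in> V 1}" if "p \<in> rees" for p
    using rees_in_G[OF that] G_V by (auto simp: rees_deg_def intro!: csubspace_scale[OF csubspace_V])
qed (rule N_pos rees_br_skew rees_br_jacobi rees_br_rees rees_deg_derivation; assumption?)+

text \<open>\<open>ext p\<close> sends \<open>d\<close> to \<open>- t dp/dt\<close>, and this determines \<open>p\<close>.\<close>

lemma rees_ext_faithful:
  assumes "p \<in> rees" "q \<in> rees" "nexp (rees.ext p) = nexp (rees.ext q)"
  shows "p = q"
proof
  fix n
  have "rees.ext p = rees.ext q"
    using nexp_inject[OF rees.ext_nilpotent[OF assms(1)] rees.ext_nilpotent[OF assms(2)]] assms(3) by simp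
  then have "app (rees.ext p) (0, 1) = app (rees.ext q) (0, 1)" by simp
  then have "rees_deg p = rees_deg q" by (simp add: rees.app_ext rees.br_simps scaleC_one)
  then have "of_nat n *\<^sub>C p n = of_nat n *\<^sub>C q n" by (metis rees_deg_def)
  then show "p n = q n" using assms(1,2) by (cases n) (auto simp: rees_def simp del: of_nat_Suc)
qed

lemma clinear_at_one: "clinear at_one"
  by (rule clinearI) (simp_all add: at_one_def scaleC_fun_def sum.distrib cvec.scale_sum_right)

text \<open>Evaluation sums the coefficients below \<open>N\<close> only; the products that are cut off lie in
  \<open>V (i + j)\<close> with \<open>i + j \<ge> N\<close> and vanish.\<close>

lemma at_one_rees_br:
  assumes "p \<in> rees" "q \<in> rees"
  shows "at_one (rees_br p q) = br (at_one p) (at_one q)"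
proof -
  let ?f = "\<lambda>i j. br (p i) (q j)"
  have "at_one (rees_br p q) = (\<Sum>(i, j)\<in>{(i, j). i + j < N}. ?f i j)"
    unfolding at_one_def rees_br_def sum.triangle_reindex ..
  also have "\<dots> = (\<Sum>(i, j)\<in>{..<N} \<times> {..<N}. ?f i j)"
  proof (rule sum.mono_neutral_left)
    show "\<forall>x\<in>{..<N} \<times> {..<N} - {(i, j). i + j < N}. (case x of (i, j) \<Rightarrow> ?f i j) = 0"
    proof
      fix x assume "x \<in> {..<N} \<times> {..<N} - {(i, j). i + j < N}"
      then obtain i j where x: "x = (i, j)" "\<not> i + j < N" by (cases x) auto
      moreover have "?f i j \<in> V (i + j)"
        using assms br_GF[of "p i" i "q j" j] GF_V by (auto simp: rees_def)
      ultimately show "(case x of (i, j) \<Rightarrow> ?f i j) = 0" using V_zero by simp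
    qed
  qed auto
  also have "\<dots> = (\<Sum>i<N. \<Sum>j<N. ?f i j)"
    by (simp only: sum.cartesian_product)
  also have "\<dots> = br (at_one p) (at_one q)"
    unfolding at_one_def cbilinear_sum_left[OF bilinear]
    unfolding cbilinear_sum_right[OF bilinear] ..
  finally show ?thesis .
qed

lemma at_one_G: "p \<in> rees \<Longrightarrow> at_one p \<in> GF 1"
  unfolding at_one_def by (rule csubspace_sum[OF csubspace_G]) (rule rees_in_G)

lemma rees_lift: "a \<in> GF 1 \<Longrightarrow> rees_lift a \<in> rees" "a \<in> GF 1 \<Longrightarrow> at_one (rees_lift a) = a"
proof -
  assume a: "a \<in> GF 1"
  then show "rees_lift a \<in> rees" by (auto simp: rees_def rees_lift_def csubspace_0[OF csubspace_GF])
  show "at_one (rees_lift a) = a"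
  proof (cases "1 < N")
    case True
    then show ?thesis by (simp add: at_one_def rees_lift_def sum.delta)
  next
    case False
    then have "a = 0" using V_zero[of a 1] a G_V N_pos by auto
    then show ?thesis by (simp add: at_one_def rees_lift_def)
  qed
qed

lemma at_one_dynkin:
  assumes "p \<in> rees" "q \<in> rees"
  shows "at_one (dynkin rees_br p q) = dynkin br (at_one p) (at_one q)"
  by (rule dynkin_hom[where G = rees and N = N and N' = N])
    (simp_all add: rees.nilpotent_pair_G nilpotent_pair_G at_one_G clinear_at_one at_one_rees_br
      rees_br_rees rees.G_0 assms)

lemma at_one_Ad:
  assumes "p \<in> rees" "q \<in> rees"
  shows "at_one (rees.Ad p q) = Ad (at_one p) (at_one q)"
proof -
  have "(rees_br p ^^ n) q \<in> rees \<and> at_one ((rees_br p ^^ n) q) = (br (at_one p) ^^ n) (at_one q)" for n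
    by (induction n) (simp_all add: assms rees_br_rees at_one_rees_br)
  then show ?thesis
    by (simp add: rees.Ad_def Ad_def clinear_sum[OF clinear_at_one] clinear_scale[OF clinear_at_one])
qed

text \<open>In a faithful representation by nilpotent operators the Dynkin product is multiplication of
  exponentials, which is associative. Evaluation at \<open>t = 1\<close> respects the product and carries the identity
  from the Rees algebra to \<open>GF 1\<close>.\<close>

theorem dynkin_assoc:
  assumes "a \<in> GF 1" "b \<in> GF 1" "c \<in> GF 1"
  shows "dynkin br (dynkin br a b) c = dynkin br a (dynkin br b c)"
proof -
  note R = rees_lift(1)[OF assms(1)] rees_lift(1)[OF assms(2)] rees_lift(1)[OF assms(3)]
  let ?m = "dynkin rees_br"
  have "?m (?m (rees_lift a) (rees_lift b)) (rees_lift c) = ?m (rees_lift a) (?m (rees_lift b) (rees_lift c))"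
    by (rule rees_ext_faithful) (simp_all add: R rees.dynkin_G rees.nexp_ext_dynkin mult.assoc)
  from arg_cong[OF this, of at_one] show ?thesis
    by (simp add: at_one_dynkin R rees.dynkin_G rees_lift(2)[OF assms(1)] rees_lift(2)[OF assms(2)]
        rees_lift(2)[OF assms(3)])
qed

theorem dynkin_conjugate:
  assumes "a \<in> GF 1" "b \<in> GF 1"
  shows "dynkin br (dynkin br a b) (- a) = Ad a b"
proof -
  note R = rees_lift(1)[OF assms(1)] rees_lift(1)[OF assms(2)]
  let ?m = "dynkin rees_br" and ?a = "rees_lift a" and ?b = "rees_lift b"
  have mem: "rees.Ad ?a ?b \<in> rees"
  proof -
    have "(rees_br ?a ^^ n) ?b \<in> rees" for n by (induction n) (simp_all add: R rees_br_rees)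
    then show ?thesis unfolding rees.Ad_def
      by (intro csubspace_sum csubspace_scale rees.csubspace_G) auto
  qed
  have "nexp (rees.ext (?m (?m ?a ?b) (- ?a))) = nexp (rees.ext ?a) * nexp (rees.ext ?b) * nexp (- rees.ext ?a)"
    by (simp add: R rees.dynkin_G rees.G_minus rees.nexp_ext_dynkin rees.nexp_ext_minus)
  also have "\<dots> = nexp (rees.ext (rees.Ad ?a ?b))"
    by (simp add: nexp_conjugate[OF nexp_inverse[OF rees.ext_nilpotent[OF R(1)]] rees.ext_nilpotent[OF R(2)]]
        rees.nexp_ad_ext[OF R])
  finally have "?m (?m ?a ?b) (- ?a) = rees.Ad ?a ?b"
    by (intro rees_ext_faithful mem rees.dynkin_G rees.G_minus R)
  from arg_cong[OF this, of at_one] show ?thesis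
    by (simp add: at_one_dynkin at_one_Ad R rees.dynkin_G rees.G_minus rees_lift(2)[OF assms(1)]
        rees_lift(2)[OF assms(2)] clinear_minus[OF clinear_at_one])
qed

end

section \<open>Filtered differential graded Lie algebras\<close>

text \<open>The model is \<open>K \<otimes> A\<close> with \<open>F i k = K\<^sup>i \<otimes> \<mm>\<^sup>k\<close>. The graded pieces \<open>F i 0\<close>
  span the space so that identities between homogeneous elements extend by linearity.\<close>

locale filtered_dgla =
  fixes K :: "'v::complex_vector dgla_data" and F :: "int \<Rightarrow> nat \<Rightarrow> 'v set" and N :: nat
  assumes bilinear: "cbilinear (brk K)" and clinear_dif: "clinear (dif K)" and N_pos: "0 < N"
    and csubspace_F: "csubspace (F i k)" and F_Suc: "F i (Suc k) \<subseteq> F i k" and F_N: "F i N = {0}"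
    and span_F: "cspan (\<Union>i. F i 0) = UNIV"
    and brk_F: "x \<in> F i k \<Longrightarrow> y \<in> F j l \<Longrightarrow> brk K x y \<in> F (i + j) (k + l)"
    and dif_F: "x \<in> F i k \<Longrightarrow> dif K x \<in> F (i + 1) k"
    and skew: "x \<in> F i 0 \<Longrightarrow> y \<in> F j 0 \<Longrightarrow> brk K x y = - ((-1) powi (i * j) *\<^sub>C brk K y x)"
    and jacobi_homogeneous: "x \<in> F i 0 \<Longrightarrow> y \<in> F j 0 \<Longrightarrow> z \<in> F h 0 \<Longrightarrow>
      brk K x (brk K y z) = brk K (brk K x y) z + (-1) powi (i * j) *\<^sub>C brk K y (brk K x z)"
    and dif_dif: "dif K (dif K x) = 0"
    and leibniz: "x \<in> F i 0 \<Longrightarrow>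
      dif K (brk K x y) = brk K (dif K x) y + (-1) powi i *\<^sub>C brk K x (dif K y)"
begin

abbreviation br where "br \<equiv> brk K"
abbreviation d where "d \<equiv> dif K"

lemmas br_simps = cbilinear_add_left[OF bilinear] cbilinear_add_right[OF bilinear]
  cbilinear_scale_left[OF bilinear] cbilinear_scale_right[OF bilinear]
  cbilinear_zero_left[OF bilinear] cbilinear_zero_right[OF bilinear]
  cbilinear_minus_left[OF bilinear] cbilinear_minus_right[OF bilinear]
  cbilinear_diff_left[OF bilinear] cbilinear_diff_right[OF bilinear]

lemmas d_simps = clinear_zero[OF clinear_dif] clinear_add[OF clinear_dif] clinear_scale[OF clinear_dif]
  clinear_minus[OF clinear_dif] clinear_diff[OF clinear_dif]

lemma F_0: "0 \<in> F i k" and F_add: "x \<in> F i k \<Longrightarrow> y \<in> F i k \<Longrightarrow> x + y \<in> F i k"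
  and F_diff: "x \<in> F i k \<Longrightarrow> y \<in> F i k \<Longrightarrow> x - y \<in> F i k"
  and F_minus: "x \<in> F i k \<Longrightarrow> - x \<in> F i k" and F_scale: "x \<in> F i k \<Longrightarrow> c *\<^sub>C x \<in> F i k"
  by (simp_all add: csubspace_0 csubspace_add csubspace_diff csubspace_minus csubspace_scale csubspace_F)

lemmas F_sum = csubspace_sum[OF csubspace_F]

lemma F_antimono: "k \<le> l \<Longrightarrow> x \<in> F i l \<Longrightarrow> x \<in> F i k"
  using lift_Suc_antimono_le[of "F i" k l] F_Suc by blast

lemma F_to_0: "x \<in> F i k \<Longrightarrow> x \<in> F i 0"
  by (rule F_antimono) simp_all

lemma F_zero: "x \<in> F i k \<Longrightarrow> N \<le> k \<Longrightarrow> x = 0"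
  using F_antimono[of N k x i] F_N by auto

lemma brk_F1: "x \<in> F i k \<Longrightarrow> y \<in> F j 1 \<Longrightarrow> br x y \<in> F (i + j) (Suc k)"
  and brk_F1': "x \<in> F i 1 \<Longrightarrow> y \<in> F j k \<Longrightarrow> br x y \<in> F (i + j) (Suc k)"
  unfolding Suc_eq_plus1 using brk_F[of x i k y j 1] brk_F[of x i 1 y j k] by (simp_all add: add.commute)

lemma jacobi:
  assumes "x \<in> F i 0" "y \<in> F j 0"
  shows "br x (br y v) = br (br x y) v + (-1) powi (i * j) *\<^sub>C br y (br x v)"
proof (rule clinear_eq_on_cspan[where x = v])
  show "clinear (\<lambda>v. br x (br y v))" by (rule clinearI) (simp_all add: br_simps)
  show "clinear (\<lambda>v. br (br x y) v + (-1) powi (i * j) *\<^sub>C br y (br x v))"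
    by (rule clinearI) (simp_all add: br_simps scaleC_simps mult.commute)
  show "v \<in> cspan (\<Union>i. F i 0)" by (simp add: span_F)
qed (use jacobi_homogeneous[OF assms] in auto)

lemma skew_0: "x \<in> F 0 0 \<Longrightarrow> y \<in> F j 0 \<Longrightarrow> br x y = - br y x"
  and skew_11: "x \<in> F 1 0 \<Longrightarrow> y \<in> F 1 0 \<Longrightarrow> br x y = br y x"
  and skew_12: "x \<in> F 1 0 \<Longrightarrow> y \<in> F 2 0 \<Longrightarrow> br x y = - br y x"
  using skew[of x 0 y j] skew[of x 1 y 1] skew[of x 1 y 2] by (simp_all add: scaleC_one)

lemma jacobi_0: "x \<in> F 0 0 \<Longrightarrow> y \<in> F j 0 \<Longrightarrow> br x (br y v) = br (br x y) v + br y (br x v)"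
  and jacobi_11: "x \<in> F 1 0 \<Longrightarrow> y \<in> F 1 0 \<Longrightarrow> br x (br y v) = br (br x y) v - br y (br x v)"
  using jacobi[of x 0 y j v] jacobi[of x 1 y 1 v] by (simp_all add: scaleC_one)

lemma leibniz_0: "x \<in> F 0 0 \<Longrightarrow> d (br x y) = br (d x) y + br x (d y)"
  and leibniz_1: "x \<in> F 1 0 \<Longrightarrow> d (br x y) = br (d x) y - br x (d y)"
  and leibniz_m1: "x \<in> F (-1) 0 \<Longrightarrow> d (br x y) = br (d x) y - br x (d y)"
  using leibniz[of x 0 y] leibniz[of x 1 y] leibniz[of x "-1" y] by (simp_all add: scaleC_one power_int_minus)

text \<open>The filtration of the whole space mixes all degrees, since \<open>F 0 1\<close> acts on each \<open>F i k\<close>.\<close>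

sublocale lie: filtered_lie br "F 0" "\<lambda>k. cspan (\<Union>i. F i k)" N
proof (intro filtered_lie.intro filtered_lie_axioms.intro nilpotent_lie.intro)
  show "cspan (\<Union>i. F i (Suc k)) \<subseteq> cspan (\<Union>i. F i k)" for k
    by (rule cvec.span_mono) (use F_Suc in blast)
  show "cspan (\<Union>i. F i N) = {0}" by (simp add: F_N)
  have sub: "F 0 k \<subseteq> cspan (\<Union>i. F i k)" for k
    by (blast intro: cvec.span_base)
  show "F 0 1 \<subseteq> cspan (\<Union>i. F i 1)" and "F 0 k \<subseteq> cspan (\<Union>i. F i k)" for k
    by (rule sub)+
  show "br a b \<in> F 0 1" if "a \<in> F 0 1" "b \<in> F 0 1" for a b
    using brk_F[OF that] F_antimono[of 1 "1 + 1"] by simp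
  show "br a v \<in> cspan (\<Union>i. F i (Suc k))" if "a \<in> F 0 1" "v \<in> cspan (\<Union>i. F i k)" for a v k
  proof (rule clinear_cspan_subset[where f = "br a", OF _ _ cvec.subspace_span that(2)])
    show "clinear (br a)" using bilinear by (simp add: cbilinear_def)
    fix x assume "x \<in> (\<Union>i. F i k)"
    then obtain i where "x \<in> F i k" by blast
    then have "br a x \<in> F i (Suc k)" using brk_F1'[OF that(1), of x i k] by simp
    then show "br a x \<in> cspan (\<Union>i. F i (Suc k))" by (blast intro: cvec.span_base)
  qed
  show "br a b = - br b a" if "a \<in> F 0 1" "b \<in> F 0 1" for a b
    by (rule skew_0[of _ _ 0]) (use that F_to_0 in blast)+
  show "br a (br b v) = br (br a b) v + br b (br a v)" if "a \<in> F 0 1" "b \<in> F 0 1" for a b v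
    by (rule jacobi_0[of _ _ 0]) (use that F_to_0 in blast)+
  show "br a b \<in> F 0 (i + j)" if "a \<in> F 0 i" "b \<in> F 0 j" for a b i j
    using brk_F[OF that] by simp
qed (simp_all add: bilinear N_pos csubspace_F F_Suc span_F cvec.subspace_span)

sublocale rep: nilpotent_lie_derivation br "F 0 1" "\<lambda>k. cspan (\<Union>i. F i k)" N d
proof (intro nilpotent_lie_derivation.intro nilpotent_lie_derivation_axioms.intro
    lie.nilpotent_lie_axioms clinear_dif)
  show "d a \<in> cspan (\<Union>i. F i 1)" if "a \<in> F 0 1" for a
    using dif_F[OF that] by (blast intro: cvec.span_base)
  show "d (br a b) = br a (d b) - br b (d a)" if "a \<in> F 0 1" "b \<in> F 0 1" for a b
    using leibniz_0[OF F_to_0[OF that(1)], of b]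
      skew_0[OF F_to_0[OF that(2)] F_to_0[OF dif_F[OF that(1)]]] by simp
qed

abbreviation Ad where "Ad \<equiv> lie.Ad"

lemma Ad_0: "Ad a 0 = 0" and Ad_scale: "Ad a (c *\<^sub>C v) = c *\<^sub>C Ad a v"
proof -
  have "(br a ^^ n) 0 = 0 \<and> (br a ^^ n) (c *\<^sub>C v) = c *\<^sub>C (br a ^^ n) v" for n
    by (induction n) (simp_all add: br_simps)
  then show "Ad a 0 = 0" "Ad a (c *\<^sub>C v) = c *\<^sub>C Ad a v"
    by (simp_all add: lie.Ad_def cvec.scale_sum_right scaleC_scaleC mult.commute)
qed

lemma br_funpow_F: "a \<in> F 0 1 \<Longrightarrow> v \<in> F i k \<Longrightarrow> (br a ^^ n) v \<in> F i (n + k)"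
proof (induction n)
  case (Suc n)
  then show ?case using brk_F1'[of a 0 "(br a ^^ n) v" i "n + k"] by simp
qed simp

lemma Ad_F: "a \<in> F 0 1 \<Longrightarrow> v \<in> F i k \<Longrightarrow> Ad a v \<in> F i k"
  unfolding lie.Ad_def
  by (intro F_sum F_scale) (meson F_antimono br_funpow_F le_add2)

lemma Ad_approx:
  assumes "a \<in> F 0 1" "v \<in> F i k"
  shows "Ad a v - v \<in> F i (Suc k)"
proof -
  obtain n where n: "N = Suc n" using N_pos by (cases N) auto
  have "Ad a v = (\<Sum>m<Suc n. (1 / fact m) *\<^sub>C (br a ^^ m) v)"
    unfolding n[symmetric] lie.Ad_def ..
  then have "Ad a v - v = (\<Sum>m<n. (1 / fact (Suc m)) *\<^sub>C (br a ^^ Suc m) v)"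
    unfolding sum.lessThan_Suc_shift by (simp add: scaleC_one)
  also have "\<dots> \<in> F i (Suc k)"
    by (intro F_sum F_scale F_antimono[OF _ br_funpow_F[OF assms]]) simp
  finally show ?thesis .
qed

subsection \<open>Gauge transformations\<close>

lemma gauge_eq:
  assumes "a \<in> F 0 1"
  shows "gauge K a w = w + (\<Sum>n<N. (1 / fact (n + 1)) *\<^sub>C (br a ^^ n) (br a w - d a))"
  unfolding gauge_def
  by (subst Sum_any.expand_superset[of "{..<N}"])
    (auto, metis lie.br_funpow_zero[OF assms] not_le)

lemma nexp_gauge: "a \<in> F 0 1 \<Longrightarrow> app (nexp (rep.ext a)) (w, 1) = (gauge K a w, 1)"
  using rep.app_nexp_ext_1 gauge_eq by simp

text \<open>Exponentials in the representation on \<open>K \<oplus> \<complex>d\<close> multiply according to the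
  Baker--Campbell--Hausdorff product.\<close>

lemma gauge_bch:
  assumes "a \<in> F 0 1" "b \<in> F 0 1"
  shows "gauge K (bch K a b) w = gauge K a (gauge K b w)"
proof -
  have "(gauge K (bch K a b) w, 1 :: complex) = app (nexp (rep.ext (bch K a b))) (w, 1)"
    using assms lie.dynkin_G by (subst nexp_gauge) (simp_all add: bch_eq_dynkin)
  also have "\<dots> = (gauge K a (gauge K b w), 1)"
    using assms by (simp add: bch_eq_dynkin rep.nexp_ext_dynkin nexp_gauge)
  finally show ?thesis by simp
qed

lemma gauge_fixed:
  assumes "a \<in> F 0 1" "br a w = d a"
  shows "gauge K a w = w"
proof -
  have "(br a ^^ n) 0 = 0" for n by (induction n) (simp_all add: br_simps)
  then show ?thesis using assms by (simp add: gauge_eq)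
qed

lemma gauge_0: "gauge K 0 w = w"
  by (rule gauge_fixed) (simp_all add: F_0 br_simps d_simps)

lemma gauge_F: "a \<in> F 0 1 \<Longrightarrow> w \<in> F 1 1 \<Longrightarrow> gauge K a w \<in> F 1 1"
proof -
  assume a: "a \<in> F 0 1" and w: "w \<in> F 1 1"
  have "br a w - d a \<in> F 1 1"
    using brk_F1'[OF a w] F_antimono[of 1 "Suc 1"] dif_F[OF a] by (simp add: F_diff)
  then have "(br a ^^ n) (br a w - d a) \<in> F 1 1" for n
    using br_funpow_F[OF a, of _ 1 1 n] F_antimono[of 1 "n + 1"] by simp
  then show ?thesis unfolding gauge_eq[OF a] by (intro F_add w F_sum F_scale)
qed

text \<open>Each bracket with an element of \<open>F 0 1\<close> or \<open>F 1 1\<close> raises the filtration degree. So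
  a change of order \<open>k\<close> in \<open>a\<close> and \<open>w\<close> enters \<open>e\<^sup>a * w = w - da + \<dots>\<close>, modulo \<open>F 1 (Suc k)\<close>,
  through the terms \<open>w - da\<close> only.\<close>

lemma gauge_approx:
  assumes k: "1 \<le> k" and a: "a \<in> F 0 1" "a' \<in> F 0 1" "a' - a \<in> F 0 k"
    and w: "w \<in> F 1 1" "w' \<in> F 1 1" "w' - w \<in> F 1 k"
  shows "gauge K a' w' - (gauge K a w + (w' - w) - d (a' - a)) \<in> F 1 (Suc k)"
proof -
  define z z' where "z = br a w - d a" and "z' = br a' w' - d a'"
  have z: "z \<in> F 1 1" "z' \<in> F 1 1"
    unfolding z_def z'_def
    using brk_F1'[OF a(1) w(1)] brk_F1'[OF a(2) w(2)] F_antimono[of 1 "Suc 1"] dif_F[OF a(1)] dif_F[OF a(2)]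
    by (simp_all add: F_diff)
  have diff: "br a' y' - br a y \<in> F 1 (Suc k)" if "y \<in> F 1 1" "y' - y \<in> F 1 k" for y y'
  proof -
    have "br a' y' - br a y = br a' (y' - y) + br (a' - a) y" by (simp add: br_simps)
    moreover have "br a' (y' - y) \<in> F 1 (Suc k)" using brk_F1'[OF a(2) that(2)] by simp
    moreover have "br (a' - a) y \<in> F 1 (Suc k)" using brk_F1[OF a(3) that(1)] by simp
    ultimately show ?thesis by (simp add: F_add)
  qed
  have zz: "z' - z + d (a' - a) \<in> F 1 (Suc k)"
  proof -
    have "z' - z + d (a' - a) = br a' w' - br a w" by (simp add: z_def z'_def d_simps)
    then show ?thesis using diff[OF w(1,3)] by simp
  qed
  have "(z' - z + d (a' - a)) - d (a' - a) \<in> F 1 k"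
    by (rule F_diff) (use F_antimono[OF _ zz, of k] dif_F[OF a(3)] in simp_all)
  then have zk: "z' - z \<in> F 1 k" by simp
  \<comment> \<open>the last part records the gain in degree as soon as one bracket is applied\<close>
  have pow: "(br a ^^ n) z \<in> F 1 1 \<and> (br a' ^^ n) z' - (br a ^^ n) z \<in> F 1 k
      \<and> (n \<noteq> 0 \<longrightarrow> (br a' ^^ n) z' - (br a ^^ n) z \<in> F 1 (Suc k))" for n
  proof (induction n)
    case (Suc n)
    have "br a ((br a ^^ n) z) \<in> F 1 (Suc 1)" using brk_F1'[OF a(1), of _ 1 1] Suc by simp
    then show ?case
      using diff[of "(br a ^^ n) z" "(br a' ^^ n) z'"] Suc F_antimono[of 1 "Suc 1"] F_antimono[of k "Suc k"]
      by simp
  qed (use z zk in simp)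
  obtain m where m: "N = Suc m" using N_pos by (cases N) auto
  have "gauge K a' w' - (gauge K a w + (w' - w) - d (a' - a))
      = (\<Sum>n<N. (1 / fact (n + 1)) *\<^sub>C ((br a' ^^ n) z' - (br a ^^ n) z)) + d (a' - a)"
    unfolding gauge_eq[OF a(1)] gauge_eq[OF a(2)] z_def z'_def
    by (simp add: cvec.scale_right_diff_distrib sum_subtractf)
  also have "\<dots> = (z' - z + d (a' - a))
      + (\<Sum>n<m. (1 / fact (Suc n + 1)) *\<^sub>C ((br a' ^^ Suc n) z' - (br a ^^ Suc n) z))"
    unfolding m sum.lessThan_Suc_shift by (simp add: scaleC_one)
  also have "\<dots> \<in> F 1 (Suc k)"
    by (intro F_add zz F_sum F_scale pow[THEN conjunct2, THEN conjunct2, rule_format]) simp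
  finally show ?thesis .
qed

subsection \<open>Curvature\<close>

definition curv :: "'v \<Rightarrow> 'v"
  where "curv x = d x + (1/2) *\<^sub>C br x x"

text \<open>For \<open>z\<close> of degree 1, \<open>D0 + twist z\<close> is the operator \<open>[z + d, -]\<close> on \<open>K \<oplus> \<complex>d\<close>.
  Here \<open>[z, d] = dz\<close> because both elements are odd, and \<open>[d, d] = 0\<close>.\<close>

definition D0 :: "('v \<times> complex) cend" where "D0 = Cend (\<lambda>(v, c). (d v, 0))"

definition twist :: "'v \<Rightarrow> ('v \<times> complex) cend"
  where "twist z = Cend (\<lambda>(v, c). (br z v + c *\<^sub>C d z, 0))"

lemma app_D0: "app D0 (v, c) = (d v, 0)"
proof -
  have "clinear (\<lambda>(v, c :: complex). (d v, 0 :: complex))"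
    by (rule clinearI) (auto simp: d_simps split: prod.splits)
  then show ?thesis by (simp add: D0_def app_Cend)
qed

lemma app_twist: "app (twist z) (v, c) = (br z v + c *\<^sub>C d z, 0)"
proof -
  have "clinear (\<lambda>(v, c). (br z v + c *\<^sub>C d z, 0 :: complex))"
    by (rule clinearI)
      (auto simp: br_simps scaleC_simps scaleC_complex_def algebra_simps split: prod.splits)
  then show ?thesis by (simp add: twist_def app_Cend)
qed

lemma clinear_twist: "clinear twist"
  by (intro clinearI cend_eqI) (auto simp: app_twist br_simps d_simps scaleC_simps mult.commute)

lemma commutator_ext_twist:
  assumes "a \<in> F 0 0" "z \<in> F 1 0"
  shows "commutator (rep.ext a) (twist z) = twist (br a z)"
proof (rule cend_eqI, clarify)
  fix v c
  have "br z (d a) = br (d a) z"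
    using skew_11[of z "d a"] assms dif_F[OF assms(1)] by simp
  then show "app (commutator (rep.ext a) (twist z)) (v, c) = app (twist (br a z)) (v, c)"
    by (simp add: commutator_def rep.app_ext app_twist br_simps jacobi_0[OF assms] leibniz_0[OF assms(1)]
        scaleC_simps algebra_simps)
qed

lemma commutator_ext_D0:
  assumes "a \<in> F 0 0"
  shows "commutator (rep.ext a) D0 = twist (- d a)"
  by (rule cend_eqI, clarify)
    (simp add: commutator_def rep.app_ext app_twist app_D0 br_simps leibniz_0[OF assms] d_simps dif_dif)

text \<open>The automorphism \<open>e\<^bsup>ad a\<^esup>\<close> of \<open>K \<oplus> \<complex>d\<close> carries \<open>w + d\<close> to
  \<open>e\<^sup>a * w + d\<close>, and therefore conjugates the adjoint actions of these elements.\<close>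

lemma nexp_ext_twist:
  assumes a: "a \<in> F 0 1" and w: "w \<in> F 1 0"
  shows "nexp (rep.ext a) * (D0 + twist w) = (D0 + twist (gauge K a w)) * nexp (rep.ext a)"
proof -
  note nil = rep.ext_nilpotent[OF a] and a0 = F_to_0[OF a]
  let ?z = "br a w - d a"
  have z: "?z \<in> F 1 0" using brk_F[OF a0 w] dif_F[OF a0] by (simp add: F_diff)
  have zn: "(br a ^^ n) ?z \<in> F 1 0" for n
    using F_to_0[OF br_funpow_F[OF a z]] .
  have step: "commutator (rep.ext a) (D0 + twist w) = twist ?z"
    by (simp add: clinear_add[OF clinear_commutator] commutator_ext_D0[OF a0] commutator_ext_twist[OF a0 w]
        clinear_diff[OF clinear_twist] clinear_minus[OF clinear_twist])
  have pow: "(app (ad (rep.ext a)) ^^ Suc n) (D0 + twist w) = twist ((br a ^^ n) ?z)" for n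
  proof (induction n)
    case 0
    show ?case by (simp only: funpow.simps o_apply id_apply app_ad step)
  next
    case (Suc n)
    have "(app (ad (rep.ext a)) ^^ Suc (Suc n)) (D0 + twist w)
        = commutator (rep.ext a) ((app (ad (rep.ext a)) ^^ Suc n) (D0 + twist w))"
      unfolding funpow.simps(2)[of "Suc n"] o_apply app_ad ..
    also have "\<dots> = twist (br a ((br a ^^ n) ?z))"
      unfolding Suc by (rule commutator_ext_twist[OF a0 zn])
    finally show ?case by simp
  qed
  have nil2: "ad (rep.ext a) ^ Suc (2 * N) = 0" using ad_nilpotent[OF nil] by simp
  have trunc: "(\<Sum>n<2 * N. (1 / fact (Suc n)) *\<^sub>C twist ((br a ^^ n) ?z))
      = (\<Sum>n<N. (1 / fact (Suc n)) *\<^sub>C twist ((br a ^^ n) ?z))"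
    by (rule sum.mono_neutral_right)
      (auto simp: lie.br_funpow_zero[OF a] clinear_zero[OF clinear_twist])
  have sum: "(\<Sum>n<2 * N. (1 / fact (Suc n)) *\<^sub>C twist ((br a ^^ n) ?z)) = twist (gauge K a w - w)"
    unfolding gauge_eq[OF a] trunc
    by (simp only: add_diff_cancel_left' clinear_sum[OF clinear_twist] clinear_scale[OF clinear_twist] Suc_eq_plus1)
  have "app (nexp (ad (rep.ext a))) (D0 + twist w)
      = D0 + twist w + (\<Sum>n<2 * N. (1 / fact (Suc n)) *\<^sub>C twist ((br a ^^ n) ?z))"
    unfolding app_nil_eval[OF nil2] sum.lessThan_Suc_shift pow
    by (simp add: scaleC_one del: fact_Suc)
  moreover have "D0 + twist w + twist (gauge K a w - w) = D0 + twist (gauge K a w)"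
    by (simp add: clinear_diff[OF clinear_twist])
  ultimately have "app (nexp (ad (rep.ext a))) (D0 + twist w) = D0 + twist (gauge K a w)"
    by (simp only: sum)
  then show ?thesis by (simp only: nexp_mult_ad[OF nil])
qed

text \<open>Because \<open>[w + d, w + d] = 2 curv w\<close>, the curvature is the value of \<open>[w + d, -]\<close> at
  \<open>w + d\<close> itself, and the preceding conjugation carries it to the curvature of \<open>e\<^sup>a * w\<close>.\<close>

theorem curv_gauge:
  assumes a: "a \<in> F 0 1" and w: "w \<in> F 1 0"
  shows "curv (gauge K a w) = Ad a (curv w)"
proof -
  have c: "app (D0 + twist x) (x, 1) = (2 *\<^sub>C curv x, 0)" for x
  proof -
    have "2 *\<^sub>C curv x = (d x + d x) + br x x"
      using scaleC_add_left[of 1 1 "d x"] by (simp add: curv_def scaleC_simps)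
    then show ?thesis by (simp add: app_D0 app_twist scaleC_one)
  qed
  have "(2 *\<^sub>C curv (gauge K a w), 0 :: complex) = app ((D0 + twist (gauge K a w)) * nexp (rep.ext a)) (w, 1)"
    by (simp only: app_simps(6) nexp_gauge[OF a] c)
  also have "\<dots> = app (nexp (rep.ext a)) (app (D0 + twist w) (w, 1))"
    by (simp only: nexp_ext_twist[OF assms, symmetric] app_simps(6))
  also have "\<dots> = (2 *\<^sub>C Ad a (curv w), 0)"
    by (simp only: c rep.app_nexp_ext_0[OF a] Ad_scale)
  finally have "(1/2) *\<^sub>C 2 *\<^sub>C curv (gauge K a w) = (1/2) *\<^sub>C 2 *\<^sub>C Ad a (curv w)" by simp
  then show ?thesis by (simp add: scaleC_simps)
qed

text \<open>The same conjugation, on elements of \<open>K\<close>: \<open>Ad a\<close> intertwines the twisted differentials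
  \<open>d + [w, -]\<close> and \<open>d + [e\<^sup>a * w, -]\<close>.\<close>

lemma twisted_dif_Ad:
  assumes a: "a \<in> F 0 1" and w: "w \<in> F 1 0"
  shows "d (Ad a v) + br (gauge K a w) (Ad a v) = Ad a (d v + br w v)"
proof -
  have "app (D0 + twist (gauge K a w)) (app (nexp (rep.ext a)) (v, 0))
      = app (nexp (rep.ext a)) (app (D0 + twist w) (v, 0))"
    by (simp only: app_simps(6)[symmetric] nexp_ext_twist[OF assms])
  then show ?thesis
    by (simp only: app_simps(3) app_D0 app_twist rep.app_nexp_ext_0[OF a] add_Pair) (simp add: rep.app_nexp_ext_0[OF a])
qed

text \<open>The cubic term \<open>[[w, w], w]\<close> vanishes by the Jacobi identity in characteristic 0.\<close>

lemma bianchi: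
  assumes w: "w \<in> F 1 0"
  shows "d (curv w) = br (curv w) w"
proof -
  have ww: "br w w \<in> F 2 0" and dw: "d w \<in> F 2 0" using brk_F[OF w w] dif_F[OF w] by simp_all
  let ?t = "br (br w w) w"
  have "br w (br w w) = - ?t" using skew_12[OF w ww] .
  then have "- ?t = ?t + ?t" using jacobi_11[OF w w, of w] by simp
  then have "?t + ?t + ?t = 0" by (simp add: neg_eq_iff_add_eq_0 add.assoc)
  moreover have "3 *\<^sub>C ?t = ?t + ?t + ?t"
    using scaleC_add_left[of 2 1 ?t] scaleC_add_left[of 1 1 ?t] by (simp add: scaleC_one)
  ultimately have "?t = 0" by simp
  moreover have "d (curv w) = (1/2) *\<^sub>C (br (d w) w + br (d w) w)"
    using skew_12[OF w dw] by (simp add: curv_def d_simps dif_dif leibniz_1[OF w])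
  moreover have "(1/2) *\<^sub>C (br (d w) w + br (d w) w) = br (d w) w"
    by (simp add: scaleC_add_right scaleC_add_left[symmetric] scaleC_one)
  ultimately show ?thesis by (simp add: curv_def br_simps)
qed

text \<open>If \<open>w\<close> is a Maurer--Cartan element, \<open>d + [w, -]\<close> squares to zero. So
  \<open>l = du + [w, u]\<close> satisfies \<open>dl + [w, l] = 0\<close>, which is the infinitesimal condition for fixing
  \<open>w\<close>, and all terms of \<open>e\<^sup>l * w - w\<close> vanish.\<close>

lemma inner_stabilizer:
  assumes w: "w \<in> F 1 1" "curv w = 0" and u: "u \<in> F (-1) 1"
  shows "d u + br w u \<in> F 0 1" "gauge K (d u + br w u) w = w"
proof -
  let ?l = "d u + br w u"
  note w0 = F_to_0[OF w(1)]
  show l: "?l \<in> F 0 1"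
    using dif_F[OF u] brk_F1'[OF w(1) u] F_antimono[of 1 "Suc 1"] by (simp add: F_add)
  have "br w (br w u) + br w (br w u) = br (br w w) u" using jacobi_11[OF w0 w0, of u] by (metis eq_diff_eq)
  then have "(1/2) *\<^sub>C (br w (br w u) + br w (br w u)) = (1/2) *\<^sub>C br (br w w) u" by simp
  then have sq: "br w (br w u) = (1/2) *\<^sub>C br (br w w) u"
    by (simp add: scaleC_add_right scaleC_add_left[symmetric] scaleC_one)
  have "d ?l + br w ?l = br (d w) u + br w (br w u)"
    by (simp add: d_simps dif_dif leibniz_1[OF w0] br_simps)
  also have "\<dots> = br (curv w) u" by (simp add: sq curv_def br_simps)
  finally have "d ?l + br w ?l = 0" by (simp add: w br_simps)
  then have "d ?l = - br w ?l" by (simp only: eq_neg_iff_add_eq_0)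
  then have "br ?l w = d ?l" using skew_0[OF F_to_0[OF l] w0] by (simp only:)
  then show "gauge K ?l w = w" by (rule gauge_fixed[OF l])
qed

lemma curv_approx:
  assumes "1 \<le> k" "w \<in> F 1 1" "v \<in> F 1 k"
  shows "curv (w + v) - (curv w + d v) \<in> F 2 (Suc k)"
proof -
  have "curv (w + v) - (curv w + d v) = (1/2) *\<^sub>C (br w v + br v w + br v v)"
    by (simp add: curv_def d_simps br_simps scaleC_simps)
  moreover have "br w v \<in> F 2 (Suc k)" "br v w \<in> F 2 (Suc k)" "br v v \<in> F 2 (Suc k)"
    using brk_F1'[OF assms(2,3)] brk_F1[OF assms(3,2)] brk_F1[OF assms(3) F_antimono[OF assms(1,3)]]
    by simp_all
  ultimately show ?thesis by (simp add: F_add F_scale)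
qed

subsection \<open>The exponential group\<close>

lemma bch_F: "a \<in> F 0 1 \<Longrightarrow> b \<in> F 0 1 \<Longrightarrow> bch K a b \<in> F 0 1"
  unfolding bch_eq_dynkin by (rule lie.dynkin_G)

lemma bch_assoc: "a \<in> F 0 1 \<Longrightarrow> b \<in> F 0 1 \<Longrightarrow> c \<in> F 0 1 \<Longrightarrow> bch K (bch K a b) c = bch K a (bch K b c)"
  unfolding bch_eq_dynkin by (rule lie.dynkin_assoc)

lemma bch_simps:
  "a \<in> F 0 1 \<Longrightarrow> bch K a 0 = a" "a \<in> F 0 1 \<Longrightarrow> bch K 0 a = a"
  "a \<in> F 0 1 \<Longrightarrow> bch K a (- a) = 0" "a \<in> F 0 1 \<Longrightarrow> bch K (- a) a = 0"
  unfolding bch_eq_dynkin by (rule lie.dynkin_0 lie.dynkin_inverse; assumption)+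

lemma bch_cancel:
  assumes "a \<in> F 0 1" "b \<in> F 0 1"
  shows "bch K (bch K b a) (- a) = b" "bch K (bch K b (- a)) a = b"
    "bch K (- a) (bch K a b) = b" "bch K a (bch K (- a) b) = b"
  using bch_assoc[of b a "- a"] bch_assoc[of b "- a" a] bch_assoc[of "- a" a b] bch_assoc[of a "- a" b]
    assms by (simp_all add: F_minus bch_simps)

lemma bch_minus:
  assumes "a \<in> F 0 1" "b \<in> F 0 1"
  shows "- bch K a b = bch K (- b) (- a)"
proof -
  let ?c = "bch K a b"
  have c: "?c \<in> F 0 1" by (simp add: assms bch_F)
  have "bch K (bch K (- b) (- a)) ?c = 0"
    using assms by (simp add: bch_assoc F_minus bch_F bch_cancel bch_simps)
  then have "bch K (bch K (bch K (- b) (- a)) ?c) (- ?c) = - ?c"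
    by (simp add: bch_simps F_minus c)
  then show ?thesis using assms c by (simp add: bch_cancel bch_F F_minus)
qed

lemma bch_conjugate: "a \<in> F 0 1 \<Longrightarrow> b \<in> F 0 1 \<Longrightarrow> bch K (bch K a b) (- a) = Ad a b"
  unfolding bch_eq_dynkin by (rule lie.dynkin_conjugate)

text \<open>All longer words contain \<open>a\<close> and \<open>b\<close> at least once, and the one that is in \<open>F 0 k\<close> is
  bracketed with another element of \<open>F 0 1\<close>.\<close>

lemma bch_approx:
  assumes "a \<in> F 0 1" "b \<in> F 0 1" "a \<in> F 0 k \<or> b \<in> F 0 k"
  shows "bch K a b - (a + b) \<in> F 0 (Suc k)"
  unfolding bch_eq_dynkin
proof (rule lie.dynkin_mod[OF assms(1,2) csubspace_F])
  show "br a b \<in> F 0 (Suc k)"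
    using assms brk_F1[of a 0 k b 0] brk_F1'[of a 0 b 0 k] by auto
  show "br a x \<in> F 0 (Suc k)" "br b x \<in> F 0 (Suc k)" if "x \<in> F 0 (Suc k)" for x
    using brk_F1'[OF assms(1) that] brk_F1'[OF assms(2) that] F_Suc by auto
qed

text \<open>The exponents \<open>dm\<close> of the second factor of the gauge group. The group element depends on
  \<open>dm\<close> and not on \<open>m\<close>, so it is the space of boundaries that has to be closed under the product.\<close>

abbreviation B where "B \<equiv> d ` F (-1) 1"

lemma B_F: "c \<in> B \<Longrightarrow> c \<in> F 0 1"
  using dif_F[of _ "-1" 1] by auto

lemma csubspace_B: "csubspace B"
  using F_0 F_add F_scale
  by (intro csubspaceI) (auto simp: image_iff, metis d_simps(1), metis d_simps(2), metis d_simps(3))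

text \<open>\<open>[dm, dm'] = d[m, dm']\<close>, so the boundaries form a Lie subalgebra.\<close>

lemma bch_B: "c \<in> B \<Longrightarrow> c' \<in> B \<Longrightarrow> bch K c c' \<in> B"
  unfolding bch_eq_dynkin
proof (rule lie.dynkin_in_subalgebra[OF csubspace_B])
  show "B \<subseteq> F 0 1" using B_F by blast
  fix x y assume "x \<in> B" "y \<in> B"
  then obtain m where m: "m \<in> F (-1) 1" "x = d m" and y: "y \<in> F 0 1" "d y = 0"
    using B_F dif_dif by auto
  have "br x y = d (br m y)" by (simp add: leibniz_m1[OF F_to_0[OF m(1)]] m y br_simps)
  moreover have "br m y \<in> F (-1) 1"
    using brk_F[OF m(1) y(1)] F_antimono[of 1 "1 + 1"] by simp
  ultimately show "br x y \<in> B" by blast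
qed

lemma gauge_B_0: "c \<in> B \<Longrightarrow> gauge K c 0 = 0"
  by (rule gauge_fixed[OF B_F]) (auto simp: br_simps dif_dif)

end

section \<open>Morphisms and the deformation groupoid\<close>

locale filtered_dgla_hom = src: filtered_dgla K F N + tgt: filtered_dgla K' F' N
  for K :: "'v::complex_vector dgla_data" and F and N and K' :: "'w::complex_vector dgla_data" and F' +
  fixes \<phi> :: "'v \<Rightarrow> 'w"
  assumes clinear_hom: "clinear \<phi>" and hom_F: "x \<in> F i k \<Longrightarrow> \<phi> x \<in> F' i k"
    and hom_brk: "\<phi> (brk K x y) = brk K' (\<phi> x) (\<phi> y)"
    and hom_dif: "\<phi> (dif K x) = dif K' (\<phi> x)"
begin

lemmas hom_simps = clinear_zero[OF clinear_hom] clinear_add[OF clinear_hom] clinear_scale[OF clinear_hom]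
  clinear_minus[OF clinear_hom] clinear_diff[OF clinear_hom]

lemma hom_funpow: "\<phi> ((brk K a ^^ n) v) = (brk K' (\<phi> a) ^^ n) (\<phi> v)"
  by (induction n) (simp_all add: hom_brk)

lemma hom_gauge: "a \<in> F 0 1 \<Longrightarrow> \<phi> (gauge K a w) = gauge K' (\<phi> a) (\<phi> w)"
  by (simp add: src.gauge_eq tgt.gauge_eq hom_F hom_simps clinear_sum[OF clinear_hom] hom_funpow hom_brk hom_dif)

lemma hom_bch: "a \<in> F 0 1 \<Longrightarrow> b \<in> F 0 1 \<Longrightarrow> \<phi> (bch K a b) = bch K' (\<phi> a) (\<phi> b)"
  unfolding bch_eq_dynkin
  by (rule dynkin_hom[where G = UNIV and N = N and N' = N])
    (simp_all add: src.lie.nilpotent_pair_G tgt.lie.nilpotent_pair_G clinear_hom hom_brk hom_F)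

lemma hom_curv: "\<phi> (src.curv x) = tgt.curv (\<phi> x)"
  by (simp add: src.curv_def tgt.curv_def hom_simps hom_brk hom_dif)

lemma hom_B: "c \<in> src.B \<Longrightarrow> \<phi> c \<in> tgt.B"
  using hom_F[of _ "-1" 1] by (auto simp: hom_dif)

definition MC :: "('v \<times> 'w) set"
  where "MC = {(x, a). x \<in> F 1 1 \<and> a \<in> F' 0 1 \<and> src.curv x = 0 \<and> gauge K' a (\<phi> x) = 0}"

definition act :: "'v \<times> 'w \<Rightarrow> 'v \<times> 'w \<Rightarrow> 'v \<times> 'w"
  where "act = (\<lambda>(l, c) (x, a). (gauge K l x, bch K' (bch K' c a) (- \<phi> l)))"

abbreviation grp :: "('v \<times> 'w) set" where "grp \<equiv> F 0 1 \<times> tgt.B"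

text \<open>The group law is componentwise, and by \<open>dynkin_inverse\<close> the inverse of \<open>g\<close> is \<open>- g\<close>.\<close>

definition mult :: "'v \<times> 'w \<Rightarrow> 'v \<times> 'w \<Rightarrow> 'v \<times> 'w"
  where "mult = (\<lambda>(l', c') (l, c). (bch K l' l, bch K' c' c))"

definition equivalent :: "(('v \<times> 'w) \<times> ('v \<times> 'w)) set"
  where "equivalent = {(p, act g p) | p g. p \<in> MC \<and> g \<in> grp}"

lemma mult_grp: "g' \<in> grp \<Longrightarrow> g \<in> grp \<Longrightarrow> mult g' g \<in> grp"
  by (auto simp: mult_def src.bch_F tgt.bch_B split: prod.splits)

lemma grp_minus: "g \<in> grp \<Longrightarrow> - g \<in> grp"
  using csubspace_minus[OF tgt.csubspace_B] by (auto simp: src.F_minus uminus_prod_def)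

text \<open>Gauge transformations preserve the Maurer--Cartan equation by \<open>curv_gauge\<close>. In the second
  component, \<open>e\<^bsup>-\<phi>(l)\<^esup>\<close> undoes the transformation of \<open>x\<close>, after which \<open>e\<^sup>a\<close> gives \<open>0\<close>, and
  \<open>e\<^bsup>dm\<^esup>\<close> fixes \<open>0\<close>.\<close>

lemma act_MC:
  assumes "p \<in> MC" "g \<in> grp"
  shows "act g p \<in> MC"
proof -
  obtain x a where p: "p = (x, a)" "x \<in> F 1 1" "a \<in> F' 0 1" "src.curv x = 0" "gauge K' a (\<phi> x) = 0"
    using assms(1) by (auto simp: MC_def)
  obtain l c where g: "g = (l, c)" "l \<in> F 0 1" "c \<in> tgt.B" using assms(2) by auto
  note c = tgt.B_F[OF g(3)] and l' = hom_F[OF g(2)]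
  have "src.curv (gauge K l x) = 0"
    using src.curv_gauge[OF g(2) src.F_to_0[OF p(2)]] p by (simp add: src.Ad_0)
  moreover have "gauge K' (bch K' (bch K' c a) (- \<phi> l)) (\<phi> (gauge K l x)) = 0"
  proof -
    have "gauge K' (- \<phi> l) (\<phi> (gauge K l x)) = \<phi> x"
      using tgt.gauge_bch[OF tgt.F_minus[OF l'] l', of "\<phi> x"]
      by (simp add: hom_gauge g tgt.bch_simps l' tgt.gauge_0)
    then show ?thesis
      by (simp add: tgt.gauge_bch tgt.bch_F c p l' tgt.F_minus tgt.gauge_B_0 g)
  qed
  ultimately show ?thesis
    by (simp add: p(1) g(1) act_def MC_def src.gauge_F g p tgt.bch_F c l' tgt.F_minus)
qed

lemma act_mult:
  assumes "snd p \<in> F' 0 1" "g \<in> grp" "g' \<in> grp"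
  shows "act g' (act g p) = act (mult g' g) p"
proof -
  obtain x a where p: "p = (x, a)" by fastforce
  obtain l c where g: "g = (l, c)" "l \<in> F 0 1" "c \<in> tgt.B" using assms(2) by auto
  obtain l' c' where g': "g' = (l', c')" "l' \<in> F 0 1" "c' \<in> tgt.B" using assms(3) by auto
  note mem = tgt.B_F[OF g(3)] hom_F[OF g(2)] tgt.B_F[OF g'(3)] hom_F[OF g'(2)] assms(1)[unfolded p snd_conv]
  show ?thesis
    by (simp add: p g(1) g'(1) act_def mult_def src.gauge_bch g(2) g'(2) hom_bch tgt.bch_minus mem
        tgt.bch_assoc tgt.bch_F tgt.F_minus)
qed

lemma act_inverse:
  assumes "snd p \<in> F' 0 1" "g \<in> grp"
  shows "act (- g) (act g p) = p" "act g (act (- g) p) = p"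
proof -
  have e: "act (0, 0) p = p"
    using assms(1)
    by (cases p) (simp add: act_def src.gauge_0 tgt.bch_simps hom_simps tgt.F_0)
  obtain l c where g: "g = (l, c)" "l \<in> F 0 1" "c \<in> F' 0 1" using assms(2) tgt.B_F by auto
  have "mult (- g) g = (0, 0)" "mult g (- g) = (0, 0)"
    by (simp_all add: g(1) mult_def uminus_prod_def src.bch_simps tgt.bch_simps g(2,3))
  then show "act (- g) (act g p) = p" "act g (act (- g) p) = p"
    by (simp_all add: act_mult[OF assms(1)] assms(2) grp_minus e del: mem_Times_iff)
qed

lemma MC_snd: "p \<in> MC \<Longrightarrow> snd p \<in> F' 0 1"
  by (auto simp: MC_def)

lemma equivalentI: "p \<in> MC \<Longrightarrow> g \<in> grp \<Longrightarrow> q = act g p \<Longrightarrow> (p, q) \<in> equivalent"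
  unfolding equivalent_def by blast

lemma equivalentE:
  assumes "(p, q) \<in> equivalent"
  obtains g where "p \<in> MC" "q \<in> MC" "g \<in> grp" "q = act g p"
proof -
  from assms obtain g where g: "p \<in> MC" "g \<in> grp" "q = act g p"
    unfolding equivalent_def by blast
  with act_MC[OF g(1,2)] that show ?thesis by blast
qed

lemma equivalent_trans: "(p, q) \<in> equivalent \<Longrightarrow> (q, r) \<in> equivalent \<Longrightarrow> (p, r) \<in> equivalent"
proof -
  assume "(p, q) \<in> equivalent" "(q, r) \<in> equivalent"
  then obtain g g' where g: "p \<in> MC" "g \<in> grp" "q = act g p" "g' \<in> grp" "r = act g' q"
    by (elim equivalentE) blast
  show "(p, r) \<in> equivalent"
    by (rule equivalentI[OF g(1) mult_grp[OF g(4,2)]]) (simp only: g(3,5) act_mult[OF MC_snd[OF g(1)] g(2,4)])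
qed

lemma equivalent_sym: "(p, q) \<in> equivalent \<Longrightarrow> (q, p) \<in> equivalent"
proof -
  assume "(p, q) \<in> equivalent"
  then obtain g where g: "p \<in> MC" "q \<in> MC" "g \<in> grp" "q = act g p" by (elim equivalentE) blast
  show "(q, p) \<in> equivalent"
    by (rule equivalentI[OF g(2) grp_minus[OF g(3)]])
      (simp only: g(4) act_inverse[OF MC_snd[OF g(1)] g(3)])
qed

theorem equiv_equivalent: "equiv MC equivalent"
proof (rule equivI)
  show "equivalent \<subseteq> MC \<times> MC" by (auto elim: equivalentE)
  have "(0, 0) \<in> grp"
    using src.F_0 csubspace_0[OF tgt.csubspace_B] by blast
  moreover have "act (0, 0) p = p" if "p \<in> MC" for p
    using MC_snd[OF that]
    by (cases p) (simp add: act_def src.gauge_0 tgt.bch_simps hom_simps tgt.F_0)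
  ultimately show "refl_on MC equivalent"
    by (intro refl_onI equivalentI) (auto simp del: mem_Sigma_iff)
  show "sym equivalent" by (rule symI) (rule equivalent_sym)
  show "trans equivalent" by (rule transI) (rule equivalent_trans)
qed

end

context filtered_dgla
begin

lemma bch3_approx:
  assumes a: "a \<in> F 0 1" "b \<in> F 0 1" "c \<in> F 0 1" and k: "a \<in> F 0 k \<or> b \<in> F 0 k" "c \<in> F 0 k"
  shows "bch K (bch K a b) c - (a + b + c) \<in> F 0 (Suc k)"
proof -
  have "bch K (bch K a b) c - (bch K a b + c) \<in> F 0 (Suc k)"
    by (rule bch_approx) (use a k bch_F in auto)
  moreover have "bch K a b - (a + b) \<in> F 0 (Suc k)"
    by (rule bch_approx) (use a k in auto)
  ultimately have "(bch K (bch K a b) c - (bch K a b + c)) + (bch K a b - (a + b)) \<in> F 0 (Suc k)"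
    by (rule F_add)
  then show ?thesis by (simp add: algebra_simps)
qed

lemma F_cong: "x - y \<in> F i k \<Longrightarrow> y \<in> F i k \<Longrightarrow> x \<in> F i k"
  using F_add[of "x - y" i k y] by simp

end

text \<open>Used twice: with the maps \<open>f\<close> and \<open>f'\<close> of the theorem, and with a change of coefficients
  \<open>A \<rightarrow> B\<close> in place of \<open>f\<close> and \<open>f'\<close>.\<close>

locale hom_square =
  chi: filtered_dgla_hom KL FL N KM FM \<chi> + eta: filtered_dgla_hom KH FH N KI FI \<eta>
  + f: filtered_dgla_hom KL FL N KH FH f + f': filtered_dgla_hom KM FM N KI FI f'
  for KL :: "'l::complex_vector dgla_data" and FL and N and KM :: "'m::complex_vector dgla_data" and FM
    and \<chi> and KH :: "'h::complex_vector dgla_data" and FH and KI :: "'i::complex_vector dgla_data" and FI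
    and \<eta> f f' +
  assumes square: "\<eta> (f x) = f' (\<chi> x)"
begin

abbreviation \<Phi> where "\<Phi> \<equiv> map_prod f f'"

lemma map_MC: "p \<in> chi.MC \<Longrightarrow> \<Phi> p \<in> eta.MC"
proof -
  assume "p \<in> chi.MC"
  then obtain x a where p: "p = (x, a)" "x \<in> FL 1 1" "a \<in> FM 0 1" "chi.src.curv x = 0" "gauge KM a (\<chi> x) = 0"
    by (auto simp: chi.MC_def)
  have "gauge KI (f' a) (\<eta> (f x)) = 0"
    using f'.hom_gauge[OF p(3), of "\<chi> x"] p(5) by (simp add: square f'.hom_simps)
  then show ?thesis
    using p f.hom_curv[of x] by (simp add: eta.MC_def f.hom_F f'.hom_F f.hom_simps)
qed

lemma map_grp: "g \<in> chi.grp \<Longrightarrow> \<Phi> g \<in> eta.grp"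
  using f'.hom_B by (auto simp: f.hom_F)

lemma map_act:
  assumes "g \<in> chi.grp" "snd p \<in> FM 0 1"
  shows "\<Phi> (chi.act g p) = eta.act (\<Phi> g) (\<Phi> p)"
proof -
  obtain x a where p: "p = (x, a)" "a \<in> FM 0 1" using assms(2) by (cases p) auto
  obtain l c where g: "g = (l, c)" "l \<in> FL 0 1" "c \<in> FM 0 1" using assms(1) chi.tgt.B_F by auto
  show ?thesis
    by (simp add: p(1) g(1) chi.act_def eta.act_def f.hom_gauge f'.hom_bch chi.tgt.bch_F chi.tgt.F_minus
        chi.hom_F p(2) g(2,3) f'.hom_simps square)
qed

lemma map_equivalent: "(p, q) \<in> chi.equivalent \<Longrightarrow> (\<Phi> p, \<Phi> q) \<in> eta.equivalent"
proof -
  assume "(p, q) \<in> chi.equivalent"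
  then obtain g where g: "p \<in> chi.MC" "g \<in> chi.grp" "q = chi.act g p" by (elim chi.equivalentE) blast
  show ?thesis
    by (rule eta.equivalentI[OF map_MC[OF g(1)] map_grp[OF g(2)]])
      (simp only: g(3) map_act[OF g(2) chi.MC_snd[OF g(1)]])
qed

end

text \<open>The first axiom says that the mapping cone of \<open>C\<^sub>\<chi> \<rightarrow> C\<^sub>\<eta>\<close> is acyclic on graded pieces: the
  four conditions state that \<open>(o1, o2, r1, r2)\<close> is a cocycle of this cone modulo \<open>F _ (Suc k)\<close>, and the conclusion
  that it is a boundary modulo \<open>F _ (Suc k)\<close>. The second axiom says that a boundary of
  filtration degree \<open>k\<close> bounds an element of filtration degree \<open>k\<close>; it is needed because
  a gauge transformation \<open>e\<^bsup>dm\<^esup>\<close> is small when \<open>dm\<close> is, and \<open>m\<close> need not be.\<close>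

locale filtered_square = hom_square +
  assumes acyclic: "\<lbrakk> o1 \<in> FL i k; o2 \<in> FM (i - 1) k; r1 \<in> FH (i - 1) k; r2 \<in> FI (i - 2) k;
      dif KL o1 \<in> FL (i + 1) (Suc k); \<chi> o1 - dif KM o2 \<in> FM i (Suc k);
      f o1 + dif KH r1 \<in> FH i (Suc k); f' o2 + (\<eta> r1 - dif KI r2) \<in> FI (i - 1) (Suc k) \<rbrakk>
      \<Longrightarrow> \<exists>c1 \<in> FL (i - 1) k. \<exists>c2 \<in> FM (i - 2) k. \<exists>e1 \<in> FH (i - 2) k. \<exists>e2 \<in> FI (i - 3) k.
        o1 + dif KL c1 \<in> FL i (Suc k) \<and> o2 + (\<chi> c1 - dif KM c2) \<in> FM (i - 1) (Suc k)
        \<and> r1 - f c1 - dif KH e1 \<in> FH (i - 1) (Suc k)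
        \<and> r2 - f' c2 - (\<eta> e1 - dif KI e2) \<in> FI (i - 2) (Suc k)"
    and strict_boundaries: "c \<in> dif KI ` FI (-1) 1 \<Longrightarrow> c \<in> FI 0 k \<Longrightarrow> c \<in> dif KI ` FI (-1) k"
begin

text \<open>For a pair \<open>(y, b)\<close>, the stabilizer element \<open>l = du + [y, u]\<close> of \<open>y\<close> moves \<open>e\<^sup>b\<close> to
  \<open>e\<^sup>b e\<^bsup>-\<eta>(l)\<^esup>\<close>. As \<open>e\<^sup>b * \<eta>(y) = 0\<close>, \<open>Ad b\<close> turns the differential twisted by \<open>\<eta>(y)\<close> into \<open>d\<close>; so
  \<open>e\<^sup>b e\<^bsup>\<eta>(l)\<^esup> e\<^sup>-\<^sup>b\<close> is \<open>e\<^bsup>dv\<^esup>\<close> with \<open>v = Ad b (\<eta>(u))\<close>, and the factor \<open>e\<^bsup>dv\<^esup>\<close> on the left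
  compensates. To leading order, \<open>l\<close> is \<open>du\<close> and \<open>v\<close> is \<open>\<eta>(u)\<close>.\<close>

lemma inner_stabilizer:
  assumes p: "(y, b) \<in> eta.MC" and u: "u \<in> FH (-1) k" and k: "1 \<le> k"
  obtains l v where "l \<in> FH 0 1" "v \<in> FI (-1) k" "eta.act (l, dif KI v) (y, b) = (y, b)"
    "l - dif KH u \<in> FH 0 (Suc k)" "v - \<eta> u \<in> FI (-1) (Suc k)"
proof -
  let ?l = "dif KH u + brk KH y u" and ?v = "eta.tgt.Ad b (\<eta> u)"
  have y: "y \<in> FH 1 1" "eta.src.curv y = 0" and b: "b \<in> FI 0 1" "gauge KI b (\<eta> y) = 0"
    using p by (auto simp: eta.MC_def)
  have u1: "u \<in> FH (-1) 1" using eta.src.F_antimono[OF k u] .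
  note l = eta.src.inner_stabilizer[OF y u1]
  have hl: "\<eta> ?l \<in> FI 0 1" by (rule eta.hom_F[OF l(1)])
  have v: "?v \<in> FI (-1) k" by (rule eta.tgt.Ad_F[OF b(1) eta.hom_F[OF u]])
  have v1: "dif KI ?v \<in> FI 0 1" using eta.tgt.dif_F[OF eta.tgt.F_antimono[OF k v]] by simp
  have "dif KI ?v = eta.tgt.Ad b (\<eta> ?l)"
    using eta.tgt.twisted_dif_Ad[OF b(1) eta.tgt.F_to_0[OF eta.hom_F[OF y(1)]], of "\<eta> u"]
    by (simp add: b(2) eta.tgt.br_simps eta.hom_simps eta.hom_brk eta.hom_dif)
  then have "dif KI ?v = bch KI (bch KI b (\<eta> ?l)) (- b)"
    using eta.tgt.bch_conjugate[OF b(1) hl] by (simp only:)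
  then have "bch KI (dif KI ?v) b = bch KI b (\<eta> ?l)"
    using eta.tgt.bch_cancel(2)[OF b(1) eta.tgt.bch_F[OF b(1) hl]] by (simp only:)
  then have "bch KI (bch KI (dif KI ?v) b) (- \<eta> ?l) = b"
    using eta.tgt.bch_cancel(1)[OF hl b(1)] by (simp only:)
  then have act: "eta.act (?l, dif KI ?v) (y, b) = (y, b)"
    by (simp add: eta.act_def l(2) del: eta.hom_simps)
  have lu: "?l - dif KH u \<in> FH 0 (Suc k)" using eta.src.brk_F1'[OF y(1) u] by simp
  show thesis
    by (rule that[OF l(1) v act lu eta.tgt.Ad_approx[OF b(1) eta.hom_F[OF u]]])
qed

text \<open>With \<open>g = (e\<^sup>l, e\<^bsup>dm\<^esup>)\<close>, the cochain \<open>(q - p, l, m)\<close> is a cocycle of the cone modulo degree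
  \<open>k + 1\<close>. It is bounded by some \<open>(s\<^sub>1, s\<^sub>2, u, n)\<close>. Acting with \<open>(e\<^bsup>s\<^sub>1\<^esup>, e\<^bsup>ds\<^sub>2\<^esup>)\<close> on \<open>p\<close> gives a
  \<open>p'\<close> that is closer to \<open>q\<close>. The new \<open>g'\<close> is \<open>g h\<^sup>-\<^sup>1 \<Phi>(e\<^bsup>s\<^sub>1\<^esup>, e\<^bsup>ds\<^sub>2\<^esup>)\<^sup>-\<^sup>1\<close>, where \<open>h\<close> is the
  stabilizer of \<open>\<Phi> p\<close> attached to \<open>u\<close>. Its leading terms are \<open>l - du - f(s\<^sub>1)\<close> and
  \<open>d(m - \<eta>(u) - f'(s\<^sub>2))\<close>; the bounding relation puts both in degree \<open>k + 1\<close>, the second because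
  \<open>d\<close> kills \<open>dn\<close>.\<close>

lemma injective_step:
  assumes p: "p \<in> chi.MC" and q: "q \<in> chi.MC" and g: "g \<in> eta.grp" and act: "\<Phi> q = eta.act g (\<Phi> p)"
    and k: "1 \<le> k" and pq: "fst q - fst p \<in> FL 1 k" "snd q - snd p \<in> FM 0 k"
    and gk: "fst g \<in> FH 0 k" "snd g \<in> FI 0 k"
  obtains p' g' where "(p, p') \<in> chi.equivalent" "g' \<in> eta.grp" "\<Phi> q = eta.act g' (\<Phi> p')"
    "fst q - fst p' \<in> FL 1 (Suc k)" "snd q - snd p' \<in> FM 0 (Suc k)"
    "fst g' \<in> FH 0 (Suc k)" "snd g' \<in> FI 0 (Suc k)"
proof -
  obtain x a where pe: "p = (x, a)" and x: "x \<in> FL 1 1" "chi.src.curv x = 0" and a: "a \<in> FM 0 1" "gauge KM a (\<chi> x) = 0"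
    using p by (auto simp: chi.MC_def)
  obtain y b where qe: "q = (y, b)" and y: "y \<in> FL 1 1" "chi.src.curv y = 0" and b: "b \<in> FM 0 1" "gauge KM b (\<chi> y) = 0"
    using q by (auto simp: chi.MC_def)
  obtain l c where ge: "g = (l, c)" and l: "l \<in> FH 0 k" and c: "c \<in> dif KI ` FI (-1) 1" "c \<in> FI 0 k"
    using g gk by auto
  obtain m where m: "m \<in> FI (-1) k" "c = dif KI m" using strict_boundaries[OF c] by blast
  have l1: "l \<in> FH 0 1" and c1: "c \<in> FI 0 1"
    using eta.src.F_antimono[OF k l] eta.tgt.F_antimono[OF k c(2)] by simp_all
  let ?o1 = "y - x" and ?o2 = "b - a"
  have o: "?o1 \<in> FL 1 k" "?o2 \<in> FM 0 k" using pq by (simp_all add: pe qe)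
  have fact: "f y = gauge KH l (f x)" "f' b = bch KI (bch KI c (f' a)) (- \<eta> l)"
    using act by (simp_all add: pe qe ge eta.act_def)
  \<comment> \<open>\<open>z1\<close> and \<open>z2\<close> compare the two Maurer--Cartan pairs, \<open>z3\<close> and \<open>z4\<close> linearize
    the action of \<open>g\<close>\<close>
  have z1: "dif KL ?o1 \<in> FL 2 (Suc k)"
    using chi.src.F_minus[OF chi.src.curv_approx[OF k x(1) o(1)]] x(2) y(2) by simp
  have z2: "\<chi> ?o1 - dif KM ?o2 \<in> FM 1 (Suc k)"
    using chi.tgt.F_minus[OF chi.tgt.gauge_approx[OF k a(1) b(1) o(2) chi.hom_F[OF x(1)] chi.hom_F[OF y(1)]]]
      chi.hom_F[OF o(1)] a(2) b(2) by (simp add: chi.hom_simps)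
  have z3: "f ?o1 + dif KH l \<in> FH 1 (Suc k)"
    using eta.src.gauge_approx[OF k eta.src.F_0 l1 _ f.hom_F[OF x(1)] f.hom_F[OF x(1)]] l
    by (simp add: eta.src.gauge_0 eta.src.F_0 f.hom_simps fact(1) algebra_simps)
  have z4: "f' ?o2 + (\<eta> l - dif KI m) \<in> FI 0 (Suc k)"
    using eta.tgt.bch3_approx[OF c1 f'.hom_F[OF a(1)] eta.tgt.F_minus[OF eta.hom_F[OF l1]] disjI1[OF c(2)]
        eta.tgt.F_minus[OF eta.hom_F[OF l]]]
    by (simp add: f'.hom_simps fact(2) m(2) algebra_simps)
  obtain s1 s2 u n where s: "s1 \<in> FL 0 k" "s2 \<in> FM (-1) k" "u \<in> FH (-1) k" "n \<in> FI (-2) k"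
    and b1: "?o1 + dif KL s1 \<in> FL 1 (Suc k)" and b2: "?o2 + (\<chi> s1 - dif KM s2) \<in> FM 0 (Suc k)"
    and b3: "l - f s1 - dif KH u \<in> FH 0 (Suc k)" and b4: "m - f' s2 - (\<eta> u - dif KI n) \<in> FI (-1) (Suc k)"
    using acyclic[of ?o1 1 k ?o2 l m] o l m z1 z2 z3 z4 by auto
  let ?g0 = "(s1, dif KM s2)"
  have s11: "s1 \<in> FL 0 1" "s2 \<in> FM (-1) 1"
    using chi.src.F_antimono[OF k s(1)] chi.tgt.F_antimono[OF k s(2)] .
  have g0: "?g0 \<in> chi.grp" using s11 by simp
  have ds2: "dif KM s2 \<in> FM 0 k" "dif KM s2 \<in> FM 0 1"
    using chi.tgt.dif_F[OF s(2)] chi.tgt.dif_F[OF s11(2)] by simp_all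
  let ?p' = "chi.act ?g0 p"
  have pp': "(p, ?p') \<in> chi.equivalent" by (rule chi.equivalentI[OF p g0 refl])
  have p'1: "fst q - fst ?p' \<in> FL 1 (Suc k)"
  proof -
    have "gauge KL s1 x - (x - dif KL s1) \<in> FL 1 (Suc k)"
      using chi.src.gauge_approx[OF k chi.src.F_0 s11(1) _ x(1) x(1)] s(1)
      by (simp add: chi.src.gauge_0 chi.src.F_0)
    from chi.src.F_diff[OF b1 this] show ?thesis
      by (simp add: pe qe chi.act_def algebra_simps)
  qed
  have p'2: "snd q - snd ?p' \<in> FM 0 (Suc k)"
  proof -
    have "bch KM (bch KM (dif KM s2) a) (- \<chi> s1) - (dif KM s2 + a + - \<chi> s1) \<in> FM 0 (Suc k)"
      by (intro chi.tgt.bch3_approx disjI1 chi.tgt.F_minus chi.hom_F ds2 a(1) s(1) s11(1))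
    from chi.tgt.F_diff[OF b2 this] show ?thesis
      by (simp add: pe qe chi.act_def algebra_simps)
  qed
  have Pp: "\<Phi> p \<in> eta.MC" by (rule map_MC[OF p])
  obtain lu v where lv: "lu \<in> FH 0 1" "v \<in> FI (-1) k" "eta.act (lu, dif KI v) (\<Phi> p) = \<Phi> p"
    "lu - dif KH u \<in> FH 0 (Suc k)" "v - \<eta> u \<in> FI (-1) (Suc k)"
    using inner_stabilizer[of "f x" "f' a" u k] Pp s(3) k by (auto simp: pe)
  have v1: "v \<in> FI (-1) 1" using eta.tgt.F_antimono[OF k lv(2)] .
  let ?gu = "(lu, dif KI v)"
  have gu: "?gu \<in> eta.grp" using lv(1) v1 by simp
  let ?g' = "eta.mult (eta.mult g (- ?gu)) (- \<Phi> ?g0)"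
  have mem: "- ?gu \<in> eta.grp" "\<Phi> ?g0 \<in> eta.grp" "- \<Phi> ?g0 \<in> eta.grp" "eta.mult g (- ?gu) \<in> eta.grp" "?g' \<in> eta.grp"
    using gu g map_grp[OF g0] by (simp_all only: eta.grp_minus eta.mult_grp)
  have Pp': "\<Phi> ?p' = eta.act (\<Phi> ?g0) (\<Phi> p)" by (rule map_act[OF g0 chi.MC_snd[OF p]])
  have sp: "snd (\<Phi> p) \<in> FI 0 1" "snd (\<Phi> ?p') \<in> FI 0 1"
    using eta.MC_snd[OF Pp] eta.MC_snd[OF map_MC[OF chi.act_MC[OF p g0]]] .
  have "eta.act ?g' (\<Phi> ?p') = eta.act (eta.mult g (- ?gu)) (eta.act (- \<Phi> ?g0) (\<Phi> ?p'))"
    by (rule eta.act_mult[OF sp(2) mem(3,4), symmetric])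
  also have "eta.act (- \<Phi> ?g0) (\<Phi> ?p') = \<Phi> p"
    unfolding Pp' by (rule eta.act_inverse(1)[OF sp(1) mem(2)])
  also have "eta.act (eta.mult g (- ?gu)) (\<Phi> p) = eta.act g (eta.act (- ?gu) (\<Phi> p))"
    by (rule eta.act_mult[OF sp(1) mem(1) g, symmetric])
  also have "eta.act (- ?gu) (\<Phi> p) = \<Phi> p"
    using eta.act_inverse(1)[OF sp(1) gu] by (simp only: lv(3))
  finally have act': "\<Phi> q = eta.act ?g' (\<Phi> ?p')" by (simp only: act)
  have "lu \<in> FH 0 k"
    by (rule eta.src.F_cong[OF eta.src.F_antimono[OF _ lv(4)]])
      (use eta.src.dif_F[OF s(3)] in simp_all)
  then have "bch KH (bch KH l (- lu)) (- f s1) - (l + - lu + - f s1) \<in> FH 0 (Suc k)"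
    by (intro eta.src.bch3_approx disjI1 eta.src.F_minus f.hom_F lv(1) s(1) s11(1) l l1)
  moreover have "l + - lu + - f s1 \<in> FH 0 (Suc k)"
    using eta.src.F_diff[OF b3 lv(4)] by (simp add: algebra_simps)
  ultimately have g'1: "fst ?g' \<in> FH 0 (Suc k)"
    using eta.src.F_cong by (simp add: ge eta.mult_def uminus_prod_def)
  have dv: "dif KI v \<in> FI 0 k" "dif KI v \<in> FI 0 1"
    using eta.tgt.dif_F[OF lv(2)] eta.tgt.dif_F[OF v1] by simp_all
  then have "bch KI (bch KI c (- dif KI v)) (- f' (dif KM s2)) - (c + - dif KI v + - f' (dif KM s2)) \<in> FI 0 (Suc k)"
    by (intro eta.tgt.bch3_approx disjI1 eta.tgt.F_minus f'.hom_F ds2 c c1)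
  moreover have "c + - dif KI v + - f' (dif KM s2) \<in> FI 0 (Suc k)"
    using eta.tgt.dif_F[OF eta.tgt.F_diff[OF b4 lv(5)]]
    by (simp add: eta.tgt.d_simps eta.tgt.dif_dif m(2) f'.hom_dif algebra_simps)
  ultimately have g'2: "snd ?g' \<in> FI 0 (Suc k)"
    using eta.tgt.F_cong by (simp add: ge eta.mult_def uminus_prod_def)
  show thesis by (rule that[OF pp' mem(5) act' p'1 p'2 g'1 g'2])
qed

theorem injective:
  assumes p: "p \<in> chi.MC" and q: "q \<in> chi.MC" and eq: "(\<Phi> p, \<Phi> q) \<in> eta.equivalent"
  shows "(p, q) \<in> chi.equivalent"
proof -
  have main: "(p, q) \<in> chi.equivalent"
    if "p \<in> chi.MC" "g \<in> eta.grp" "\<Phi> q = eta.act g (\<Phi> p)" "1 \<le> k"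
      "fst q - fst p \<in> FL 1 k" "snd q - snd p \<in> FM 0 k" "fst g \<in> FH 0 k" "snd g \<in> FI 0 k"
    for p g k
    using that
  proof (induction "N - k" arbitrary: k p g rule: less_induct)
    case less
    show ?case
    proof (cases "N \<le> k")
      case True
      then have "fst q - fst p = 0" "snd q - snd p = 0"
        using chi.src.F_zero[OF less.prems(5)] chi.tgt.F_zero[OF less.prems(6)] by simp_all
      then have "q = p" by (simp add: prod_eq_iff)
      then show ?thesis using equivE[OF chi.equiv_equivalent] less.prems(1) by (metis refl_onD)
    next
      case False
      from injective_step[OF less.prems(1) q less.prems(2-8)]
      obtain p' g' where p': "(p, p') \<in> chi.equivalent" and g': "g' \<in> eta.grp" "\<Phi> q = eta.act g' (\<Phi> p')"
        "fst q - fst p' \<in> FL 1 (Suc k)" "snd q - snd p' \<in> FM 0 (Suc k)"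
        "fst g' \<in> FH 0 (Suc k)" "snd g' \<in> FI 0 (Suc k)" by blast
      have "p' \<in> chi.MC" using p' by (elim chi.equivalentE) simp
      then have "(p', q) \<in> chi.equivalent"
        using less.hyps[of "Suc k" p' g'] g' False by simp
      then show ?thesis using p' chi.equivalent_trans by blast
    qed
  qed
  from eq obtain g where g: "g \<in> eta.grp" "\<Phi> q = eta.act g (\<Phi> p)" by (elim eta.equivalentE) blast
  show ?thesis
  proof (rule main[OF p g, of 1])
    show "fst q - fst p \<in> FL 1 1" "snd q - snd p \<in> FM 0 1"
      using p q by (auto simp: chi.MC_def intro: chi.src.F_diff chi.tgt.F_diff)
    show "fst g \<in> FH 0 1" "snd g \<in> FI 0 1" using g(1) eta.tgt.B_F by auto
  qed simp
qed

text \<open>The defects of \<open>(x, a)\<close> and the difference from \<open>q\<close> form a cocycle of the cone modulo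
  degree \<open>k + 1\<close>. A bounding cochain \<open>(s\<^sub>1, s\<^sub>2, u, n)\<close> changes \<open>(x, a)\<close> by \<open>(s\<^sub>1, s\<^sub>2)\<close> and \<open>q\<close> by
  the gauge transformation \<open>(e\<^sup>u, e\<^bsup>dn\<^esup>)\<close>.\<close>

lemma surjective_step:
  assumes q: "q \<in> eta.MC" and x: "x \<in> FL 1 1" and a: "a \<in> FM 0 1" and k: "1 \<le> k"
    and o: "chi.src.curv x \<in> FL 2 k" "gauge KM a (\<chi> x) \<in> FM 1 k"
    and r: "fst q - f x \<in> FH 1 k" "snd q - f' a \<in> FI 0 k"
  obtains q' x' a' where "(q, q') \<in> eta.equivalent" "x' \<in> FL 1 1" "a' \<in> FM 0 1"
    "chi.src.curv x' \<in> FL 2 (Suc k)" "gauge KM a' (\<chi> x') \<in> FM 1 (Suc k)"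
    "fst q' - f x' \<in> FH 1 (Suc k)" "snd q' - f' a' \<in> FI 0 (Suc k)"
proof -
  obtain y b where qe: "q = (y, b)" and y: "y \<in> FH 1 1" "eta.src.curv y = 0" and b: "b \<in> FI 0 1" "gauge KI b (\<eta> y) = 0"
    using q by (auto simp: eta.MC_def)
  let ?o1 = "chi.src.curv x" and ?o2 = "gauge KM a (\<chi> x)" and ?r1 = "y - f x" and ?r2 = "b - f' a"
  have r': "?r1 \<in> FH 1 k" "?r2 \<in> FI 0 k" using r by (simp_all add: qe)
  \<comment> \<open>\<open>z1\<close> is the Bianchi identity, \<open>z2\<close> the invariance of curvature under gauge
    transformations; \<open>z3\<close> and \<open>z4\<close> hold because \<open>q\<close> has no defects\<close>
  have z1: "dif KL ?o1 \<in> FL 3 (Suc k)"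
    using chi.src.brk_F1[OF o(1) x] by (simp add: chi.src.bianchi[OF chi.src.F_to_0[OF x]])
  have z2: "\<chi> ?o1 - dif KM ?o2 \<in> FM 2 (Suc k)"
  proof -
    have "chi.tgt.curv ?o2 = chi.tgt.Ad a (\<chi> ?o1)"
      using chi.tgt.curv_gauge[OF a chi.tgt.F_to_0[OF chi.hom_F[OF x]]] by (simp add: chi.hom_curv)
    then have dw: "dif KM ?o2 = chi.tgt.Ad a (\<chi> ?o1) - (1/2) *\<^sub>C brk KM ?o2 ?o2"
      by (simp add: chi.tgt.curv_def eq_diff_eq)
    have "chi.tgt.Ad a (\<chi> ?o1) - \<chi> ?o1 \<in> FM 2 (Suc k)"
      by (rule chi.tgt.Ad_approx[OF a chi.hom_F[OF o(1)]])
    moreover have "(1/2) *\<^sub>C brk KM ?o2 ?o2 \<in> FM 2 (Suc k)"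
      using chi.tgt.brk_F1[OF o(2) chi.tgt.F_antimono[OF k o(2)]] by (intro chi.tgt.F_scale) simp
    ultimately show ?thesis
      unfolding dw
      using chi.tgt.F_diff[of "(1/2) *\<^sub>C brk KM ?o2 ?o2" 2 "Suc k" "chi.tgt.Ad a (\<chi> ?o1) - \<chi> ?o1"]
      by (simp add: algebra_simps)
  qed
  have z3: "f ?o1 + dif KH ?r1 \<in> FH 2 (Suc k)"
    using eta.src.F_minus[OF eta.src.curv_approx[OF k f.hom_F[OF x] r'(1)]] y(2)
    by (simp add: f.hom_curv add.commute)
  have z4: "f' ?o2 + (\<eta> ?r1 - dif KI ?r2) \<in> FI 1 (Suc k)"
  proof -
    have "\<eta> y - \<eta> (f x) \<in> FI 1 k" using eta.hom_F[OF r'(1)] by (simp add: eta.hom_simps)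
    from eta.tgt.F_minus[OF eta.tgt.gauge_approx[OF k f'.hom_F[OF a] b(1) r'(2)
          eta.hom_F[OF f.hom_F[OF x]] eta.hom_F[OF y(1)] this]]
    show ?thesis by (simp add: b(2) f'.hom_gauge[OF a] square eta.hom_simps add_diff_eq)
  qed
  obtain s1 s2 u n where s: "s1 \<in> FL 1 k" "s2 \<in> FM 0 k" "u \<in> FH 0 k" "n \<in> FI (-1) k"
    and b1: "?o1 + dif KL s1 \<in> FL 2 (Suc k)" and b2: "?o2 + (\<chi> s1 - dif KM s2) \<in> FM 1 (Suc k)"
    and b3: "?r1 - f s1 - dif KH u \<in> FH 1 (Suc k)" and b4: "?r2 - f' s2 - (\<eta> u - dif KI n) \<in> FI 0 (Suc k)"
    using acyclic[of ?o1 2 k ?o2 ?r1 ?r2] o r' z1 z2 z3 z4 by auto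
  have s11: "s1 \<in> FL 1 1" "s2 \<in> FM 0 1" "u \<in> FH 0 1" "n \<in> FI (-1) 1"
    using chi.src.F_antimono[OF k s(1)] chi.tgt.F_antimono[OF k s(2)] eta.src.F_antimono[OF k s(3)]
      eta.tgt.F_antimono[OF k s(4)] .
  have dn: "dif KI n \<in> FI 0 k" "dif KI n \<in> FI 0 1"
    using eta.tgt.dif_F[OF s(4)] eta.tgt.dif_F[OF s11(4)] by simp_all
  let ?x' = "x + s1" and ?a' = "a + s2" and ?g = "(u, dif KI n)"
  have g: "?g \<in> eta.grp" using s11 by simp
  have x': "?x' \<in> FL 1 1" and a': "?a' \<in> FM 0 1"
    using x a s11 by (simp_all add: chi.src.F_add chi.tgt.F_add)
  have o1': "chi.src.curv ?x' \<in> FL 2 (Suc k)"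
    by (rule chi.src.F_cong[OF chi.src.curv_approx[OF k x s(1)] b1])
  have o2': "gauge KM ?a' (\<chi> ?x') \<in> FM 1 (Suc k)"
  proof (rule chi.tgt.F_cong)
    show "gauge KM ?a' (\<chi> ?x') - (?o2 + (\<chi> ?x' - \<chi> x) - dif KM (?a' - a)) \<in> FM 1 (Suc k)"
      by (rule chi.tgt.gauge_approx[OF k a a' _ chi.hom_F[OF x] chi.hom_F[OF x']])
        (simp_all add: s chi.hom_simps chi.hom_F)
    show "?o2 + (\<chi> ?x' - \<chi> x) - dif KM (?a' - a) \<in> FM 1 (Suc k)"
      using b2 by (simp add: chi.hom_simps add_diff_eq)
  qed
  have r1': "gauge KH u y - f ?x' \<in> FH 1 (Suc k)"
  proof -
    have "gauge KH u y - (y - dif KH u) \<in> FH 1 (Suc k)"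
      using eta.src.gauge_approx[OF k eta.src.F_0 s11(3) _ y(1) y(1)] s(3)
      by (simp add: eta.src.gauge_0 eta.src.F_0)
    from eta.src.F_add[OF b3 this] show ?thesis by (simp add: f.hom_simps algebra_simps)
  qed
  have r2': "bch KI (bch KI (dif KI n) b) (- \<eta> u) - f' ?a' \<in> FI 0 (Suc k)"
  proof -
    have "bch KI (bch KI (dif KI n) b) (- \<eta> u) - (dif KI n + b + - \<eta> u) \<in> FI 0 (Suc k)"
      by (intro eta.tgt.bch3_approx disjI1 eta.tgt.F_minus eta.hom_F dn b(1) s(3) s11(3))
    from eta.tgt.F_add[OF b4 this] show ?thesis by (simp add: f'.hom_simps algebra_simps)
  qed
  show thesis
    by (rule that[OF eta.equivalentI[OF q g refl] x' a' o1' o2'])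
      (use r1' r2' in \<open>simp_all add: qe eta.act_def\<close>)
qed

text \<open>The approximation starts at \<open>(0, 0)\<close>, which has no defects and agrees with \<open>q\<close> modulo
  degree 1. The pair \<open>q\<close> changes in each step, but only within its gauge orbit.\<close>

theorem surjective:
  assumes q: "q \<in> eta.MC"
  shows "\<exists>p \<in> chi.MC. (\<Phi> p, q) \<in> eta.equivalent"
proof -
  have main: "\<exists>p \<in> chi.MC. (\<Phi> p, q) \<in> eta.equivalent"
    if "q \<in> eta.MC" "x \<in> FL 1 1" "a \<in> FM 0 1" "1 \<le> k"
      "chi.src.curv x \<in> FL 2 k" "gauge KM a (\<chi> x) \<in> FM 1 k"
      "fst q - f x \<in> FH 1 k" "snd q - f' a \<in> FI 0 k" for q x a k
    using that
  proof (induction "N - k" arbitrary: k q x a rule: less_induct)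
    case less
    show ?case
    proof (cases "N \<le> k")
      case True
      then have "chi.src.curv x = 0" "gauge KM a (\<chi> x) = 0" "fst q - f x = 0" "snd q - f' a = 0"
        using chi.src.F_zero[OF less.prems(5)] chi.tgt.F_zero[OF less.prems(6)]
          eta.src.F_zero[OF less.prems(7)] eta.tgt.F_zero[OF less.prems(8)] by simp_all
      then have "(x, a) \<in> chi.MC" "\<Phi> (x, a) = q"
        using less.prems(2,3) by (simp_all add: chi.MC_def prod_eq_iff)
      then show ?thesis using equivE[OF eta.equiv_equivalent] less.prems(1) by (metis refl_onD)
    next
      case False
      from surjective_step[OF less.prems]
      obtain q' x' a' where q': "(q, q') \<in> eta.equivalent" and x': "x' \<in> FL 1 1" "a' \<in> FM 0 1"
        "chi.src.curv x' \<in> FL 2 (Suc k)" "gauge KM a' (\<chi> x') \<in> FM 1 (Suc k)"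
        "fst q' - f x' \<in> FH 1 (Suc k)" "snd q' - f' a' \<in> FI 0 (Suc k)" by blast
      have "q' \<in> eta.MC" using q' by (elim eta.equivalentE) simp
      then have "\<exists>p \<in> chi.MC. (\<Phi> p, q') \<in> eta.equivalent"
        using less.hyps[of "Suc k" q' x' a'] x' False by simp
      then show ?thesis using q' eta.equivalent_trans eta.equivalent_sym by blast
    qed
  qed
  show ?thesis
  proof (rule main[OF q, of 0 0 1])
    show "fst q - f 0 \<in> FH 1 1" "snd q - f' 0 \<in> FI 0 1"
      using q by (auto simp: eta.MC_def f.hom_simps f'.hom_simps)
  qed (simp_all add: chi.src.F_0 chi.tgt.F_0 chi.src.curv_def chi.src.d_simps chi.src.br_simps
      chi.hom_simps chi.tgt.gauge_0)
qed

end

section \<open>Powers of the maximal ideal\<close>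

lemma max_ideal: "ring_ideal (max_ideal :: 'a::local_artinian set)" "(max_ideal :: 'a set) \<noteq> UNIV"
  using maximal_ideal_max_ideal unfolding maximal_ideal_def by blast+

lemma
  fixes x y r :: "'a::local_artinian"
  shows max_ideal_mult: "x \<in> max_ideal \<Longrightarrow> r * x \<in> max_ideal"
    and max_ideal_add: "x \<in> max_ideal \<Longrightarrow> y \<in> max_ideal \<Longrightarrow> x + y \<in> max_ideal"
  using max_ideal(1)[where ?'a = 'a] by (auto simp: ring_ideal_def)

lemma ring_ideal_UNIV: "ring_ideal J \<Longrightarrow> 1 \<in> J \<Longrightarrow> J = UNIV"
  unfolding ring_ideal_def by (metis UNIV_eq_I mult.right_neutral)

lemma one_notin_max_ideal: "(1 :: 'a::local_artinian) \<notin> max_ideal"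
  using max_ideal ring_ideal_UNIV by blast

lemma ring_ideal_multiples: "ring_ideal (range (\<lambda>r. r * (u :: 'a::comm_ring_1)))"
  unfolding ring_ideal_def
  by (auto simp: image_iff) (metis mult_zero_left, metis distrib_right, metis mult.assoc)

lemma ring_ideal_csubspace:
  assumes "ring_ideal (J :: 'a::complex_comm_algebra set)"
  shows "csubspace J"
proof (rule csubspaceI)
  show "c *\<^sub>C x \<in> J" if "x \<in> J" for c x
  proof -
    have "(c *\<^sub>C 1) * x \<in> J" using assms that by (simp add: ring_ideal_def)
    then show ?thesis by (simp add: scaleC_mult_left)
  qed
qed (use assms in \<open>auto simp: ring_ideal_def\<close>)

text \<open>A proper ideal that contains \<open>u\<close> lies in a maximal one by Zorn's lemma, and there is only
  one maximal ideal.\<close>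

lemma unit_if_notin_max_ideal:
  fixes u :: "'a::local_artinian"
  assumes "u \<notin> max_ideal"
  shows "\<exists>v. v * u = 1"
proof (rule ccontr)
  assume "\<nexists>v. v * u = 1"
  then have no: "1 \<notin> range (\<lambda>r. r * u)" by (metis imageE)
  let ?A = "{J. ring_ideal J \<and> u \<in> J \<and> 1 \<notin> J}"
  have "range (\<lambda>r. r * u) \<in> ?A"
    using no ring_ideal_multiples[of u] by (auto intro: range_eqI[of _ _ 1])
  then have "?A \<noteq> {}" by blast
  then have "\<exists>M\<in>?A. \<forall>X\<in>?A. M \<subseteq> X \<longrightarrow> X = M"
  proof (rule subset_Zorn_nonempty)
    fix C assume C: "C \<noteq> {}" "subset.chain ?A C"
    have add: "x + y \<in> \<Union>C" if "x \<in> \<Union>C" "y \<in> \<Union>C" for x y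
    proof -
      from that obtain X Y where XY: "X \<in> C" "x \<in> X" "Y \<in> C" "y \<in> Y" by blast
      then have "X \<subseteq> Y \<or> Y \<subseteq> X" using C(2) by (auto simp: subset_chain_def)
      moreover have "ring_ideal X" "ring_ideal Y" using C(2) XY by (auto simp: subset_chain_def)
      ultimately have "x + y \<in> X \<or> x + y \<in> Y"
        using XY(2,4) unfolding ring_ideal_def by blast
      then show ?thesis using XY(1,3) by blast
    qed
    have ideals: "ring_ideal X" if "X \<in> C" for X using C(2) that by (auto simp: subset_chain_def)
    have "ring_ideal (\<Union>C)"
      unfolding ring_ideal_def
    proof (intro conjI ballI allI)
      show "0 \<in> \<Union>C" using C(1) ideals unfolding ring_ideal_def by blast
      fix r x assume "x \<in> \<Union>C"
      then show "r * x \<in> \<Union>C" using ideals unfolding ring_ideal_def by blast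
    qed (rule add)
    moreover have "u \<in> \<Union>C" "1 \<notin> \<Union>C" using C by (auto simp: subset_chain_def)
    ultimately show "\<Union>C \<in> ?A" by blast
  qed
  then obtain M where M: "ring_ideal M" "u \<in> M" "1 \<notin> M" "\<And>X. X \<in> ?A \<Longrightarrow> M \<subseteq> X \<Longrightarrow> X = M" by blast
  have "maximal_ideal M"
    unfolding maximal_ideal_def
  proof (intro conjI allI impI)
    show "M \<noteq> UNIV" using M(3) by blast
    fix J assume J: "ring_ideal J \<and> M \<subseteq> J"
    then show "J = M \<or> J = UNIV"
      using M(2) M(4)[of J] ring_ideal_UNIV[of J] by blast
  qed (rule M(1))
  then have "M = max_ideal" using local maximal_ideal_max_ideal by blast
  then show False using M(2) assms by simp
qed

text \<open>The spans are taken over the complex numbers; the result is an ideal all the same, because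
  \<open>max_ideal\<close> is one.\<close>

primrec max_power :: "nat \<Rightarrow> 'a::local_artinian set" where
  "max_power 0 = UNIV"
| "max_power (Suc k) = cspan {x * y | x y. x \<in> max_ideal \<and> y \<in> max_power k}"

lemma clinear_mult: "clinear (\<lambda>z. (r :: 'a::complex_comm_algebra) * z)" "clinear (\<lambda>z. z * (r :: 'a))"
  by (simp_all add: clinear_iff distrib_left distrib_right scaleC_mult_left)
    (metis mult.commute scaleC_mult_left)

lemma csubspace_max_power: "csubspace (max_power k)"
  by (cases k) (simp_all add: cvec.subspace_UNIV cvec.subspace_span)

lemma max_power_mult: "z \<in> max_power k \<Longrightarrow> r * z \<in> (max_power k :: 'a::local_artinian set)"
proof (cases k)
  case (Suc j)
  assume "z \<in> max_power k"
  then have z: "z \<in> cspan {x * y | x y. x \<in> max_ideal \<and> y \<in> max_power j}" by (simp add: Suc)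
  show ?thesis
    unfolding Suc max_power.simps
  proof (rule clinear_cspan_subset[OF clinear_mult(1) _ cvec.subspace_span z])
    fix x :: 'a assume "x \<in> {x * y | x y. x \<in> max_ideal \<and> y \<in> max_power j}"
    then obtain a b where "x = a * b" "a \<in> max_ideal" "b \<in> max_power j" by blast
    moreover have "r * a \<in> max_ideal" by (rule max_ideal_mult) fact
    ultimately show "r * x \<in> cspan {x * y | x y. x \<in> max_ideal \<and> y \<in> max_power j}"
      by (intro cvec.span_base) (auto simp: mult.assoc[symmetric])
  qed
qed simp

lemma ring_ideal_max_power: "ring_ideal (max_power k)"
  unfolding ring_ideal_def
  using csubspace_0[OF csubspace_max_power] csubspace_add[OF csubspace_max_power] max_power_mult by blast

lemma max_power_Suc_subset: "max_power (Suc k) \<subseteq> max_power k"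
  unfolding max_power.simps
  by (rule cvec.span_minimal[OF _ csubspace_max_power]) (auto intro: max_power_mult)

lemma max_power_antimono: "k \<le> l \<Longrightarrow> max_power l \<subseteq> max_power k"
  by (rule lift_Suc_antimono_le[of max_power]) (rule max_power_Suc_subset)

lemma max_power_1: "max_power 1 = max_ideal"
proof -
  have "max_power 1 \<subseteq> max_ideal"
    unfolding One_nat_def max_power.simps
    by (rule cvec.span_minimal[OF _ ring_ideal_csubspace[OF max_ideal(1)]])
      (auto, metis max_ideal_mult mult.commute)
  moreover have "x \<in> max_power 1" if "x \<in> max_ideal" for x :: 'a
    unfolding One_nat_def max_power.simps
    by (rule cvec.span_base, rule CollectI, rule exI[of _ x], rule exI[of _ 1]) (simp add: that)
  ultimately show ?thesis by blast
qed

lemma max_power_mult_max_power: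
  fixes x y :: "'a::local_artinian"
  shows "x \<in> max_power i \<Longrightarrow> y \<in> max_power j \<Longrightarrow> x * y \<in> max_power (i + j)"
proof (induction i arbitrary: x)
  case 0
  then show ?case by (simp add: max_power_mult)
next
  case (Suc i)
  show ?case
  proof (rule clinear_cspan_subset[where f = "\<lambda>x. x * y", OF clinear_mult(2) _ csubspace_max_power])
    show "x \<in> cspan {x * y | x y. x \<in> max_ideal \<and> y \<in> max_power i}" using Suc.prems by simp
    fix z :: 'a assume "z \<in> {x * y | x y. x \<in> max_ideal \<and> y \<in> max_power i}"
    then obtain a b where z: "z = a * b" "a \<in> max_ideal" "b \<in> max_power i" by blast
    then have "b * y \<in> max_power (i + j)" using Suc by blast
    then have "a * (b * y) \<in> max_power (Suc (i + j))"
      unfolding max_power.simps by (intro cvec.span_base) (use z in blast)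
    then show "z * y \<in> max_power (Suc i + j)" by (simp add: z mult.assoc)
  qed
qed

text \<open>The descending chain condition for sequences of ideals, restated as a minimality principle.\<close>

lemma ideal_minimal:
  fixes S :: "'a::local_artinian set set"
  assumes "I \<in> S" "\<And>I. I \<in> S \<Longrightarrow> ring_ideal I"
  obtains J where "J \<in> S" "\<And>J'. J' \<in> S \<Longrightarrow> J' \<subseteq> J \<Longrightarrow> J' = J"
proof -
  let ?R = "{(J', J :: 'a set). ring_ideal J' \<and> ring_ideal J \<and> J' \<subset> J}"
  have "wf ?R"
    unfolding wf_iff_no_infinite_down_chain
  proof
    assume "\<exists>f. \<forall>i. (f (Suc i), f i) \<in> ?R"
    then obtain f :: "nat \<Rightarrow> 'a set" where f: "\<And>i. (f (Suc i), f i) \<in> ?R" by blast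
    have id: "ring_ideal (f i)" for i using f[of i] by simp
    have less: "f (Suc i) \<subset> f i" for i using f[of i] by simp
    have "\<exists>k. \<forall>n\<ge>k. f n = f k"
      by (rule artinian[of f]) (rule id, rule psubset_imp_subset[OF less])
    then obtain k where k: "\<forall>n\<ge>k. f n = f k" ..
    have "f (Suc k) = f k" using k[rule_format, of "Suc k"] by (simp only: le_SucI order_refl)
    then show False using less[of k] by (simp only: psubset_eq not_True_eq_False simp_thms)
  qed
  then obtain J where "J \<in> S" "\<And>J'. (J', J) \<in> ?R \<Longrightarrow> J' \<notin> S"
    using wfE_min[of ?R I S] assms(1) by blast
  then show thesis using that assms(2) by blast
qed

text \<open>The powers stabilize at some \<open>P\<close> with \<open>P = \<mm>P\<close>. If \<open>P\<close> is not zero, choose an ideal \<open>I\<close> minimal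
  with \<open>I P \<noteq> 0\<close> and \<open>x \<in> I\<close> with \<open>x P \<noteq> 0\<close>. Since \<open>x\<mm>P = x P\<close>, minimality gives
  \<open>I = x\<mm>\<close>. So \<open>x = x z\<close> with \<open>z \<in> \<mm>\<close>, and \<open>1 - z\<close> is a unit; hence \<open>x = 0\<close>. Nakayama's
  lemma does not apply directly, because \<open>P\<close> is not known to be finitely generated.\<close>

theorem max_power_nilpotent: "\<exists>N. max_power N = {0 :: 'a::local_artinian}"
proof -
  obtain k where k: "\<And>n. k \<le> n \<Longrightarrow> max_power n = (max_power k :: 'a set)"
    using artinian[of max_power] ring_ideal_max_power max_power_Suc_subset by blast
  let ?P = "max_power k :: 'a set"
  have P: "?P = cspan {x * y | x y. x \<in> max_ideal \<and> y \<in> ?P}" using k[of "Suc k"] by simp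
  have "?P = {0}"
  proof (rule ccontr)
    assume "?P \<noteq> {0}"
    then obtain y where y: "y \<in> ?P" "y \<noteq> 0" using csubspace_0[OF csubspace_max_power] by blast
    let ?S = "{I. ring_ideal I \<and> (\<exists>x\<in>I. \<exists>y\<in>?P. x * y \<noteq> 0)}"
    have "UNIV \<in> ?S"
      using y by (auto simp: ring_ideal_def intro!: bexI[of _ y] exI[of _ 1])
    then obtain I where I: "I \<in> ?S" "\<And>J. J \<in> ?S \<Longrightarrow> J \<subseteq> I \<Longrightarrow> J = I"
      by (rule ideal_minimal) auto
    then obtain x y where xy: "ring_ideal I" "x \<in> I" "y \<in> ?P" "x * y \<noteq> 0" by blast
    let ?J = "(\<lambda>z. x * z) ` max_ideal"
    have J: "ring_ideal ?J"
      using max_ideal(1)[where ?'a = 'a] unfolding ring_ideal_def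
      by (auto simp: image_iff) (metis mult_zero_right, metis distrib_left, metis mult.left_commute)
    have "\<exists>z\<in>max_ideal. \<exists>b\<in>?P. x * z * b \<noteq> 0"
    proof (rule ccontr)
      assume no: "\<not> ?thesis"
      have "x * y \<in> {0}"
      proof (rule clinear_cspan_subset[OF clinear_mult(1)])
        show "y \<in> cspan {x * y | x y. x \<in> max_ideal \<and> y \<in> ?P}" using xy(3) P by simp
      qed (use no in \<open>auto simp: mult.assoc intro: csubspaceI\<close>)
      then show False using xy(4) by simp
    qed
    then have "?J \<in> ?S" using J by blast
    moreover have "?J \<subseteq> I" using xy(1,2) by (auto simp: ring_ideal_def mult.commute)
    ultimately have "x \<in> ?J" using I(2) xy(2) by blast
    then obtain z where z: "z \<in> max_ideal" "x = x * z" by blast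
    have "1 - z \<notin> max_ideal"
    proof
      assume "1 - z \<in> max_ideal"
      then have "(1 - z) + z \<in> max_ideal" using z(1) by (rule max_ideal_add)
      then show False using one_notin_max_ideal[where ?'a = 'a] by simp
    qed
    then obtain v where "v * (1 - z) = 1" using unit_if_notin_max_ideal by blast
    moreover have "v * (1 - z) * x = v * (x - x * z)" by (simp add: algebra_simps)
    ultimately have "x = v * (x - x * z)" by simp
    also have "x - x * z = 0" using z(2) by simp
    finally have "x = 0" by simp
    then show False using xy(4) by simp
  qed
  then show ?thesis by blast
qed

text \<open>A homomorphism maps \<open>\<mm>\<close> into the maximal ideal, since the elements of \<open>\<mm>\<close> are nilpotent and
  a nilpotent element is not a unit.\<close>

lemma algebra_hom_max_power:
  fixes \<phi> :: "'a::local_artinian \<Rightarrow> 'b::local_artinian"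
  assumes \<phi>: "algebra_hom \<phi>" and "x \<in> max_power k"
  shows "\<phi> x \<in> max_power k"
  using assms(2)
proof (induction k arbitrary: x)
  case (Suc k)
  have lin: "clinear \<phi>" and mult: "\<phi> (x * y) = \<phi> x * \<phi> y" and one: "\<phi> 1 = 1" for x y
    using \<phi> by (auto simp: algebra_hom_def)
  have ideal: "\<phi> x \<in> max_ideal" if "x \<in> max_ideal" for x
  proof (rule ccontr)
    assume "\<phi> x \<notin> max_ideal"
    then obtain v where v: "v * \<phi> x = 1" using unit_if_notin_max_ideal by blast
    obtain N where N: "max_power N = {0 :: 'a}" using max_power_nilpotent by blast
    have "x ^ n \<in> max_power n" for n
      by (induction n) (use that in \<open>auto intro: cvec.span_base\<close>)
    then have "x ^ N = 0" using N by blast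
    moreover have "\<phi> (x ^ n) = \<phi> x ^ n" for n by (induction n) (simp_all add: mult one)
    ultimately have "\<phi> x ^ N = 0" using clinear_zero[OF lin] by metis
    then have "(v * \<phi> x) ^ N = 0" by (simp add: power_mult_distrib)
    then show False by (simp add: v)
  qed
  show ?case
  proof (rule clinear_cspan_subset[OF lin _ csubspace_max_power])
    show "x \<in> cspan {x * y | x y. x \<in> max_ideal \<and> y \<in> max_power k}" using Suc.prems by simp
    fix z :: 'a assume "z \<in> {x * y | x y. x \<in> max_ideal \<and> y \<in> max_power k}"
    then obtain a b where z: "z = a * b" "a \<in> max_ideal" "b \<in> max_power k" by blast
    then show "\<phi> z \<in> max_power (Suc k)"
      unfolding max_power.simps by (intro cvec.span_base) (use ideal Suc.IH in \<open>auto simp: mult\<close>)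
  qed
qed simp

section \<open>Tensor products of subspaces\<close>

lemma csubspace_tensor_subspace: "csubspace (tensor_subspace V W)"
  unfolding tensor_subspace_def by (rule cvec.subspace_span)

lemma pure_in_tensor_subspace: "v \<in> V \<Longrightarrow> w \<in> W \<Longrightarrow> v \<otimes> w \<in> tensor_subspace V W"
  unfolding tensor_subspace_def by (rule cvec.span_base) blast

lemma tensor_subspace_mono: "V \<subseteq> V' \<Longrightarrow> W \<subseteq> W' \<Longrightarrow> tensor_subspace V W \<subseteq> tensor_subspace V' W'"
  unfolding tensor_subspace_def by (rule cvec.span_mono) blast

lemma tensor_subspace_induct:
  assumes "clinear g" "csubspace S" "\<And>v w. v \<in> V \<Longrightarrow> w \<in> W \<Longrightarrow> g (v \<otimes> w) \<in> S"
    and "t \<in> tensor_subspace V W"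
  shows "g t \<in> S"
  using clinear_cspan_subset[OF assms(1) _ assms(2) assms(4)[unfolded tensor_subspace_def]] assms(3) by blast

lemma tensor_subspace_eq:
  assumes "clinear g" "clinear h" "\<And>v w. v \<in> V \<Longrightarrow> w \<in> W \<Longrightarrow> g (v \<otimes> w) = h (v \<otimes> w)"
    and "t \<in> tensor_subspace V W"
  shows "g t = h t"
  using clinear_eq_on_cspan[OF assms(1,2) _ assms(4)[unfolded tensor_subspace_def]] assms(3) by blast

lemma clinear_id: "clinear id" by (simp add: clinear_iff)

text \<open>Linear maps are determined by their values on pure tensors; so a linear projection onto the
  span of the pure tensors is the identity.\<close>

lemma tensor_subspace_UNIV: "tensor_subspace UNIV UNIV = UNIV"
proof -
  let ?S = "tensor_subspace UNIV UNIV :: ('a \<otimes> 'b) set"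
  obtain g :: "'a \<otimes> 'b \<Rightarrow> 'a \<otimes> 'b" where g: "range g \<subseteq> ?S" "clinear g" "\<And>v. v \<in> ?S \<Longrightarrow> g v = v"
    using vector_space_pair.linear_exists_left_inverse_on[OF
        vector_space_pair.intro[OF cvec.vector_space_axioms cvec.vector_space_axioms] clinear_id csubspace_tensor_subspace, of UNIV UNIV]
    by auto
  have "g = id"
    by (rule clinear_eq_on_pure_tensors[OF g(2) clinear_id]) (simp add: g(3) pure_in_tensor_subspace)
  then show ?thesis using g(1) by auto
qed

lemma pure_tensor_zero: "0 \<otimes> w = 0" "v \<otimes> 0 = 0"
  using cbilinear_zero_left[OF cbilinear_pure_tensor] cbilinear_zero_right[OF cbilinear_pure_tensor] .

lemma tensor_map_subspace:
  assumes "clinear f" "clinear g" "f ` V \<subseteq> V'" "g ` W \<subseteq> W'" "t \<in> tensor_subspace V W"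
  shows "tensor_map f g t \<in> tensor_subspace V' W'"
  by (rule tensor_subspace_induct[OF clinear_tensor_map[OF assms(1,2)] csubspace_tensor_subspace _ assms(5)])
    (use assms in \<open>auto simp: tensor_map_pure intro!: pure_in_tensor_subspace\<close>)

lemma clinear_comp: "clinear f \<Longrightarrow> clinear g \<Longrightarrow> clinear (\<lambda>x. f (g x))"
  by (simp add: clinear_iff)

lemma tensor_map_comp:
  assumes "clinear f" "clinear g" "clinear f'" "clinear g'"
  shows "tensor_map f f' (tensor_map g g' t) = tensor_map (\<lambda>x. f (g x)) (\<lambda>x. f' (g' x)) t"
proof -
  have "(\<lambda>t. tensor_map f f' (tensor_map g g' t)) = tensor_map (\<lambda>x. f (g x)) (\<lambda>x. f' (g' x))"
    by (rule clinear_eq_on_pure_tensors)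
      (simp_all add: clinear_comp clinear_tensor_map tensor_map_pure assms)
  then show ?thesis by metis
qed

abbreviation tm :: "('v::complex_vector \<Rightarrow> 'w::complex_vector) \<Rightarrow> 'v \<otimes> 'a::complex_vector \<Rightarrow> 'w \<otimes> 'a"
  where "tm f \<equiv> tensor_map f id"

lemma clinear_tm: "clinear f \<Longrightarrow> clinear (tm f)"
  by (simp add: clinear_tensor_map clinear_id)

lemma tm_pure: "clinear f \<Longrightarrow> tm f (v \<otimes> a) = f v \<otimes> a"
  by (simp add: tensor_map_pure clinear_id)

lemma tm_comp: "clinear f \<Longrightarrow> clinear g \<Longrightarrow> tm f (tm g t) = tm (\<lambda>x. f (g x)) t"
proof -
  show "tm f (tm g t) = tm (\<lambda>x. f (g x)) t" if "clinear f" "clinear g"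
    using tensor_map_comp[OF that clinear_id clinear_id] by (simp only: id_def)
qed

lemma tm_subspace: "clinear f \<Longrightarrow> f ` V \<subseteq> V' \<Longrightarrow> t \<in> tensor_subspace V W \<Longrightarrow> tm f t \<in> tensor_subspace V' W"
  by (rule tensor_map_subspace) (auto simp: clinear_id)

lemma clinear_pointwise:
  "clinear f \<Longrightarrow> clinear g \<Longrightarrow> clinear (\<lambda>x. f x + g x)" "clinear f \<Longrightarrow> clinear g \<Longrightarrow> clinear (\<lambda>x. f x - g x)"
  "clinear f \<Longrightarrow> clinear (\<lambda>x. - f x)" "clinear (\<lambda>x. 0)" "clinear (\<lambda>x. x)"
  by (simp_all add: clinear_iff scaleC_simps)

lemma tm_eqI:
  assumes "clinear f" "clinear g" "\<And>x. x \<in> V \<Longrightarrow> f x = g x" "t \<in> tensor_subspace V W"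
  shows "tm f t = tm g t"
  by (rule tensor_subspace_eq[OF clinear_tm[OF assms(1)] clinear_tm[OF assms(2)] _ assms(4)])
    (simp add: tm_pure assms)

lemma
  assumes f: "clinear f"
  shows tm_add: "clinear g \<Longrightarrow> tm (\<lambda>x. f x + g x) t = tm f t + tm g t"
    and tm_diff: "clinear g \<Longrightarrow> tm (\<lambda>x. f x - g x) t = tm f t - tm g t"
    and tm_minus: "tm (\<lambda>x. - f x) t = - tm f t"
proof -
  note pure = tm_pure clinear_pointwise f pure_tensor_add_left
    cbilinear_diff_left[OF cbilinear_pure_tensor] cbilinear_minus_left[OF cbilinear_pure_tensor]
  show "tm (\<lambda>x. f x + g x) t = tm f t + tm g t" if g: "clinear g"
  proof -
    have "tm (\<lambda>x. f x + g x) = (\<lambda>t. tm f t + tm g t)"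
      by (rule clinear_eq_on_pure_tensors)
        (intro clinear_tm clinear_pointwise f g, intro clinear_tm clinear_pointwise f g, simp only: pure g)
    then show ?thesis by metis
  qed
  show "tm (\<lambda>x. f x - g x) t = tm f t - tm g t" if g: "clinear g"
  proof -
    have "tm (\<lambda>x. f x - g x) = (\<lambda>t. tm f t - tm g t)"
      by (rule clinear_eq_on_pure_tensors)
        (intro clinear_tm clinear_pointwise f g, intro clinear_tm clinear_pointwise f g, simp only: pure g)
    then show ?thesis by metis
  qed
  have "tm (\<lambda>x. - f x) = (\<lambda>t. - tm f t)"
    by (rule clinear_eq_on_pure_tensors)
      (intro clinear_tm clinear_pointwise f, intro clinear_tm clinear_pointwise f, simp only: pure)
  then show "tm (\<lambda>x. - f x) t = - tm f t" by metis
qed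

lemma tm_zero: "tm (\<lambda>x. 0) t = 0" and tm_ident: "tm (\<lambda>x. x) t = t"
proof -
  have "tm (\<lambda>x. 0) = (\<lambda>t. 0)"
    by (rule clinear_eq_on_pure_tensors)
      (intro clinear_tm clinear_pointwise, rule clinear_pointwise, simp only: tm_pure clinear_pointwise pure_tensor_zero)
  then show "tm (\<lambda>x. 0) t = 0" by metis
  have "tm (\<lambda>x. x) = (\<lambda>t. t)"
    by (rule clinear_eq_on_pure_tensors)
      (intro clinear_tm clinear_pointwise, rule clinear_pointwise, simp only: tm_pure clinear_pointwise)
  then show "tm (\<lambda>x. x) t = t" by metis
qed

section \<open>The filtered algebra \<open>K \<otimes> A\<close>\<close>

abbreviation tensor_filtration ::
    "'v::complex_vector dgla_data \<Rightarrow> int \<Rightarrow> nat \<Rightarrow> ('v \<otimes> 'a::local_artinian) set"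
  where "tensor_filtration K i k \<equiv> tensor_subspace (deg K i) (max_power k)"

lemma deg_dgla_tensor: "deg (dgla_tensor K) i = tensor_filtration K i 1"
  by (simp add: dgla_tensor_def max_power_1)

lemma dif_dgla_tensor: "dif (dgla_tensor K) = tm (dif K)"
  by (simp add: dgla_tensor_def)

context dgla
begin

lemmas brk_tensor = brk_tensor_pure[OF brk_bilinear]
lemmas bilinear_tensor = cbilinear_brk_tensor[OF brk_bilinear]

lemma brk_tensor_clinear:
  "clinear (\<lambda>x. brk (dgla_tensor K) (x :: 'v \<otimes> 'a::local_artinian) y)"
  "clinear (\<lambda>y. brk (dgla_tensor K) (x :: 'v \<otimes> 'a) y)"
  using bilinear_tensor unfolding cbilinear_def by blast+

lemma clinear_scaled: "clinear f \<Longrightarrow> clinear (\<lambda>x. c *\<^sub>C f x)"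
  by (simp add: clinear_iff scaleC_simps mult.commute)

lemma homogeneous_span: "cspan (\<Union>i. tensor_filtration K i 0) = (UNIV :: ('v \<otimes> 'a::local_artinian) set)"
proof -
  have "v \<otimes> a \<in> cspan (\<Union>i. tensor_filtration K i 0)" for v and a :: 'a
  proof -
    obtain c :: "int \<Rightarrow> 'v" where c: "\<forall>i. c i \<in> deg K i" "finite {i. c i \<noteq> 0}" "v = Sum_any c"
      using deg_direct_sum[of v] by blast
    have "v \<otimes> a = (\<Sum>i | c i \<noteq> 0. c i \<otimes> a)"
      by (simp add: c(3) Sum_any.expand_set cbilinear_sum_left[OF cbilinear_pure_tensor])
    also have "\<dots> \<in> cspan (\<Union>i. tensor_filtration K i 0)"
      by (rule csubspace_sum[OF cvec.subspace_span], rule cvec.span_base)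
        (use c(1) in \<open>auto intro!: pure_in_tensor_subspace\<close>)
    finally show ?thesis .
  qed
  then have "tensor_subspace UNIV UNIV \<subseteq> cspan (\<Union>i. tensor_filtration K i 0 :: ('v \<otimes> 'a) set)"
    unfolding tensor_subspace_def[of UNIV UNIV] by (intro cvec.span_minimal cvec.subspace_span) auto
  then show ?thesis unfolding tensor_subspace_UNIV by auto
qed

lemma filtered_dgla_tensor:
  assumes N: "0 < N" "max_power N = {0 :: 'a::local_artinian}"
  shows "filtered_dgla (dgla_tensor K) (tensor_filtration K :: int \<Rightarrow> nat \<Rightarrow> ('v \<otimes> 'a) set) N"
proof (rule filtered_dgla.intro)
  let ?F = "tensor_filtration K :: int \<Rightarrow> nat \<Rightarrow> ('v \<otimes> 'a) set"
  let ?b = "brk (dgla_tensor K) :: 'v \<otimes> 'a \<Rightarrow> 'v \<otimes> 'a \<Rightarrow> 'v \<otimes> 'a"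
  note lin = brk_tensor_clinear
  note dlin = clinear_tm[OF dif_linear]
  show "cbilinear ?b" by (rule bilinear_tensor)
  show "0 < N" by (rule N)
  show "?F i (Suc k) \<subseteq> ?F i k" for i k
    by (rule tensor_subspace_mono) (simp_all add: max_power_Suc_subset del: max_power.simps)
  show "?F i N = {0}" for i
  proof -
    have "id t \<in> {0}" if "t \<in> ?F i N" for t
      by (rule tensor_subspace_induct[OF clinear_id _ _ that])
        (auto simp: N pure_tensor_zero intro: csubspaceI)
    then show ?thesis using csubspace_0[OF csubspace_tensor_subspace] by fastforce
  qed
  show "cspan (\<Union>i. ?F i 0) = UNIV" by (rule homogeneous_span)
  show "?b x y \<in> ?F (i + j) (k + l)" if "x \<in> ?F i k" "y \<in> ?F j l" for x y i j k l
  proof (rule tensor_subspace_induct[OF lin(1) csubspace_tensor_subspace _ that(1)])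
    fix v a assume va: "v \<in> deg K i" "a \<in> (max_power k :: 'a set)"
    show "?b (v \<otimes> a) y \<in> ?F (i + j) (k + l)"
      by (rule tensor_subspace_induct[OF lin(2) csubspace_tensor_subspace _ that(2)])
        (use va in \<open>auto simp: brk_tensor intro!: pure_in_tensor_subspace brk_deg max_power_mult_max_power\<close>)
  qed
  show "dif (dgla_tensor K) x \<in> ?F (i + 1) k" if "x \<in> ?F i k" for x i k
    unfolding dif_dgla_tensor by (rule tm_subspace[OF dif_linear _ that]) (use dif_deg in auto)
  show "?b x y = - ((-1) powi (i * j) *\<^sub>C ?b y x)" if "x \<in> ?F i 0" "y \<in> ?F j 0" for x y i j
  proof (rule tensor_subspace_eq[OF lin(1) clinear_pointwise(3)[OF clinear_scaled[OF lin(2)]] _ that(1)])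
    fix v a assume v: "v \<in> deg K i"
    show "?b (v \<otimes> a) y = - ((-1) powi (i * j) *\<^sub>C ?b y (v \<otimes> a))"
    proof (rule tensor_subspace_eq[OF lin(2) clinear_pointwise(3)[OF clinear_scaled[OF lin(1)]] _ that(2)])
      fix w b assume "w \<in> deg K j"
      then show "?b (v \<otimes> a) (w \<otimes> b) = - ((-1) powi (i * j) *\<^sub>C ?b (w \<otimes> b) (v \<otimes> a))"
        using brk_skew[OF v]
        by (simp add: brk_tensor pure_tensor_scale_left cbilinear_minus_left[OF cbilinear_pure_tensor] mult.commute)
    qed
  qed
  show "?b x (?b y z) = ?b (?b x y) z + (-1) powi (i * j) *\<^sub>C ?b y (?b x z)"
    if "x \<in> ?F i 0" "y \<in> ?F j 0" "z \<in> ?F h 0" for x y z i j h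
  proof (rule tensor_subspace_eq[OF lin(1) _ _ that(1)])
    show "clinear (\<lambda>x. ?b (?b x y) z + (-1) powi (i * j) *\<^sub>C ?b y (?b x z))"
      by (intro clinear_pointwise(1) clinear_scaled clinear_comp[OF lin(1) lin(1)] clinear_comp[OF lin(2) lin(1)])
    fix v a assume v: "v \<in> deg K i"
    let ?x = "v \<otimes> a :: 'v \<otimes> 'a"
    show "?b ?x (?b y z) = ?b (?b ?x y) z + (-1) powi (i * j) *\<^sub>C ?b y (?b ?x z)"
    proof (rule tensor_subspace_eq[OF _ _ _ that(2)])
      show "clinear (\<lambda>y. ?b ?x (?b y z))" by (rule clinear_comp[OF lin(2) lin(1)])
      show "clinear (\<lambda>y. ?b (?b ?x y) z + (-1) powi (i * j) *\<^sub>C ?b y (?b ?x z))"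
        by (intro clinear_pointwise(1) clinear_scaled clinear_comp[OF lin(1) lin(2)] lin(1))
      fix w b assume w: "w \<in> deg K j"
      let ?y = "w \<otimes> b :: 'v \<otimes> 'a"
      show "?b ?x (?b ?y z) = ?b (?b ?x ?y) z + (-1) powi (i * j) *\<^sub>C ?b ?y (?b ?x z)"
      proof (rule tensor_subspace_eq[OF _ _ _ that(3)])
        show "clinear (\<lambda>z. ?b ?x (?b ?y z))" by (rule clinear_comp[OF lin(2) lin(2)])
        show "clinear (\<lambda>z. ?b (?b ?x ?y) z + (-1) powi (i * j) *\<^sub>C ?b ?y (?b ?x z))"
          by (intro clinear_pointwise(1) clinear_scaled clinear_comp[OF lin(2) lin(2)] lin(2))
        fix u c assume "u \<in> deg K h"
        then show "?b ?x (?b ?y (u \<otimes> c)) = ?b (?b ?x ?y) (u \<otimes> c) + (-1) powi (i * j) *\<^sub>C ?b ?y (?b ?x (u \<otimes> c))"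
          using brk_jacobi[OF v w]
          by (simp add: brk_tensor pure_tensor_add_left pure_tensor_scale_left mult_ac)
      qed
    qed
  qed
  show "dif (dgla_tensor K) (dif (dgla_tensor K) x) = 0" for x :: "'v \<otimes> 'a"
    by (simp add: dif_dgla_tensor tm_comp dif_linear dif_dif tm_zero)
  show "dif (dgla_tensor K) (?b x y) = ?b (dif (dgla_tensor K) x) y + (-1) powi i *\<^sub>C ?b x (dif (dgla_tensor K) y)"
    if "x \<in> ?F i 0" for x y i
    unfolding dif_dgla_tensor
  proof (rule tensor_subspace_eq[OF _ _ _ that])
    show "clinear (\<lambda>x. tm (dif K) (?b x y))" by (rule clinear_comp[OF dlin lin(1)])
    show "clinear (\<lambda>x. ?b (tm (dif K) x) y + (-1) powi i *\<^sub>C ?b x (tm (dif K) y))"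
      by (intro clinear_pointwise(1) clinear_scaled clinear_comp[OF lin(1) dlin] lin(1))
    fix v a assume v: "v \<in> deg K i"
    have "y \<in> tensor_subspace UNIV UNIV" by (simp add: tensor_subspace_UNIV)
    then show "tm (dif K) (?b (v \<otimes> a) y) = ?b (tm (dif K) (v \<otimes> a)) y + (-1) powi i *\<^sub>C ?b (v \<otimes> a) (tm (dif K) y)"
    proof (rule tensor_subspace_eq[rotated 3])
      show "clinear (\<lambda>y. tm (dif K) (?b (v \<otimes> a) y))" by (rule clinear_comp[OF dlin lin(2)])
      show "clinear (\<lambda>y. ?b (tm (dif K) (v \<otimes> a)) y + (-1) powi i *\<^sub>C ?b (v \<otimes> a) (tm (dif K) y))"
        by (intro clinear_pointwise(1) clinear_scaled clinear_comp[OF lin(2) dlin] lin(2))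
      fix w b
      show "tm (dif K) (?b (v \<otimes> a) (w \<otimes> b))
          = ?b (tm (dif K) (v \<otimes> a)) (w \<otimes> b) + (-1) powi i *\<^sub>C ?b (v \<otimes> a) (tm (dif K) (w \<otimes> b))"
        by (simp add: brk_tensor tm_pure dif_linear dif_brk[OF v] pure_tensor_add_left pure_tensor_scale_left)
    qed
  qed
qed (simp_all only: csubspace_tensor_subspace dif_dgla_tensor clinear_tm dif_linear)

lemma boundaries_tensor:
  "tensor_subspace (dif K ` deg K i) W = tm (dif K) ` tensor_subspace (deg K i) W"
proof
  have sub: "csubspace (tm (dif K) ` tensor_subspace (deg K i) W)"
  proof -
    interpret t: Vector_Spaces.linear scaleC scaleC "tm (dif K) :: 'v \<otimes> 'a \<Rightarrow> 'v \<otimes> 'a"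
      by (rule clinear_tm[OF dif_linear])
    show ?thesis by (rule t.subspace_image[OF csubspace_tensor_subspace])
  qed
  have "dif K v \<otimes> w \<in> tm (dif K) ` tensor_subspace (deg K i) W" if "v \<in> deg K i" "w \<in> W" for v w
    using that by (intro image_eqI[of _ _ "v \<otimes> w"]) (simp_all add: tm_pure dif_linear pure_in_tensor_subspace)
  then show "tensor_subspace (dif K ` deg K i) W \<subseteq> tm (dif K) ` tensor_subspace (deg K i) W"
    unfolding tensor_subspace_def[of "dif K ` deg K i"] by (intro cvec.span_minimal sub) auto
  show "tm (dif K) ` tensor_subspace (deg K i) W \<subseteq> tensor_subspace (dif K ` deg K i) W"
    using tm_subspace[OF dif_linear] by blast
qed

end

lemma filtered_dgla_hom_tensor:
  assumes "dgla K" "dgla K'" and f: "dgla_hom K K' f" and N: "0 < N" "max_power N = {0 :: 'a::local_artinian}"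
  shows "filtered_dgla_hom (dgla_tensor K) (tensor_filtration K :: int \<Rightarrow> nat \<Rightarrow> (_ \<otimes> 'a) set) N
    (dgla_tensor K') (tensor_filtration K') (tm f)"
proof -
  interpret K: dgla K by fact
  interpret K': dgla K' by fact
  have lin: "clinear f" and deg: "f ` deg K i \<subseteq> deg K' i" and brk: "f (brk K x y) = brk K' (f x) (f y)"
    and dif: "f (dif K x) = dif K' (f x)" for i x y
    using f by (auto simp: dgla_hom_def)
  show ?thesis
  proof (intro filtered_dgla_hom.intro filtered_dgla_hom_axioms.intro K.filtered_dgla_tensor
      K'.filtered_dgla_tensor N)
    show "clinear (tm f)" by (rule clinear_tm[OF lin])
    show "tm f x \<in> tensor_filtration K' i k" if "x \<in> tensor_filtration K i k" for x :: "_ \<otimes> 'a" and i k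
      by (rule tm_subspace[OF lin deg that])
    show "tm f (dif (dgla_tensor K) x) = dif (dgla_tensor K') (tm f x)" for x :: "_ \<otimes> 'a"
      by (simp add: dif_dgla_tensor tm_comp lin K.dif_linear K'.dif_linear dif)
    show "tm f (brk (dgla_tensor K) x y) = brk (dgla_tensor K') (tm f x) (tm f y)" for x y :: "_ \<otimes> 'a"
    proof (rule tensor_subspace_eq[where V = UNIV and W = UNIV and t = x])
      show "clinear (\<lambda>x. tm f (brk (dgla_tensor K) x y))"
        by (rule clinear_comp[OF clinear_tm[OF lin] K.brk_tensor_clinear(1)])
      show "clinear (\<lambda>x. brk (dgla_tensor K') (tm f x) (tm f y))"
        by (rule clinear_comp[OF K'.brk_tensor_clinear(1) clinear_tm[OF lin]])
      fix v and a :: 'a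
      show "tm f (brk (dgla_tensor K) (v \<otimes> a) y) = brk (dgla_tensor K') (tm f (v \<otimes> a)) (tm f y)"
      proof (rule tensor_subspace_eq[where V = UNIV and W = UNIV and t = y])
        show "clinear (\<lambda>y. tm f (brk (dgla_tensor K) (v \<otimes> a) y))"
          by (rule clinear_comp[OF clinear_tm[OF lin] K.brk_tensor_clinear(2)])
        show "clinear (\<lambda>y. brk (dgla_tensor K') (tm f (v \<otimes> a)) (tm f y))"
          by (rule clinear_comp[OF K'.brk_tensor_clinear(2) clinear_tm[OF lin]])
        fix w and b :: 'a
        show "tm f (brk (dgla_tensor K) (v \<otimes> a) (w \<otimes> b)) = brk (dgla_tensor K') (tm f (v \<otimes> a)) (tm f (w \<otimes> b))"
          by (simp only: K.brk_tensor K'.brk_tensor tm_pure[OF lin] brk)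
      qed (simp only: tensor_subspace_UNIV UNIV_I)
    qed (simp add: tensor_subspace_UNIV)
  qed
qed

text \<open>A change of coefficients is a morphism of filtered algebras like any other, and so the
  statements about squares of morphisms apply to it.\<close>

lemma filtered_dgla_hom_base_change:
  fixes \<phi> :: "'a::local_artinian \<Rightarrow> 'b::local_artinian"
  assumes "dgla K" and \<phi>: "algebra_hom \<phi>"
    and N: "0 < N" "max_power N = {0 :: 'a::local_artinian}" "max_power N = {0 :: 'b::local_artinian}"
  shows "filtered_dgla_hom (dgla_tensor K) (tensor_filtration K) N
    (dgla_tensor K) (tensor_filtration K) (tensor_map id \<phi>)"
proof -
  interpret K: dgla K by fact
  have lin: "clinear \<phi>" and mult: "\<phi> (x * y) = \<phi> x * \<phi> y" for x y
    using \<phi> by (auto simp: algebra_hom_def)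
  have tlin: "clinear (tensor_map id \<phi>)" by (rule clinear_tensor_map[OF clinear_id lin])
  show ?thesis
  proof (intro filtered_dgla_hom.intro filtered_dgla_hom_axioms.intro K.filtered_dgla_tensor N tlin)
    show "tensor_map id \<phi> x \<in> tensor_filtration K i k" if "x \<in> tensor_filtration K i k" for x i k
      by (rule tensor_map_subspace[OF clinear_id lin _ _ that]) (use algebra_hom_max_power[OF \<phi>] in auto)
    show "tensor_map id \<phi> (dif (dgla_tensor K) x) = dif (dgla_tensor K) (tensor_map id \<phi> x)" for x
      by (simp add: dif_dgla_tensor tensor_map_comp lin clinear_id K.dif_linear)
    show "tensor_map id \<phi> (brk (dgla_tensor K) x y)
        = brk (dgla_tensor K) (tensor_map id \<phi> x) (tensor_map id \<phi> y)" for x y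
    proof (rule tensor_subspace_eq[where V = UNIV and W = UNIV and t = x])
      show "clinear (\<lambda>x. tensor_map id \<phi> (brk (dgla_tensor K) x y))"
        by (rule clinear_comp[OF tlin K.brk_tensor_clinear(1)])
      show "clinear (\<lambda>x. brk (dgla_tensor K) (tensor_map id \<phi> x) (tensor_map id \<phi> y))"
        by (rule clinear_comp[OF K.brk_tensor_clinear(1) tlin])
      fix v a
      show "tensor_map id \<phi> (brk (dgla_tensor K) (v \<otimes> a) y)
          = brk (dgla_tensor K) (tensor_map id \<phi> (v \<otimes> a)) (tensor_map id \<phi> y)"
      proof (rule tensor_subspace_eq[where V = UNIV and W = UNIV and t = y])
        show "clinear (\<lambda>y. tensor_map id \<phi> (brk (dgla_tensor K) (v \<otimes> a) y))"
          by (rule clinear_comp[OF tlin K.brk_tensor_clinear(2)])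
        show "clinear (\<lambda>y. brk (dgla_tensor K) (tensor_map id \<phi> (v \<otimes> a)) (tensor_map id \<phi> y))"
          by (rule clinear_comp[OF K.brk_tensor_clinear(2) tlin])
        fix w b
        show "tensor_map id \<phi> (brk (dgla_tensor K) (v \<otimes> a) (w \<otimes> b))
            = brk (dgla_tensor K) (tensor_map id \<phi> (v \<otimes> a)) (tensor_map id \<phi> (w \<otimes> b))"
          by (simp only: K.brk_tensor tensor_map_pure[OF clinear_id lin] id_apply mult)
      qed (simp only: tensor_subspace_UNIV UNIV_I)
    qed (simp add: tensor_subspace_UNIV)
  qed
qed

section \<open>Maps of quotients\<close>

lemma quotient_map_class:
  assumes "equiv B r" "equiv A r'" "\<And>x y. (x, y) \<in> r' \<Longrightarrow> (g x, g y) \<in> r" "p \<in> A"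
  shows "quotient_map r g (r' `` {p}) = r `` {g p}"
proof
  show "quotient_map r g (r' `` {p}) \<subseteq> r `` {g p}"
    using assms(3) equivE[OF assms(1)] unfolding quotient_map_def by (blast dest: transD)
  have "p \<in> r' `` {p}" using equiv_class_self[OF assms(2,4)] .
  then show "r `` {g p} \<subseteq> quotient_map r g (r' `` {p})"
    unfolding quotient_map_def by blast
qed

lemma equiv_cohomologous:
  assumes "clinear \<delta>" "csubspace (C (i - 1))" "csubspace (C i)"
  shows "equiv (cocycles C \<delta> i) (cohomologous C \<delta> i)"
proof (rule equivI)
  show "cohomologous C \<delta> i \<subseteq> cocycles C \<delta> i \<times> cocycles C \<delta> i"
    by (auto simp: cohomologous_def)
  have 0: "0 \<in> \<delta> ` C (i - 1)"
    using csubspace_0[OF assms(2)] clinear_zero[OF assms(1)] by (metis image_eqI)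
  then show "refl_on (cocycles C \<delta> i) (cohomologous C \<delta> i)"
    by (auto simp: refl_on_def cohomologous_def)
  show "sym (cohomologous C \<delta> i)"
  proof (rule symI)
    fix x y assume xy: "(x, y) \<in> cohomologous C \<delta> i"
    then obtain c where "c \<in> C (i - 1)" "x - y = \<delta> c" by (auto simp: cohomologous_def)
    then have "- c \<in> C (i - 1)" "y - x = \<delta> (- c)"
      using csubspace_minus[OF assms(2)] clinear_minus[OF assms(1), of c] by (auto simp: minus_diff_eq[of x y, symmetric] simp del: minus_diff_eq)
    then show "(y, x) \<in> cohomologous C \<delta> i" using xy by (auto simp: cohomologous_def)
  qed
  show "trans (cohomologous C \<delta> i)"
  proof (rule transI)
    fix x y z assume xyz: "(x, y) \<in> cohomologous C \<delta> i" "(y, z) \<in> cohomologous C \<delta> i"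
    then obtain b c where "b \<in> C (i - 1)" "x - y = \<delta> b" "c \<in> C (i - 1)" "y - z = \<delta> c"
      by (auto simp: cohomologous_def)
    then have "b + c \<in> C (i - 1)" "x - z = \<delta> (b + c)"
      using csubspace_add[OF assms(2)] clinear_add[OF assms(1), of b c] by (auto simp: algebra_simps)
    then show "(x, z) \<in> cohomologous C \<delta> i" using xyz by (auto simp: cohomologous_def)
  qed
qed

lemma quasi_isomorphismD:
  assumes qi: "quasi_isomorphism C \<delta> D \<epsilon> g" and lin: "clinear \<delta>" "clinear \<epsilon>" "clinear g"
    and sub: "\<And>i. csubspace (C i)" "\<And>i. csubspace (D i)"
    and g: "\<And>i. g ` C i \<subseteq> D i" "\<And>x. g (\<delta> x) = \<epsilon> (g x)"
  shows "z \<in> C i \<Longrightarrow> \<delta> z = 0 \<Longrightarrow> g z \<in> \<epsilon> ` D (i - 1) \<Longrightarrow> z \<in> \<delta> ` C (i - 1)"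
    and "w \<in> D i \<Longrightarrow> \<epsilon> w = 0 \<Longrightarrow> \<exists>z\<in>C i. \<delta> z = 0 \<and> g z - w \<in> \<epsilon> ` D (i - 1)"
proof -
  let ?r = "cohomologous C \<delta> i" and ?s = "cohomologous D \<epsilon> i"
  note eC = equiv_cohomologous[where C = C and i = i, OF lin(1) sub(1) sub(1)] and eD = equiv_cohomologous[where C = D and i = i, OF lin(2) sub(2) sub(2)]
  have bij: "bij_betw (quotient_map ?s g) (cohomology C \<delta> i) (cohomology D \<epsilon> i)"
    using qi by (simp add: quasi_isomorphism_def)
  have cocycle: "g x \<in> cocycles D \<epsilon> i" if "x \<in> cocycles C \<delta> i" for x
    using that g clinear_zero[OF lin(3)] by (auto simp: cocycles_def g(2)[symmetric])
  have rel: "(g x, g y) \<in> ?s" if "(x, y) \<in> ?r" for x y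
  proof -
    from that obtain c where "c \<in> C (i - 1)" "x - y = \<delta> c" "x \<in> cocycles C \<delta> i" "y \<in> cocycles C \<delta> i"
      by (auto simp: cohomologous_def)
    moreover from this have "g x - g y = \<epsilon> (g c)" by (simp add: clinear_diff[OF lin(3), symmetric] g(2))
    ultimately show ?thesis using g(1) cocycle by (auto simp: cohomologous_def)
  qed
  have cls: "quotient_map ?s g (?r `` {x}) = ?s `` {g x}" if "x \<in> cocycles C \<delta> i" for x
    by (rule quotient_map_class[OF eD eC _ that]) (rule rel)
  show "z \<in> \<delta> ` C (i - 1)" if "z \<in> C i" "\<delta> z = 0" "g z \<in> \<epsilon> ` D (i - 1)"
  proof -
    have z: "z \<in> cocycles C \<delta> i" and 0: "0 \<in> cocycles C \<delta> i"
      using that csubspace_0[OF sub(1)] clinear_zero[OF lin(1)] by (auto simp: cocycles_def)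
    have "(g z, g 0) \<in> ?s"
      using cocycle[OF z] cocycle[OF 0] that(3) by (simp add: cohomologous_def clinear_zero[OF lin(3)])
    then have same: "quotient_map ?s g (?r `` {z}) = quotient_map ?s g (?r `` {0})"
      using cls[OF z] cls[OF 0] equiv_class_eq[OF eD] by simp
    have "?r `` {z} = ?r `` {0}"
      by (rule inj_onD[OF bij_betw_imp_inj_on[OF bij] same]) (simp_all add: cohomology_def quotientI z 0)
    then have "(z, 0) \<in> ?r" using eq_equiv_class[OF _ eC 0] by blast
    then show ?thesis by (simp add: cohomologous_def)
  qed
  show "\<exists>z\<in>C i. \<delta> z = 0 \<and> g z - w \<in> \<epsilon> ` D (i - 1)" if "w \<in> D i" "\<epsilon> w = 0"
  proof -
    have w: "w \<in> cocycles D \<epsilon> i" using that by (simp add: cocycles_def)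
    then have "?s `` {w} \<in> quotient_map ?s g ` cohomology C \<delta> i"
      using bij_betw_imp_surj_on[OF bij] by (simp add: cohomology_def quotientI)
    then obtain z where z: "z \<in> cocycles C \<delta> i" "?s `` {w} = quotient_map ?s g (?r `` {z})"
      unfolding cohomology_def by (auto elim!: quotientE)
    then have "?s `` {g z} = ?s `` {w}" using cls by simp
    then have "(g z, w) \<in> ?s" by (rule eq_equiv_class[OF _ eD w])
    then show ?thesis using z(1) by (auto simp: cohomologous_def cocycles_def)
  qed
qed

section \<open>The total complex of the square\<close>

lemma dgla_hom_deg: "dgla_hom K K' g \<Longrightarrow> x \<in> deg K i \<Longrightarrow> g x \<in> deg K' i"
  unfolding dgla_hom_def by (elim conjE) (blast dest: spec)

locale dgla_square =
  L: dgla L + M: dgla M + H: dgla H + I: dgla I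
  for L :: "'l::complex_vector dgla_data" and M :: "'m::complex_vector dgla_data"
    and H :: "'h::complex_vector dgla_data" and I :: "'i::complex_vector dgla_data" +
  fixes \<chi> \<eta> f f'
  assumes chi: "dgla_hom L M \<chi>" and eta: "dgla_hom H I \<eta>" and f: "dgla_hom L H f" and f': "dgla_hom M I f'"
    and square: "\<eta> \<circ> f = f' \<circ> \<chi>"
    and qi: "quasi_isomorphism (cone L M) (cone_dif L M \<chi>) (cone H I) (cone_dif H I \<eta>) (map_prod f f')"
begin

lemma linear: "clinear \<chi>" "clinear \<eta>" "clinear f" "clinear f'"
  using chi eta f f' by (auto simp: dgla_hom_def)

lemma hom_deg: "x \<in> deg L i \<Longrightarrow> \<chi> x \<in> deg M i" "y \<in> deg H i \<Longrightarrow> \<eta> y \<in> deg I i"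
  "x \<in> deg L i \<Longrightarrow> f x \<in> deg H i" "z \<in> deg M i \<Longrightarrow> f' z \<in> deg I i"
  by (rule dgla_hom_deg[OF chi] dgla_hom_deg[OF eta] dgla_hom_deg[OF f] dgla_hom_deg[OF f'], assumption)+

lemma hom_dif: "\<chi> (dif L x) = dif M (\<chi> x)" "\<eta> (dif H y) = dif I (\<eta> y)" "f (dif L x) = dif H (f x)"
  "f' (dif M z) = dif I (f' z)"
  using chi eta f f' by (auto simp: dgla_hom_def)

lemma square': "\<eta> (f x) = f' (\<chi> x)"
  using square by (simp add: fun_eq_iff)

lemmas linear_maps = linear L.dif_linear M.dif_linear H.dif_linear I.dif_linear

lemmas linear_simps = linear_maps[THEN clinear_add] linear_maps[THEN clinear_diff]
  linear_maps[THEN clinear_minus] linear_maps[THEN clinear_zero] linear_maps[THEN clinear_scale]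

text \<open>The mapping cone of \<open>C\<^sub>\<chi> \<rightarrow> C\<^sub>\<eta>\<close>, with \<open>C\<^sub>\<chi>\<close> in its own degree and with the negative of its
  differential, so that \<open>C\<^sub>\<eta>\<close> keeps its sign.\<close>

definition Tdeg :: "int \<Rightarrow> ('l \<times> 'm \<times> 'h \<times> 'i) set"
  where "Tdeg i = deg L i \<times> deg M (i - 1) \<times> deg H (i - 1) \<times> deg I (i - 2)"

definition Tdif :: "'l \<times> 'm \<times> 'h \<times> 'i \<Rightarrow> 'l \<times> 'm \<times> 'h \<times> 'i"
  where "Tdif = (\<lambda>(l, m, h, w). (- dif L l, - (\<chi> l - dif M m), f l + dif H h, f' m + (\<eta> h - dif I w)))"

lemma csubspace_Times: "csubspace S \<Longrightarrow> csubspace T \<Longrightarrow> csubspace (S \<times> T)"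
  by (rule csubspaceI) (auto simp: csubspace_0 csubspace_add csubspace_scale zero_prod_def)

lemma csubspace_Tdeg: "csubspace (Tdeg i)"
  unfolding Tdeg_def
  by (intro csubspace_Times L.deg_subspace M.deg_subspace H.deg_subspace I.deg_subspace)

lemma clinear_Tdif: "clinear Tdif"
  by (rule clinearI) (auto simp: Tdif_def linear_simps scaleC_simps algebra_simps split: prod.splits)

text \<open>A cocycle of the cone is a cocycle \<open>(l, m)\<close> of \<open>C\<^sub>\<chi>\<close> with a cochain \<open>(h, w)\<close> that exhibits its
  image as a boundary. Injectivity gives \<open>(l, m) = \<delta>(c\<^sub>1, c\<^sub>2)\<close>; then \<open>(h, w)\<close> plus the image of
  \<open>(c\<^sub>1, c\<^sub>2)\<close> is a cocycle, which by surjectivity comes from \<open>C\<^sub>\<chi>\<close> up to a boundary.\<close>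

lemma acyclic:
  assumes t: "t \<in> Tdeg i" "Tdif t = 0"
  shows "\<exists>s\<in>Tdeg (i - 1). Tdif s = t"
proof -
  let ?d = "cone_dif L M \<chi>" and ?e = "cone_dif H I \<eta>" and ?g = "map_prod f f'"
  have lin: "clinear ?d" "clinear ?e" "clinear ?g"
    by (rule clinearI; auto simp: cone_dif_def linear_simps scaleC_simps algebra_simps)+
  have sub: "csubspace (cone L M i)" "csubspace (cone H I i)" for i
    unfolding cone_def
    by (intro csubspace_Times L.deg_subspace M.deg_subspace H.deg_subspace I.deg_subspace)+
  have g: "?g ` cone L M i \<subseteq> cone H I i" "?g (?d x) = ?e (?g x)" for i x
    by (auto simp: cone_def hom_deg) (cases x, simp add: cone_dif_def linear_simps hom_dif square')
  note inj = quasi_isomorphismD(1)[OF qi lin sub g] and surj = quasi_isomorphismD(2)[OF qi lin sub g]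
  obtain l m h w where te: "t = (l, m, h, w)" and mem: "l \<in> deg L i" "m \<in> deg M (i - 1)" "h \<in> deg H (i - 1)"
    "w \<in> deg I (i - 2)" using t(1) by (auto simp: Tdeg_def)
  have "dif L l = 0" "\<chi> l - dif M m = 0" "f l + dif H h = 0" "f' m + (\<eta> h - dif I w) = 0"
    using t(2) by (simp_all add: te Tdif_def zero_prod_def)
  then have 0: "dif L l = 0" "\<chi> l - dif M m = 0" "f l = - dif H h" "f' m = - (\<eta> h - dif I w)"
    by (simp_all only: eq_neg_iff_add_eq_0)
  have "(l, m) \<in> ?d ` cone L M (i - 1)"
  proof (rule inj)
    show "(l, m) \<in> cone L M i" using mem by (simp add: cone_def)
    show "?d (l, m) = 0" using 0 by (simp add: cone_dif_def zero_prod_def)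
    show "?g (l, m) \<in> ?e ` cone H I (i - 1)"
    proof (rule image_eqI)
      show "?g (l, m) = ?e (- h, - w)" using 0 by (simp add: cone_dif_def linear_simps)
      show "(- h, - w) \<in> cone H I (i - 1)"
        using mem by (simp add: cone_def csubspace_minus H.deg_subspace I.deg_subspace)
    qed
  qed
  then obtain c1 c2 where c: "c1 \<in> deg L (i - 1)" "c2 \<in> deg M (i - 2)" "l = dif L c1" "m = \<chi> c1 - dif M c2"
    by (auto simp: cone_def cone_dif_def)
  have "\<exists>z\<in>cone L M (i - 1). ?d z = 0 \<and> ?g z - (f c1 + h, f' c2 + w) \<in> ?e ` cone H I (i - 1 - 1)"
  proof (rule surj)
    show "(f c1 + h, f' c2 + w) \<in> cone H I (i - 1)"
      using mem c by (simp add: cone_def hom_deg csubspace_add H.deg_subspace I.deg_subspace)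
    show "?e (f c1 + h, f' c2 + w) = 0"
      using 0 c(3,4) by (simp add: cone_dif_def linear_simps zero_prod_def hom_dif square' algebra_simps)
  qed
  then obtain z1 z2 e1 e2 where z: "z1 \<in> deg L (i - 1)" "z2 \<in> deg M (i - 2)" "dif L z1 = 0" "\<chi> z1 = dif M z2"
    and e: "e1 \<in> deg H (i - 2)" "e2 \<in> deg I (i - 3)"
      "f z1 - (f c1 + h) = dif H e1" "f' z2 - (f' c2 + w) = \<eta> e1 - dif I e2"
    by (auto simp: cone_def cone_dif_def zero_prod_def)
  have h: "h = f z1 - f c1 - dif H e1" and w: "w = f' z2 - f' c2 - (\<eta> e1 - dif I e2)"
    using e(3,4) by (simp_all add: algebra_simps)
  show ?thesis
  proof (rule bexI)
    show "Tdif (z1 - c1, z2 - c2, - e1, - e2) = t"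
      by (simp add: Tdif_def te h w linear_simps z(3,4) c(3,4))
    show "(z1 - c1, z2 - c2, - e1, - e2) \<in> Tdeg (i - 1)"
      using z c e by (simp add: Tdeg_def csubspace_diff csubspace_minus L.deg_subspace M.deg_subspace
          H.deg_subspace I.deg_subspace)
  qed
qed

text \<open>Choose linear right inverses \<open>\<sigma>\<close> and \<open>\<rho>\<close> of the differential on its images in degrees
  \<open>i + 1\<close> and \<open>i\<close>. Then \<open>t - \<sigma>(Tdif t)\<close> is a cocycle, hence a boundary, and
  \<open>\<kappa> t = \<rho> (t - \<sigma>(Tdif t))\<close> bounds it.\<close>

lemma contraction:
  "\<exists>\<kappa> \<sigma>. clinear \<kappa> \<and> clinear \<sigma> \<and> range \<kappa> \<subseteq> Tdeg (i - 1) \<and> range \<sigma> \<subseteq> Tdeg i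
    \<and> (\<forall>t\<in>Tdeg i. Tdif (\<kappa> t) + \<sigma> (Tdif t) = t)"
proof -
  have pair: "vector_space_pair (scaleC :: complex \<Rightarrow> 'l \<times> 'm \<times> 'h \<times> 'i \<Rightarrow> _) (scaleC :: complex \<Rightarrow> 'l \<times> 'm \<times> 'h \<times> 'i \<Rightarrow> _)"
    by (rule vector_space_pair.intro[OF cvec.vector_space_axioms cvec.vector_space_axioms])
  have inv: "\<exists>\<sigma>. range \<sigma> \<subseteq> Tdeg j \<and> clinear \<sigma> \<and> (\<forall>t\<in>Tdif ` Tdeg j. Tdif (\<sigma> t) = t)" for j
    by (rule vector_space_pair.linear_exists_right_inverse_on[OF pair clinear_Tdif csubspace_Tdeg])
  from inv[of i] obtain \<sigma> where \<sigma>: "range \<sigma> \<subseteq> Tdeg i" "clinear \<sigma>" "\<And>t. t \<in> Tdeg i \<Longrightarrow> Tdif (\<sigma> (Tdif t)) = Tdif t"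
    by blast
  from inv[of "i - 1"] obtain \<rho> where \<rho>: "range \<rho> \<subseteq> Tdeg (i - 1)" "clinear \<rho>"
    "\<And>t. t \<in> Tdeg (i - 1) \<Longrightarrow> Tdif (\<rho> (Tdif t)) = Tdif t"
    by blast
  define \<kappa> where "\<kappa> t = \<rho> (t - \<sigma> (Tdif t))" for t
  have "Tdif (\<kappa> t) + \<sigma> (Tdif t) = t" if t: "t \<in> Tdeg i" for t
  proof -
    have "t - \<sigma> (Tdif t) \<in> Tdeg i" using t \<sigma>(1) by (intro csubspace_diff csubspace_Tdeg) auto
    moreover have "Tdif (t - \<sigma> (Tdif t)) = 0" by (simp add: clinear_diff[OF clinear_Tdif] \<sigma>(3)[OF t])
    ultimately obtain s where "s \<in> Tdeg (i - 1)" "Tdif s = t - \<sigma> (Tdif t)" using acyclic by blast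
    then show ?thesis using \<rho>(3)[of s] by (simp add: \<kappa>_def)
  qed
  moreover have "clinear \<kappa>"
    unfolding \<kappa>_def
    by (intro clinear_comp[OF \<rho>(2)] clinear_pointwise clinear_comp[OF \<sigma>(2) clinear_Tdif])
  moreover have "range \<kappa> \<subseteq> Tdeg (i - 1)" using \<rho>(1) by (auto simp: \<kappa>_def)
  ultimately show ?thesis using \<sigma>(1,2) by blast
qed

text \<open>The inclusions and projections of the four summands. They replace an identification of
  \<open>(L \<oplus> M \<oplus> H \<oplus> I) \<otimes> A\<close> with a sum of four tensor products.\<close>

definition inL :: "'l \<Rightarrow> 'l \<times> 'm \<times> 'h \<times> 'i" where "inL x = (x, 0, 0, 0)"
definition inM :: "'m \<Rightarrow> 'l \<times> 'm \<times> 'h \<times> 'i" where "inM x = (0, x, 0, 0)"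
definition inH :: "'h \<Rightarrow> 'l \<times> 'm \<times> 'h \<times> 'i" where "inH x = (0, 0, x, 0)"
definition inI :: "'i \<Rightarrow> 'l \<times> 'm \<times> 'h \<times> 'i" where "inI x = (0, 0, 0, x)"
definition prL :: "'l \<times> 'm \<times> 'h \<times> 'i \<Rightarrow> 'l" where "prL t = fst t"
definition prM :: "'l \<times> 'm \<times> 'h \<times> 'i \<Rightarrow> 'm" where "prM t = fst (snd t)"
definition prH :: "'l \<times> 'm \<times> 'h \<times> 'i \<Rightarrow> 'h" where "prH t = fst (snd (snd t))"
definition prI :: "'l \<times> 'm \<times> 'h \<times> 'i \<Rightarrow> 'i" where "prI t = snd (snd (snd t))"

lemmas in_pr_defs = inL_def inM_def inH_def inI_def prL_def prM_def prH_def prI_def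

lemma linear_in_pr: "clinear inL" "clinear inM" "clinear inH" "clinear inI"
  "clinear prL" "clinear prM" "clinear prH" "clinear prI"
  by (auto simp: in_pr_defs clinear_iff scaleC_prod_def)

lemma pr_in:
  "prL (inL x) = x" "prL (inM y) = 0" "prL (inH z) = 0" "prL (inI w) = 0"
  "prM (inL x) = 0" "prM (inM y) = y" "prM (inH z) = 0" "prM (inI w) = 0"
  "prH (inL x) = 0" "prH (inM y) = 0" "prH (inH z) = z" "prH (inI w) = 0"
  "prI (inL x) = 0" "prI (inM y) = 0" "prI (inH z) = 0" "prI (inI w) = w"
  by (simp_all add: in_pr_defs)

lemma Tdif_in:
  "Tdif (inL x) = inH (f x) - (inL (dif L x) + inM (\<chi> x))"
  "Tdif (inM y) = inM (dif M y) + inI (f' y)"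
  "Tdif (inH z) = inH (dif H z) + inI (\<eta> z)"
  "Tdif (inI w) = - inI (dif I w)"
  by (simp_all add: in_pr_defs Tdif_def linear_simps)

lemma pr_Tdif:
  "prL (Tdif t) = - dif L (prL t)" "prM (Tdif t) = - (\<chi> (prL t) - dif M (prM t))"
  "prH (Tdif t) = f (prL t) + dif H (prH t)" "prI (Tdif t) = f' (prM t) + (\<eta> (prH t) - dif I (prI t))"
  by (simp_all add: in_pr_defs Tdif_def split: prod.splits)

text \<open>Write \<open>t\<close> for the element \<open>(o1, o2, r1, r2)\<close> of the cone, and \<open>s = \<kappa> t\<close>. The contraction gives
  \<open>t - Tdif s = \<sigma>(Tdif t)\<close>. By assumption \<open>Tdif t\<close> has coefficients in \<open>W'\<close>, and \<open>\<sigma>\<close>, being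
  extended from a linear map, does not change coefficients.\<close>

theorem acyclic_tensor:
  fixes W W' :: "'a::complex_vector set"
  assumes o: "o1 \<in> tensor_subspace (deg L i) W" "o2 \<in> tensor_subspace (deg M (i - 1)) W"
      "r1 \<in> tensor_subspace (deg H (i - 1)) W" "r2 \<in> tensor_subspace (deg I (i - 2)) W"
    and \<delta>: "tm (dif L) o1 \<in> tensor_subspace (deg L (i + 1)) W'"
      "tm \<chi> o1 - tm (dif M) o2 \<in> tensor_subspace (deg M i) W'"
      "tm f o1 + tm (dif H) r1 \<in> tensor_subspace (deg H i) W'"
      "tm f' o2 + (tm \<eta> r1 - tm (dif I) r2) \<in> tensor_subspace (deg I (i - 1)) W'"
  shows "\<exists>c1 \<in> tensor_subspace (deg L (i - 1)) W. \<exists>c2 \<in> tensor_subspace (deg M (i - 2)) W.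
    \<exists>e1 \<in> tensor_subspace (deg H (i - 2)) W. \<exists>e2 \<in> tensor_subspace (deg I (i - 3)) W.
      o1 + tm (dif L) c1 \<in> tensor_subspace (deg L i) W'
      \<and> o2 + (tm \<chi> c1 - tm (dif M) c2) \<in> tensor_subspace (deg M (i - 1)) W'
      \<and> r1 - tm f c1 - tm (dif H) e1 \<in> tensor_subspace (deg H (i - 1)) W'
      \<and> r2 - tm f' c2 - (tm \<eta> e1 - tm (dif I) e2) \<in> tensor_subspace (deg I (i - 2)) W'"
proof -
  obtain \<kappa> \<sigma> where \<kappa>\<sigma>: "clinear \<kappa>" "clinear \<sigma>" "range \<kappa> \<subseteq> Tdeg (i - 1)" "range \<sigma> \<subseteq> Tdeg i"
    "\<And>t. t \<in> Tdeg i \<Longrightarrow> Tdif (\<kappa> t) + \<sigma> (Tdif t) = t" using contraction[of i] by blast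
  note lin = linear_maps linear_in_pr clinear_Tdif \<kappa>\<sigma>(1,2)
  note tm_lin = lin[THEN clinear_tm]
  note tm_simps = tm_lin[THEN clinear_add] tm_lin[THEN clinear_diff] tm_lin[THEN clinear_minus]
  define t where "t = tm inL o1 + tm inM o2 + tm inH r1 + tm inI r2"
  define s where "s = tm \<kappa> t"
  have z: "0 \<in> deg L j" "0 \<in> deg M j" "0 \<in> deg H j" "0 \<in> deg I j" for j
    by (simp_all add: csubspace_0 L.deg_subspace M.deg_subspace H.deg_subspace I.deg_subspace)
  have tT: "t \<in> tensor_subspace (Tdeg i) W"
    unfolding t_def
    by (intro csubspace_add[OF csubspace_tensor_subspace] tm_subspace[OF linear_in_pr(1) _ o(1)]
        tm_subspace[OF linear_in_pr(2) _ o(2)] tm_subspace[OF linear_in_pr(3) _ o(3)]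
        tm_subspace[OF linear_in_pr(4) _ o(4)])
      (auto simp: Tdeg_def in_pr_defs z)
  have pr_t: "tm prL t = o1" "tm prM t = o2" "tm prH t = r1" "tm prI t = r2"
    by (simp_all only: t_def tm_simps tm_comp linear_in_pr pr_in tm_zero tm_ident add_0_left add_0_right)
  have "tm Tdif t = tm inL (- tm (dif L) o1) + tm inM (- (tm \<chi> o1 - tm (dif M) o2))
      + tm inH (tm f o1 + tm (dif H) r1) + tm inI (tm f' o2 + (tm \<eta> r1 - tm (dif I) r2))"
    by (simp only: t_def tm_simps tm_comp lin Tdif_in tm_add tm_diff tm_minus clinear_comp clinear_pointwise)
      (simp add: algebra_simps)
  also have "\<dots> \<in> tensor_subspace UNIV W'"
    by (intro csubspace_add[OF csubspace_tensor_subspace]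
        tm_subspace[OF linear_in_pr(1) subset_UNIV csubspace_minus[OF csubspace_tensor_subspace \<delta>(1)]]
        tm_subspace[OF linear_in_pr(2) subset_UNIV csubspace_minus[OF csubspace_tensor_subspace \<delta>(2)]]
        tm_subspace[OF linear_in_pr(3) subset_UNIV \<delta>(3)] tm_subspace[OF linear_in_pr(4) subset_UNIV \<delta>(4)])
  finally have Tt: "tm \<sigma> (tm Tdif t) \<in> tensor_subspace (Tdeg i) W'"
    by (rule tm_subspace[OF \<kappa>\<sigma>(2,4)])
  have "tm (\<lambda>x. Tdif (\<kappa> x) + \<sigma> (Tdif x)) t = tm (\<lambda>x. x) t"
    by (rule tm_eqI[OF _ _ _ tT])
      (intro clinear_pointwise clinear_comp[OF clinear_Tdif \<kappa>\<sigma>(1)] clinear_comp[OF \<kappa>\<sigma>(2) clinear_Tdif],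
        rule clinear_pointwise, rule \<kappa>\<sigma>(5))
  then have "tm Tdif s + tm \<sigma> (tm Tdif t) = t"
    by (simp only: s_def tm_comp lin tm_add clinear_comp tm_ident)
  then have eq: "t - tm Tdif s = tm \<sigma> (tm Tdif t)" by (metis add_diff_cancel_left')
  have rest: "tm prL (t - tm Tdif s) \<in> tensor_subspace (deg L i) W'"
    "tm prM (t - tm Tdif s) \<in> tensor_subspace (deg M (i - 1)) W'"
    "tm prH (t - tm Tdif s) \<in> tensor_subspace (deg H (i - 1)) W'"
    "tm prI (t - tm Tdif s) \<in> tensor_subspace (deg I (i - 2)) W'"
    unfolding eq
    by (rule tm_subspace[OF linear_in_pr(5) _ Tt] tm_subspace[OF linear_in_pr(6) _ Tt]
        tm_subspace[OF linear_in_pr(7) _ Tt] tm_subspace[OF linear_in_pr(8) _ Tt];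
        auto simp: Tdeg_def in_pr_defs)+
  have sT: "s \<in> tensor_subspace (Tdeg (i - 1)) W"
    unfolding s_def by (rule tm_subspace[OF \<kappa>\<sigma>(1) _ tT]) (use \<kappa>\<sigma>(3) in blast)
  have comps: "tm prL s \<in> tensor_subspace (deg L (i - 1)) W" "tm prM s \<in> tensor_subspace (deg M (i - 2)) W"
    "tm prH s \<in> tensor_subspace (deg H (i - 2)) W" "tm prI s \<in> tensor_subspace (deg I (i - 3)) W"
    by (rule tm_subspace[OF linear_in_pr(5) _ sT] tm_subspace[OF linear_in_pr(6) _ sT]
        tm_subspace[OF linear_in_pr(7) _ sT] tm_subspace[OF linear_in_pr(8) _ sT];
        auto simp: Tdeg_def in_pr_defs)+
  have pr_s: "tm prL (tm Tdif s) = - tm (dif L) (tm prL s)"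
    "tm prM (tm Tdif s) = - (tm \<chi> (tm prL s) - tm (dif M) (tm prM s))"
    "tm prH (tm Tdif s) = tm f (tm prL s) + tm (dif H) (tm prH s)"
    "tm prI (tm Tdif s) = tm f' (tm prM s) + (tm \<eta> (tm prH s) - tm (dif I) (tm prI s))"
    by (simp_all only: tm_comp lin pr_Tdif tm_add tm_diff tm_minus clinear_comp clinear_pointwise)
  have "o1 + tm (dif L) (tm prL s) \<in> tensor_subspace (deg L i) W'"
    using rest(1) unfolding clinear_diff[OF clinear_tm[OF linear_in_pr(5)]] pr_t pr_s diff_minus_eq_add .
  moreover have "o2 + (tm \<chi> (tm prL s) - tm (dif M) (tm prM s)) \<in> tensor_subspace (deg M (i - 1)) W'"
    using rest(2) unfolding clinear_diff[OF clinear_tm[OF linear_in_pr(6)]] pr_t pr_s diff_minus_eq_add .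
  moreover have "r1 - tm f (tm prL s) - tm (dif H) (tm prH s) \<in> tensor_subspace (deg H (i - 1)) W'"
    using rest(3) unfolding clinear_diff[OF clinear_tm[OF linear_in_pr(7)]] pr_t pr_s diff_diff_eq .
  moreover have "r2 - tm f' (tm prM s) - (tm \<eta> (tm prH s) - tm (dif I) (tm prI s))
      \<in> tensor_subspace (deg I (i - 2)) W'"
    using rest(4) unfolding clinear_diff[OF clinear_tm[OF linear_in_pr(8)]] pr_t pr_s diff_diff_eq .
  ultimately show ?thesis
    by (rule_tac bexI[OF bexI[OF bexI[OF bexI[OF _ comps(4)] comps(3)] comps(2)] comps(1)]) (intro conjI)
qed

text \<open>Apply to \<open>c\<close> the extension of a linear right inverse of the differential on its image; this
  does not change the coefficients.\<close>

lemma strict_boundaries_tensor: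
  assumes "c \<in> tm (dif I) ` tensor_subspace (deg I j) W" "c \<in> tensor_subspace V W'"
  shows "c \<in> tm (dif I) ` tensor_subspace (deg I j) W'"
proof -
  obtain \<tau> where \<tau>: "range \<tau> \<subseteq> deg I j" "clinear \<tau>" "\<And>x. x \<in> deg I j \<Longrightarrow> dif I (\<tau> (dif I x)) = dif I x"
    using vector_space_pair.linear_exists_right_inverse_on[OF
        vector_space_pair.intro[OF cvec.vector_space_axioms cvec.vector_space_axioms]
        I.dif_linear I.deg_subspace, of j]
    by blast
  note lin = I.dif_linear \<tau>(2)
  obtain m where m: "m \<in> tensor_subspace (deg I j) W" "c = tm (dif I) m" using assms(1) by blast
  have "tm (\<lambda>x. dif I (\<tau> (dif I x))) m = tm (dif I) m"
    by (rule tm_eqI[OF clinear_comp[OF lin(1) clinear_comp[OF lin(2,1)]] lin(1) _ m(1)]) (rule \<tau>(3))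
  then have "tm (dif I) (tm \<tau> c) = c"
    by (simp only: m(2) tm_comp lin clinear_comp)
  moreover have "tm \<tau> c \<in> tensor_subspace (deg I j) W'"
    by (rule tm_subspace[OF \<tau>(2) _ assms(2)]) (use \<tau>(1) in blast)
  ultimately show ?thesis by (metis image_eqI)
qed

end

section \<open>Invariance of the deformation functor under quasi-isomorphism\<close>

lemma (in dgla_square) filtered_square_tensor:
  assumes N: "0 < N" "max_power N = {0 :: 'a::local_artinian}"
  shows "filtered_square (dgla_tensor L) (tensor_filtration L :: int \<Rightarrow> nat \<Rightarrow> ('l \<otimes> 'a) set) N
    (dgla_tensor M) (tensor_filtration M) (tm \<chi>) (dgla_tensor H) (tensor_filtration H)
    (dgla_tensor I) (tensor_filtration I) (tm \<eta>) (tm f) (tm f')"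
proof (intro filtered_square.intro filtered_square_axioms.intro hom_square.intro hom_square_axioms.intro
    filtered_dgla_hom_tensor N L.dgla_axioms M.dgla_axioms H.dgla_axioms I.dgla_axioms chi eta f f')
  show "tm \<eta> (tm f x) = tm f' (tm \<chi> x)" for x :: "'l \<otimes> 'a"
    by (simp only: tm_comp linear square')
next
  fix o1 :: "'l \<otimes> 'a" and o2 :: "'m \<otimes> 'a" and r1 :: "'h \<otimes> 'a" and r2 :: "'i \<otimes> 'a" and i k
  assume "o1 \<in> tensor_filtration L i k" "o2 \<in> tensor_filtration M (i - 1) k"
    "r1 \<in> tensor_filtration H (i - 1) k" "r2 \<in> tensor_filtration I (i - 2) k"
    "dif (dgla_tensor L) o1 \<in> tensor_filtration L (i + 1) (Suc k)"
    "tm \<chi> o1 - dif (dgla_tensor M) o2 \<in> tensor_filtration M i (Suc k)"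
    "tm f o1 + dif (dgla_tensor H) r1 \<in> tensor_filtration H i (Suc k)"
    "tm f' o2 + (tm \<eta> r1 - dif (dgla_tensor I) r2) \<in> tensor_filtration I (i - 1) (Suc k)"
  then show "\<exists>c1\<in>tensor_filtration L (i - 1) k. \<exists>c2\<in>tensor_filtration M (i - 2) k.
      \<exists>e1\<in>tensor_filtration H (i - 2) k. \<exists>e2\<in>tensor_filtration I (i - 3) k.
        o1 + dif (dgla_tensor L) c1 \<in> tensor_filtration L i (Suc k)
        \<and> o2 + (tm \<chi> c1 - dif (dgla_tensor M) c2) \<in> tensor_filtration M (i - 1) (Suc k)
        \<and> r1 - tm f c1 - dif (dgla_tensor H) e1 \<in> tensor_filtration H (i - 1) (Suc k)
        \<and> r2 - tm f' c2 - (tm \<eta> e1 - dif (dgla_tensor I) e2) \<in> tensor_filtration I (i - 2) (Suc k)"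
    unfolding dif_dgla_tensor by (rule acyclic_tensor)
next
  fix c :: "'i \<otimes> 'a" and k
  assume "c \<in> dif (dgla_tensor I) ` tensor_filtration I (-1) 1" "c \<in> tensor_filtration I 0 k"
  then show "c \<in> dif (dgla_tensor I) ` tensor_filtration I (-1) k"
    unfolding dif_dgla_tensor by (rule strict_boundaries_tensor)
qed

text \<open>The next two lemmas identify the functor \<open>Def\<close> at \<open>A\<close> with the groupoid of the filtered
  algebras \<open>L \<otimes> A\<close> and \<open>M \<otimes> A\<close>.\<close>

lemma MC_cone_tensor:
  assumes "filtered_dgla_hom (dgla_tensor L) (tensor_filtration L) N
    (dgla_tensor M) (tensor_filtration M) (tm \<chi> :: 'l::complex_vector \<otimes> 'a::local_artinian \<Rightarrow> 'm::complex_vector \<otimes> 'a)"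
  shows "(MC_cone L M \<chi> :: (('l \<otimes> 'a) \<times> ('m \<otimes> 'a)) set)
    = filtered_dgla_hom.MC (dgla_tensor L) (tensor_filtration L) (dgla_tensor M) (tensor_filtration M) (tm \<chi>)"
proof -
  interpret filtered_dgla_hom "dgla_tensor L" "tensor_filtration L" N "dgla_tensor M" "tensor_filtration M" "tm \<chi> :: 'l \<otimes> 'a \<Rightarrow> 'm \<otimes> 'a"
    by (rule assms)
  show ?thesis by (simp only: MC_def MC_cone_def src.curv_def deg_dgla_tensor)
qed

lemma gauge_equivalent_tensor:
  assumes "dgla M" and hom: "filtered_dgla_hom (dgla_tensor L) (tensor_filtration L) N
    (dgla_tensor M) (tensor_filtration M) (tm \<chi> :: 'l::complex_vector \<otimes> 'a::local_artinian \<Rightarrow> 'm::complex_vector \<otimes> 'a)"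
  shows "(gauge_equivalent L M \<chi> :: ((('l \<otimes> 'a) \<times> ('m \<otimes> 'a)) \<times> (('l \<otimes> 'a) \<times> ('m \<otimes> 'a))) set)
    = filtered_dgla_hom.equivalent (dgla_tensor L) (tensor_filtration L) (dgla_tensor M) (tensor_filtration M) (tm \<chi>)"
proof -
  interpret filtered_dgla_hom "dgla_tensor L" "tensor_filtration L" N "dgla_tensor M" "tensor_filtration M" "tm \<chi> :: 'l \<otimes> 'a \<Rightarrow> 'm \<otimes> 'a"
    by (rule hom)
  have "cone_action L M \<chi> = act" by (simp only: cone_action_def act_def)
  moreover have "tensor_subspace (deg L 0) max_ideal \<times> tensor_subspace (dif M ` deg M (-1)) max_ideal = grp"
    by (simp only: dgla.boundaries_tensor[OF assms(1)] dif_dgla_tensor max_power_1)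
  ultimately show ?thesis
    by (simp only: gauge_equivalent_def equivalent_def MC_cone_tensor[OF hom])
qed

context dgla_square
begin

lemma Def_trans_class:
  assumes sq: "filtered_square (dgla_tensor L) (tensor_filtration L :: int \<Rightarrow> nat \<Rightarrow> ('l \<otimes> 'a::local_artinian) set) N
    (dgla_tensor M) (tensor_filtration M) (tm \<chi>) (dgla_tensor H) (tensor_filtration H)
    (dgla_tensor I) (tensor_filtration I) (tm \<eta>) (tm f) (tm f')"
    and p: "p \<in> (MC_cone L M \<chi> :: (('l \<otimes> 'a) \<times> ('m \<otimes> 'a)) set)"
  shows "Def_trans H I \<eta> f f' (gauge_equivalent L M \<chi> `` {p})
    = gauge_equivalent H I \<eta> `` {map_prod (tm f) (tm f') p}"
proof -
  interpret filtered_square "dgla_tensor L" "tensor_filtration L :: int \<Rightarrow> nat \<Rightarrow> ('l \<otimes> 'a) set" N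
    "dgla_tensor M" "tensor_filtration M" "tm \<chi>" "dgla_tensor H" "tensor_filtration H"
    "dgla_tensor I" "tensor_filtration I" "tm \<eta>" "tm f" "tm f'" by (rule sq)
  have "p \<in> chi.MC" using p by (simp only: MC_cone_tensor[OF chi.filtered_dgla_hom_axioms])
  then have "quotient_map eta.equivalent \<Phi> (chi.equivalent `` {p}) = eta.equivalent `` {\<Phi> p}"
    by (intro quotient_map_class[OF eta.equiv_equivalent chi.equiv_equivalent] map_equivalent)
  then show ?thesis
    by (simp only: Def_trans_def gauge_equivalent_tensor[OF M.dgla_axioms chi.filtered_dgla_hom_axioms]
        gauge_equivalent_tensor[OF I.dgla_axioms eta.filtered_dgla_hom_axioms])
qed

theorem Def_trans_bij:
  "bij_betw (Def_trans H I \<eta> f f')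
    (Def L M \<chi> :: (('l \<otimes> 'a::local_artinian) \<times> ('m \<otimes> 'a)) set set) (Def H I \<eta>)"
proof -
  obtain N0 where N0: "max_power N0 = {0 :: 'a}" using max_power_nilpotent by blast
  \<comment> \<open>the filtered algebras require a positive bound\<close>
  define N where "N = Suc N0"
  have "max_power N \<subseteq> {0 :: 'a}" unfolding N0[symmetric] by (rule max_power_antimono) (simp add: N_def)
  then have N: "0 < N" "max_power N = {0 :: 'a}"
    using csubspace_0[OF csubspace_max_power] by (auto simp: N_def simp del: max_power.simps)
  note sq = filtered_square_tensor[OF N]
  interpret filtered_square "dgla_tensor L" "tensor_filtration L :: int \<Rightarrow> nat \<Rightarrow> ('l \<otimes> 'a) set" N
    "dgla_tensor M" "tensor_filtration M" "tm \<chi>" "dgla_tensor H" "tensor_filtration H"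
    "dgla_tensor I" "tensor_filtration I" "tm \<eta>" "tm f" "tm f'" by (rule sq)
  note MCs = MC_cone_tensor[OF chi.filtered_dgla_hom_axioms] MC_cone_tensor[OF eta.filtered_dgla_hom_axioms]
    and eqs = gauge_equivalent_tensor[OF M.dgla_axioms chi.filtered_dgla_hom_axioms]
      gauge_equivalent_tensor[OF I.dgla_axioms eta.filtered_dgla_hom_axioms]
  note cls = Def_trans_class[OF sq, unfolded MCs eqs]
  show ?thesis
    unfolding bij_betw_def Def_def MCs eqs
  proof (intro conjI inj_onI)
    fix X Y assume "X \<in> chi.MC // chi.equivalent" "Y \<in> chi.MC // chi.equivalent"
      and XY: "Def_trans H I \<eta> f f' X = Def_trans H I \<eta> f f' Y"
    then obtain p q where p: "p \<in> chi.MC" "X = chi.equivalent `` {p}" and q: "q \<in> chi.MC" "Y = chi.equivalent `` {q}"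
      by (elim quotientE) blast
    have "(\<Phi> p, \<Phi> q) \<in> eta.equivalent"
      using XY eq_equiv_class[OF _ eta.equiv_equivalent map_MC[OF q(1)], of "\<Phi> p"]
      by (simp only: p(2) q(2) cls[OF p(1)] cls[OF q(1)])
    then have "(p, q) \<in> chi.equivalent" by (rule injective[OF p(1) q(1)])
    then show "X = Y" unfolding p(2) q(2) by (rule equiv_class_eq[OF chi.equiv_equivalent])
  next
    show "Def_trans H I \<eta> f f' ` (chi.MC // chi.equivalent) = eta.MC // eta.equivalent"
    proof (intro set_eqI iffI)
      fix Y assume "Y \<in> Def_trans H I \<eta> f f' ` (chi.MC // chi.equivalent)"
      then obtain X where "X \<in> chi.MC // chi.equivalent" "Y = Def_trans H I \<eta> f f' X" by blast
      then obtain p where "p \<in> chi.MC" "Y = Def_trans H I \<eta> f f' (chi.equivalent `` {p})"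
        by (elim quotientE) blast
      then show "Y \<in> eta.MC // eta.equivalent"
        using quotientI[OF map_MC] by (simp only: cls)
    next
      fix Y assume "Y \<in> eta.MC // eta.equivalent"
      then obtain q where q: "q \<in> eta.MC" "Y = eta.equivalent `` {q}" by (elim quotientE)
      obtain p where p: "p \<in> chi.MC" "(\<Phi> p, q) \<in> eta.equivalent" using surjective[OF q(1)] by blast
      have "Y = Def_trans H I \<eta> f f' (chi.equivalent `` {p})"
        unfolding cls[OF p(1)] q(2) by (rule equiv_class_eq[OF eta.equiv_equivalent p(2), symmetric])
      then show "Y \<in> Def_trans H I \<eta> f f' ` (chi.MC // chi.equivalent)"
        using quotientI[OF p(1)] by blast
    qed
  qed
qed

end

text \<open>The maps \<open>\<chi> \<otimes> A\<close> and \<open>\<chi> \<otimes> B\<close> form a commutative square with \<open>id \<otimes> \<phi>\<close>, so \<open>id \<otimes> \<phi>\<close> respects Maurer--Cartan pairs and gauge equivalence.\<close>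

lemma Def_mor_class:
  fixes \<phi> :: "'a::local_artinian \<Rightarrow> 'b::local_artinian" and L :: "'l::complex_vector dgla_data"
    and M :: "'m::complex_vector dgla_data"
  assumes dglas: "dgla L" "dgla M" "dgla_hom L M \<chi>" and \<phi>: "algebra_hom \<phi>"
    and N: "0 < N" "max_power N = {0 :: 'a}" "max_power N = {0 :: 'b}"
    and p: "p \<in> MC_cone L M \<chi>"
  shows "Def_mor L M \<chi> \<phi> (gauge_equivalent L M \<chi> `` {p})
      = gauge_equivalent L M \<chi> `` {map_prod (tensor_map id \<phi>) (tensor_map id \<phi>) p}"
    and "map_prod (tensor_map id \<phi>) (tensor_map id \<phi>) p \<in> MC_cone L M \<chi>"
proof -
  have lin: "clinear \<phi>" "clinear \<chi>" using \<phi> dglas(3) by (auto simp: algebra_hom_def dgla_hom_def)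
  interpret hom_square "dgla_tensor L" "tensor_filtration L" N "dgla_tensor M" "tensor_filtration M"
    "tm \<chi> :: 'l \<otimes> 'a \<Rightarrow> 'm \<otimes> 'a" "dgla_tensor L" "tensor_filtration L" "dgla_tensor M" "tensor_filtration M"
    "tm \<chi> :: 'l \<otimes> 'b \<Rightarrow> 'm \<otimes> 'b" "tensor_map id \<phi>" "tensor_map id \<phi>"
  proof (intro hom_square.intro hom_square_axioms.intro filtered_dgla_hom_tensor dglas N
      filtered_dgla_hom_base_change \<phi>)
    show "tm \<chi> (tensor_map id \<phi> x) = tensor_map id \<phi> (tm \<chi> x)" for x
      unfolding tensor_map_comp[OF lin(2) clinear_id clinear_id lin(1)]
        tensor_map_comp[OF clinear_id lin(2) lin(1) clinear_id] by (simp only: id_apply)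
  qed
  note MCs = MC_cone_tensor[OF chi.filtered_dgla_hom_axioms] MC_cone_tensor[OF eta.filtered_dgla_hom_axioms]
    and eqs = gauge_equivalent_tensor[OF dglas(2) chi.filtered_dgla_hom_axioms]
      gauge_equivalent_tensor[OF dglas(2) eta.filtered_dgla_hom_axioms]
  show "map_prod (tensor_map id \<phi>) (tensor_map id \<phi>) p \<in> MC_cone L M \<chi>"
    using map_MC p unfolding MCs .
  have "p \<in> chi.MC" using p by (simp only: MCs)
  then have "quotient_map eta.equivalent \<Phi> (chi.equivalent `` {p}) = eta.equivalent `` {\<Phi> p}"
    by (intro quotient_map_class[OF eta.equiv_equivalent chi.equiv_equivalent] map_equivalent)
  then show "Def_mor L M \<chi> \<phi> (gauge_equivalent L M \<chi> `` {p})
      = gauge_equivalent L M \<chi> `` {map_prod (tensor_map id \<phi>) (tensor_map id \<phi>) p}"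
    by (simp only: Def_mor_def eqs)
qed

text \<open>On representatives, both composites apply \<open>f \<otimes> \<phi>\<close> and \<open>f' \<otimes> \<phi>\<close>.\<close>

theorem (in dgla_square) Def_trans_natural:
  fixes \<phi> :: "'a::local_artinian \<Rightarrow> 'b::local_artinian"
  assumes \<phi>: "algebra_hom \<phi>" and X: "X \<in> Def L M \<chi>"
  shows "Def_trans H I \<eta> f f' (Def_mor L M \<chi> \<phi> X) = Def_mor H I \<eta> \<phi> (Def_trans H I \<eta> f f' X)"
proof -
  obtain N1 N2 where N12: "max_power N1 = {0 :: 'a}" "max_power N2 = {0 :: 'b}"
    using max_power_nilpotent[where ?'a = 'a] max_power_nilpotent[where ?'a = 'b] by blast
  define N where "N = Suc (max N1 N2)"
  have le: "N1 \<le> N" "N2 \<le> N" by (simp_all add: N_def)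
  have "max_power N \<subseteq> {0 :: 'a}" "max_power N \<subseteq> {0 :: 'b}"
    using max_power_antimono[OF le(1), where ?'a = 'a] max_power_antimono[OF le(2), where ?'a = 'b] N12 by simp_all
  then have N: "0 < N" "max_power N = {0 :: 'a}" "max_power N = {0 :: 'b}"
    using csubspace_0[OF csubspace_max_power] by (auto simp: N_def simp del: max_power.simps)
  obtain p where p: "p \<in> MC_cone L M \<chi>" "X = gauge_equivalent L M \<chi> `` {p}"
    using X unfolding Def_def by (elim quotientE)
  have lin\<phi>: "clinear \<phi>" using \<phi> by (simp add: algebra_hom_def)
  interpret sq: filtered_square "dgla_tensor L" "tensor_filtration L :: int \<Rightarrow> nat \<Rightarrow> ('l \<otimes> 'a) set" N
    "dgla_tensor M" "tensor_filtration M" "tm \<chi>" "dgla_tensor H" "tensor_filtration H"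
    "dgla_tensor I" "tensor_filtration I" "tm \<eta>" "tm f" "tm f'" by (rule filtered_square_tensor[OF N(1,2)])
  have p': "map_prod (tm f) (tm f') p \<in> MC_cone H I \<eta>"
    using sq.map_MC p(1)
    unfolding MC_cone_tensor[OF sq.chi.filtered_dgla_hom_axioms] MC_cone_tensor[OF sq.eta.filtered_dgla_hom_axioms] .
  have comm: "tm g (tensor_map id \<phi> x) = tensor_map id \<phi> (tm g x)" if "clinear g"
    for g :: "'v::complex_vector \<Rightarrow> 'w::complex_vector" and x
    unfolding tensor_map_comp[OF that clinear_id clinear_id lin\<phi>]
      tensor_map_comp[OF clinear_id that lin\<phi> clinear_id] by (simp only: id_apply)
  show ?thesis
    unfolding p(2)
      Def_mor_class(1)[OF L.dgla_axioms M.dgla_axioms chi \<phi> N p(1)]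
      Def_trans_class[OF filtered_square_tensor[OF N(1,3)]
        Def_mor_class(2)[OF L.dgla_axioms M.dgla_axioms chi \<phi> N p(1)]]
      Def_trans_class[OF filtered_square_tensor[OF N(1,2)] p(1)]
      Def_mor_class(1)[OF H.dgla_axioms I.dgla_axioms eta \<phi> N p']
    by (cases p) (simp only: map_prod_simp comm linear)
qed

theorem theorem2p1:
  fixes L :: "'l::complex_vector dgla_data" and M :: "'m::complex_vector dgla_data"
    and H :: "'h::complex_vector dgla_data" and I :: "'i::complex_vector dgla_data"
    and \<chi> :: "'l \<Rightarrow> 'm" and \<eta> :: "'h \<Rightarrow> 'i" and f :: "'l \<Rightarrow> 'h" and f' :: "'m \<Rightarrow> 'i"
  assumes "dgla L" "dgla M" "dgla H" "dgla I"
    and "dgla_hom L M \<chi>" "dgla_hom H I \<eta>" "dgla_hom L H f" "dgla_hom M I f'"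
    and "\<eta> \<circ> f = f' \<circ> \<chi>"
    and "quasi_isomorphism (cone L M) (cone_dif L M \<chi>) (cone H I) (cone_dif H I \<eta>) (map_prod f f')"
  shows "bij_betw (Def_trans H I \<eta> f f')
           (Def L M \<chi> :: (('l \<otimes> 'a::local_artinian) \<times> ('m \<otimes> 'a)) set set)
           (Def H I \<eta>)
    \<and> (\<forall>\<phi> :: 'a \<Rightarrow> 'b::local_artinian. algebra_hom \<phi> \<longrightarrow>
         (\<forall>X \<in> Def L M \<chi>.
            Def_trans H I \<eta> f f' (Def_mor L M \<chi> \<phi> X) = Def_mor H I \<eta> \<phi> (Def_trans H I \<eta> f f' X)))"
proof -
  interpret dgla_square L M H I \<chi> \<eta> f f'
    by (intro dgla_square.intro dgla_square_axioms.intro assms)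
  show ?thesis using Def_trans_bij Def_trans_natural by blast
qed

end
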